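(* Every alternating non-split link diagram without a nugatory crossing is $H$-$(0,0)$-thick and $H$-$1$-thick.
   Context: Khovanov homology (framed unoriented version). A link diagram $D$ is a diagram on the disc of an unoriented framed link in the 3-ball. A Kauffman state $s$ of $D$ assigns to each crossing a marker $+1$ or $-1$. The smoothing of a crossing given by a positive marker joins the two regions swept out when the over-strand is rotated counterclockwise towards the under-strand (Kauffman's $A$-smoothing); a negative marker gives the other smoothing. $D_s$ is the system of circles obtained by smoothing all crossings according to $s$, $|s|$ is the number of circles of $D_s$, and $\sigma(s)$ is the number of positive markers minus the number of negative markers. $s_+$ (resp. $s_-$) is the state with all markers positive (resp. negative). An enhanced state $S$ is a Kauffman state $s$ with a sign $+$ or $-$ assigned to each circle of $D_s$; $D_S=D_s$, $\sigma(S)=\sigma(s)$, and $\tau(S)$ is the number of positive circles minus the number of negative circles. $\mathcal{C}_{i,j}(D)$ is the free abelian group on the enhanced states $S$ with $\sigma(S)=i$ and $\sigma(S)+2\tau(S)=j$. After ordering the crossings, $d_{i,j}:\mathcal{C}_{i,j}(D)\to\mathcal{C}_{i-2,j}(D)$ is $d(S)=\sum_{S'}(-1)^{t(S:S')}[S:S']S'$, summed over enhanced states $S'$ generating $\mathcal{C}_{i-2,j}(D)$, where $[S:S']=1$ if the markers of $S$ and $S'$ differ at exactly one crossing $c$ and all circles of $D_S$ and $D_{S'}$ not touching $c$ have the same signs in $S$ and $S'$, and $[S:S']=0$ otherwise; $t(S:S')$ is the number of negative markers of $S$ at crossings bigger than $c$. $H_{i,j}(D)=\ker(d_{i,j})/d_{i+2,j}(\mathcal{C}_{i+2,j}(D))$.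 Thickness. A link diagram $D$ with $N$ crossings is $H$-$(k_1,k_2)$-thick if $H_{i,j}(D)=0$ with a possible exception of $i,j$ satisfying $N-2|s_-|-4k_2\le j-2i\le 2|s_+|-N+4k_1$. $D$ is $H$-$k$-thick if it is $H$-$(k_1,k_2)$-thick for some $k_1,k_2$ with $k\ge k_1+k_2+\frac12(|s_+|+|s_-|-N)$. A crossing is nugatory if some simple closed curve in the plane meets the diagram only at that crossing, transversally, and separates the rest of the diagram into two nonempty parts. A non-split diagram is one that is connected as a planar graph. *)

theory Defs
  imports Complex_Main "HOL-Algebra.Free_Abelian_Groups"
begin

section \<open>Link diagrams\<close>

text \<open>
  Unoriented link diagrams are given by planar diagram codes. A half-edge is a pair \<open>(c, k)\<close> of a
  crossing \<open>c\<close> and a slot \<open>k < 4\<close>. The four slots of a crossing are numbered counterclockwise;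
  slots 0 and 2 lie on the under-strand, slots 1 and 3 on the over-strand. \<open>arc_at D (c, k)\<close> is
  the arc (edge of the 4-valent plane graph) leaving \<open>c\<close> at slot \<open>k\<close>. An arc that is attached to
  no crossing is a crossingless closed component.

  The crossings are natural numbers, and their order is the one used for the signs of the
  differential; since the labels are arbitrary, every ordering of the crossings is covered.
  The framing is the blackboard framing, so it carries no extra data.
\<close>

record link_diagram =
  crossings :: "nat set"
  arcs :: "nat set"
  arc_at :: "nat \<times> nat \<Rightarrow> nat"

definition half_edges :: "link_diagram \<Rightarrow> (nat \<times> nat) set" where
  "half_edges D = crossings D \<times> {..<4}"

text \<open>
  A pair \<open>(c, k)\<close> also denotes the corner at \<open>c\<close> between slot \<open>k\<close> and slot \<open>k + 1\<close> (mod 4).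
  Leaving \<open>c\<close> along slot \<open>k + 1\<close>, this corner lies on the right; if the arc ends at the half-edge
  \<open>(c', k')\<close>, the next corner of the same region is the one counterclockwise of \<open>(c', k')\<close>.
  So the classes of corners are the boundary cycles of regions.
\<close>

definition corner_step :: "link_diagram \<Rightarrow> ((nat \<times> nat) \<times> (nat \<times> nat)) set" where
  "corner_step D = {((c, k), h). (c, k) \<in> half_edges D \<and> h \<in> half_edges D \<and>
     h \<noteq> (c, (k + 1) mod 4) \<and> arc_at D h = arc_at D (c, (k + 1) mod 4)}"

definition faces :: "link_diagram \<Rightarrow> (nat \<times> nat) set set" where
  "faces D = half_edges D // (corner_step D)\<^sup>*"

definition meeting_arcs :: "link_diagram \<Rightarrow> (nat \<times> nat) set" where
  "meeting_arcs D =
     {(arc_at D (c, k), arc_at D (c, l)) | c k l. c \<in> crossings D \<and> k < 4 \<and> l < 4}"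

definition non_split :: "link_diagram \<Rightarrow> bool" where
  "non_split D \<longleftrightarrow> (\<forall>a\<in>arcs D. \<forall>b\<in>arcs D. (a, b) \<in> (meeting_arcs D)\<^sup>*)"

text \<open>
  Planarity: the connected components of the underlying 4-valent graph (crossingless circles left
  aside) each satisfy \<open>V - E + F \<le> 2\<close>, with equality exactly in genus 0. Hence the summed Euler
  formula below says that every component is drawn in the sphere, equivalently in the disc (the
  choice of the outer region is irrelevant to everything that follows).
\<close>

definition planar :: "link_diagram \<Rightarrow> bool" where
  "planar D \<longleftrightarrow>
     card (crossings D) + card (faces D) =
     card (arc_at D ` half_edges D) + 2 * card ((arc_at D ` half_edges D) // (meeting_arcs D)\<^sup>*)"

definition is_link_diagram :: "link_diagram \<Rightarrow> bool" where
  "is_link_diagram D \<longleftrightarrow>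
     finite (crossings D) \<and> finite (arcs D) \<and>
     arc_at D ` half_edges D \<subseteq> arcs D \<and>
     (\<forall>a\<in>arcs D. card {h \<in> half_edges D. arc_at D h = a} \<in> {0, 2}) \<and>
     planar D"

text \<open>Every arc between two crossing passages runs from an over-passage to an under-passage.\<close>

definition alternating :: "link_diagram \<Rightarrow> bool" where
  "alternating D \<longleftrightarrow>
     (\<forall>(c, k)\<in>half_edges D. \<forall>(c', k')\<in>half_edges D.
        (c, k) \<noteq> (c', k') \<and> arc_at D (c, k) = arc_at D (c', k') \<longrightarrow> even k \<noteq> even k')"

text \<open>
  A simple closed curve meeting the diagram only at \<open>c\<close>, transversally, leaves \<open>c\<close> through two
  opposite corners, \<open>k\<close> and \<open>k + 2\<close>, and otherwise stays within one region. \<open>A\<close> and \<open>B\<close> are the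
  arcs of the diagram on its two sides; they are nonempty because each side contains two of the four
  half-edges at \<open>c\<close>.
\<close>

definition nugatory :: "link_diagram \<Rightarrow> nat \<Rightarrow> bool" where
  "nugatory D c \<longleftrightarrow> c \<in> crossings D \<and>
     (\<exists>k<2. (\<exists>f\<in>faces D. (c, k) \<in> f \<and> (c, k + 2) \<in> f) \<and>
       (\<exists>A B. A \<union> B = arcs D \<and> A \<inter> B = {} \<and>
          {arc_at D (c, k + 1), arc_at D (c, k + 2)} \<subseteq> A \<and>
          {arc_at D (c, (k + 3) mod 4), arc_at D (c, k)} \<subseteq> B \<and>
          (\<forall>c'\<in>crossings D - {c}.
             (\<forall>l<4. arc_at D (c', l) \<in> A) \<or> (\<forall>l<4. arc_at D (c', l) \<in> B))))"


section \<open>Kauffman states\<close>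

definition kauffman_states :: "link_diagram \<Rightarrow> (nat \<Rightarrow> int) set" where
  "kauffman_states D = crossings D \<rightarrow>\<^sub>E {1, -1}"

text \<open>
  Rotating the over-strand (slots 1 and 3) counterclockwise sweeps out the corner between slots 1 and
  2 and the corner between slots 3 and 0. Joining these two regions leaves the strands 0--1 and 2--3.
\<close>

definition smoothing :: "int \<Rightarrow> nat set set" where
  "smoothing m = (if m = 1 then {{0, 1}, {2, 3}} else {{1, 2}, {3, 0}})"

definition smoothed_arcs :: "link_diagram \<Rightarrow> (nat \<Rightarrow> int) \<Rightarrow> (nat \<times> nat) set" where
  "smoothed_arcs D s =
     {(arc_at D (c, k), arc_at D (c, l)) | c k l. c \<in> crossings D \<and> {k, l} \<in> smoothing (s c)}"

text \<open>A circle of the smoothed diagram is represented by the set of arcs it is made of.\<close>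

definition circles :: "link_diagram \<Rightarrow> (nat \<Rightarrow> int) \<Rightarrow> nat set set" where
  "circles D s = arcs D // (smoothed_arcs D s)\<^sup>*"

definition touches :: "link_diagram \<Rightarrow> nat set \<Rightarrow> nat \<Rightarrow> bool" where
  "touches D C c \<longleftrightarrow> (\<exists>k<4. arc_at D (c, k) \<in> C)"

definition s_plus :: "link_diagram \<Rightarrow> nat \<Rightarrow> int" where
  "s_plus D = (\<lambda>c\<in>crossings D. 1)"

definition s_minus :: "link_diagram \<Rightarrow> nat \<Rightarrow> int" where
  "s_minus D = (\<lambda>c\<in>crossings D. -1)"


section \<open>Khovanov homology\<close>

type_synonym enhanced_state = "(nat \<Rightarrow> int) \<times> (nat set \<Rightarrow> int)"

definition enhanced_states :: "link_diagram \<Rightarrow> enhanced_state set" where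
  "enhanced_states D = (SIGMA s:kauffman_states D. circles D s \<rightarrow>\<^sub>E {1, -1})"

definition sigma :: "link_diagram \<Rightarrow> enhanced_state \<Rightarrow> int" where
  "sigma D S = (\<Sum>c\<in>crossings D. fst S c)"

definition tau :: "link_diagram \<Rightarrow> enhanced_state \<Rightarrow> int" where
  "tau D S = (\<Sum>C\<in>circles D (fst S). snd S C)"

definition generators :: "link_diagram \<Rightarrow> int \<Rightarrow> int \<Rightarrow> enhanced_state set" where
  "generators D i j = {S \<in> enhanced_states D. sigma D S = i \<and> sigma D S + 2 * tau D S = j}"

definition chain_group :: "link_diagram \<Rightarrow> int \<Rightarrow> int \<Rightarrow> (enhanced_state \<Rightarrow>\<^sub>0 int) monoid" where
  "chain_group D i j = free_Abelian_group (generators D i j)"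

definition changed :: "link_diagram \<Rightarrow> enhanced_state \<Rightarrow> enhanced_state \<Rightarrow> nat set" where
  "changed D S S' = {c \<in> crossings D. fst S c \<noteq> fst S' c}"

definition incidence :: "link_diagram \<Rightarrow> enhanced_state \<Rightarrow> enhanced_state \<Rightarrow> int" where
  "incidence D S S' =
     (if \<exists>c. changed D S S' = {c} \<and>
           (\<forall>C \<in> circles D (fst S) \<union> circles D (fst S'). \<not> touches D C c \<longrightarrow> snd S C = snd S' C)
      then 1 else 0)"

text \<open>Used only when the markers of the two states differ at exactly one crossing.\<close>

definition t_exponent :: "link_diagram \<Rightarrow> enhanced_state \<Rightarrow> enhanced_state \<Rightarrow> nat" where
  "t_exponent D S S' =
     card {b \<in> crossings D. fst S b = -1 \<and> (\<forall>c\<in>changed D S S'. c < b)}"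

definition differential ::
    "link_diagram \<Rightarrow> int \<Rightarrow> int \<Rightarrow> (enhanced_state \<Rightarrow>\<^sub>0 int) \<Rightarrow> (enhanced_state \<Rightarrow>\<^sub>0 int)" where
  "differential D i j =
     frag_extend (\<lambda>S. \<Sum>S'\<in>generators D (i - 2) j.
       frag_cmul ((-1) ^ t_exponent D S S' * incidence D S S') (frag_of S'))"

definition khovanov_homology ::
    "link_diagram \<Rightarrow> int \<Rightarrow> int \<Rightarrow> (enhanced_state \<Rightarrow>\<^sub>0 int) set monoid" where
  "khovanov_homology D i j =
     subgroup_generated (chain_group D i j)
       (kernel (chain_group D i j) (chain_group D (i - 2) j) (differential D i j))
     Mod (differential D (i + 2) j ` carrier (chain_group D (i + 2) j))"


section \<open>Thickness\<close>

definition H_thick2 :: "link_diagram \<Rightarrow> int \<Rightarrow> int \<Rightarrow> bool" where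
  "H_thick2 D k1 k2 \<longleftrightarrow>
     (\<forall>i j.
        \<not> (int (card (crossings D)) - 2 * int (card (circles D (s_minus D))) - 4 * k2 \<le> j - 2 * i \<and>
           j - 2 * i \<le> 2 * int (card (circles D (s_plus D))) - int (card (crossings D)) + 4 * k1)
        \<longrightarrow> trivial_group (khovanov_homology D i j))"

definition H_thick :: "link_diagram \<Rightarrow> real \<Rightarrow> bool" where
  "H_thick D k \<longleftrightarrow>
     (\<exists>k1 k2. H_thick2 D k1 k2 \<and>
        k \<ge> real_of_int k1 + real_of_int k2 +
            (real (card (circles D (s_plus D))) + real (card (circles D (s_minus D)))
              - real (card (crossings D))) / 2)"

end

theory Submission
  imports Defs
begin

text \<open>
  The proof follows the idea behind Lee's theorem that alternating links have thin Khovanov homology: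
  resolving crossings one at a time, with the long exact sequence of the two smoothings, never moves
  the two diagonals \<open>j - 2i = 2|s\<^sub>+| - N\<close> and \<open>j - 2i = 2|s\<^sub>+| - N - 4\<close>.

  The geometry enters once. By Euler's formula a connected diagram has \<open>N + 2\<close> faces, and in an alternating
  diagram the faces are the circles of \<open>s\<^sub>+\<close> and \<open>s\<^sub>-\<close>; so \<open>|s\<^sub>+| + |s\<^sub>-| = N + 2\<close>
  (\<open>alternating_turaev_genus_zero\<close>). In particular the two bounds in the definition of thickness differ by
  four, which also gives the second claim. For a partial resolution with \<open>n\<close> unresolved crossings and
  \<open>k\<close> components, the number \<open>n + 2k - |s\<^sub>+| - |s\<^sub>-|\<close> is nonnegative and does not increase when a crossing is
  resolved (\<open>genus_defect_resolve_le\<close>). It is therefore \<open>0\<close> for all partial resolutions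
  (\<open>genus_defect_zero\<close>). This replaces planarity in everything that follows: every change of a marker
  merges two circles or splits one, and connected resolutions all have the same two diagonals
  (\<open>top_diagonal_resolve\<close>).

  The induction (\<open>cells_exact\<close>) runs over connected partial resolutions. If both smoothings of some
  crossing are connected, the exact sequence applies (\<open>exact_extension\<close>). Otherwise every unresolved crossing can be
  smoothed so that the resolution falls apart; then some crossing is a kink, a circle attached at one
  point (\<open>exists_kink\<close>), and it is removed by cancelling an isomorphism between two parts of the complex
  (\<open>positive_kink.exact\<close>, \<open>negative_kink.exact\<close>).

  Both steps need \<open>d\<^sup>2 = 0\<close>. Instead of a case distinction over the possible configurations of two crossings,
  the algebra \<open>\<int>[x]/(x\<^sup>2)\<close> of Khovanov homology is deformed to \<open>\<int>[x]/(x\<^sup>2 - x)\<close>. The chain groups of the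
  deformation consist of functions on labellings of the circles by \<open>0\<close> and \<open>1\<close>. Merging is restriction
  and splitting is extension by zero with signs, so that squares commute for simple reasons
  (\<open>edge_weight_square\<close>). Khovanov's differential is the part of top degree of the deformed one
  (\<open>edge_cases\<close>), which gives the squares of the original cube (\<open>edge_square\<close>).
\<close>

section \<open>Partial resolutions and their circles\<close>

text \<open>
  A partial resolution gives each crossing a marker or \<open>0\<close>, which stands for an unresolved crossing.
  A set of arcs is compatible with a marker when it is a union of strands near the crossing; at an
  unresolved crossing it has to contain all four arcs or none.
\<close>

definition compatible :: "int \<Rightarrow> (nat \<Rightarrow> bool) \<Rightarrow> bool" where
  "compatible m u \<longleftrightarrow>
     (if m = 1 then (u 0 \<longleftrightarrow> u 1) \<and> (u 2 \<longleftrightarrow> u 3)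
      else if m = 0 then (u 0 \<longleftrightarrow> u 1) \<and> (u 1 \<longleftrightarrow> u 2) \<and> (u 2 \<longleftrightarrow> u 3)
      else (u 1 \<longleftrightarrow> u 2) \<and> (u 3 \<longleftrightarrow> u 0))"

text \<open>
  Everything about circles is expressed through the closed sets, the unions of circles. They form a
  Boolean algebra, and changing a marker changes which closed sets are allowed at one crossing only,
  so no paths along the diagram have to be followed.
\<close>

definition closed_arcs :: "link_diagram \<Rightarrow> (nat \<Rightarrow> int) \<Rightarrow> nat set \<Rightarrow> bool" where
  "closed_arcs D p U \<longleftrightarrow>
     U \<subseteq> arcs D \<and> (\<forall>c\<in>crossings D. compatible (p c) (\<lambda>k. arc_at D (c, k) \<in> U))"

definition component :: "link_diagram \<Rightarrow> (nat \<Rightarrow> int) \<Rightarrow> nat \<Rightarrow> nat set" where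
  "component D p a = {b \<in> arcs D. \<forall>U. closed_arcs D p U \<longrightarrow> a \<in> U \<longrightarrow> b \<in> U}"

definition components :: "link_diagram \<Rightarrow> (nat \<Rightarrow> int) \<Rightarrow> nat set set" where
  "components D p = component D p ` arcs D"

definition refines :: "link_diagram \<Rightarrow> (nat \<Rightarrow> int) \<Rightarrow> (nat \<Rightarrow> int) \<Rightarrow> bool" where
  "refines D p q \<longleftrightarrow> (\<forall>c\<in>crossings D. q c \<noteq> 0 \<longrightarrow> p c = q c)"

text \<open>The two strands of a smoothing of \<open>c\<close> always pass through slots \<open>0\<close> and \<open>2\<close> respectively.\<close>

definition separates :: "link_diagram \<Rightarrow> (nat \<Rightarrow> int) \<Rightarrow> nat \<Rightarrow> int \<Rightarrow> bool" where
  "separates D p c m \<longleftrightarrow> arc_at D (c, 2) \<notin> component D (p(c := m)) (arc_at D (c, 0))"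

lemma sum_lessThan_4: "(\<Sum>k<4. f k) = f 0 + f 1 + f 2 + (f 3 :: nat)" for f :: "nat \<Rightarrow> nat"
proof -
  have "{..<4::nat} = {0, 1, 2, 3}" by auto
  thus ?thesis by simp
qed

text \<open>
  The combinatorics of smoothings rests on one property of arcs, the even number of their ends.
\<close>

locale four_valent =
  fixes D :: link_diagram
  assumes finite_crossings: "finite (crossings D)"
    and finite_arcs: "finite (arcs D)"
    and arc_in: "c \<in> crossings D \<Longrightarrow> k < 4 \<Longrightarrow> arc_at D (c, k) \<in> arcs D"
    and even_ends: "a \<in> arcs D \<Longrightarrow> even (card {h \<in> half_edges D. arc_at D h = a})"
begin

lemma compatible_Int: "compatible m u \<Longrightarrow> compatible m v \<Longrightarrow> compatible m (\<lambda>k. u k \<and> v k)"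
  by (simp add: compatible_def split: if_splits)

lemma compatible_Not: "compatible m u \<Longrightarrow> compatible m (\<lambda>k. \<not> u k)"
  by (simp add: compatible_def split: if_splits)

lemma compatible_cong: "(\<And>k. k < 4 \<Longrightarrow> u k = v k) \<Longrightarrow> compatible m u = compatible m v"
  by (simp add: compatible_def)

lemma compatible_zero: "compatible 0 u \<Longrightarrow> compatible m u"
  by (simp add: compatible_def split: if_splits)

lemma closed_arcs_all: "closed_arcs D p (arcs D)"
  by (simp add: closed_arcs_def compatible_def arc_in)

lemma closed_empty: "closed_arcs D p {}"
  by (simp add: closed_arcs_def compatible_def)

lemma closed_Int: "closed_arcs D p U \<Longrightarrow> closed_arcs D p V \<Longrightarrow> closed_arcs D p (U \<inter> V)"
  unfolding closed_arcs_def using compatible_Int by (simp add: Int_absorb2 le_infI1)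

lemma closed_Compl:
  assumes "closed_arcs D p U" shows "closed_arcs D p (arcs D - U)"
proof -
  have "compatible (p c) (\<lambda>k. arc_at D (c, k) \<in> arcs D - U)" if c: "c \<in> crossings D" for c
    using compatible_Not[of "p c" "\<lambda>k. arc_at D (c, k) \<in> U"] assms c arc_in[OF c]
      compatible_cong[of "\<lambda>k. arc_at D (c, k) \<in> arcs D - U" "\<lambda>k. arc_at D (c, k) \<notin> U" "p c"]
    by (simp add: closed_arcs_def)
  thus ?thesis by (simp add: closed_arcs_def)
qed

lemma closed_subset: "closed_arcs D p U \<Longrightarrow> U \<subseteq> arcs D"
  by (simp add: closed_arcs_def)

lemma closed_Diff:
  assumes "closed_arcs D p U" "closed_arcs D p V" shows "closed_arcs D p (U - V)"
proof -
  have "U - V = U \<inter> (arcs D - V)" using closed_subset[OF assms(1)] by blast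
  thus ?thesis using assms closed_Int closed_Compl by metis
qed

lemma closed_Un:
  assumes "closed_arcs D p U" "closed_arcs D p V" shows "closed_arcs D p (U \<union> V)"
proof -
  have "U \<union> V = arcs D - ((arcs D - U) \<inter> (arcs D - V))"
    using closed_subset[OF assms(1)] closed_subset[OF assms(2)] by blast
  thus ?thesis using assms closed_Int closed_Compl by metis
qed

lemma closed_cong: "(\<And>c. c \<in> crossings D \<Longrightarrow> p c = q c) \<Longrightarrow> closed_arcs D p = closed_arcs D q"
  by (auto simp: closed_arcs_def fun_eq_iff)

lemma component_cong: "(\<And>c. c \<in> crossings D \<Longrightarrow> p c = q c) \<Longrightarrow> component D p = component D q"
  using closed_cong[of p q] by (simp add: component_def fun_eq_iff)

lemma components_cong: "(\<And>c. c \<in> crossings D \<Longrightarrow> p c = q c) \<Longrightarrow> components D p = components D q"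
  using component_cong[of p q] by (simp add: components_def)

lemma closed_component: "closed_arcs D p (component D p a)"
proof -
  have "compatible (p c) (\<lambda>k. arc_at D (c, k) \<in> component D p a)" if c: "c \<in> crossings D" for c
  proof -
    have *: "compatible (p c) (\<lambda>k. arc_at D (c, k) \<in> U)" if "closed_arcs D p U" for U
      using that c by (auto simp: closed_arcs_def)
    have **: "arc_at D (c, k) \<in> component D p a \<longleftrightarrow>
        (\<forall>U. closed_arcs D p U \<longrightarrow> a \<in> U \<longrightarrow> arc_at D (c, k) \<in> U)" if "k < 4" for k
      using arc_in[OF c that] by (auto simp: component_def)
    show ?thesis
      using * by (auto simp: compatible_def ** split: if_splits)
  qed
  thus ?thesis by (auto simp: closed_arcs_def component_def)
qed

lemma component_self: "a \<in> arcs D \<Longrightarrow> a \<in> component D p a"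
  by (auto simp: component_def)

lemma component_subset: "closed_arcs D p U \<Longrightarrow> a \<in> U \<Longrightarrow> component D p a \<subseteq> U"
  by (auto simp: component_def)

lemma component_disjoint:
  assumes "closed_arcs D p U" "a \<notin> U" "a \<in> arcs D" shows "component D p a \<inter> U = {}"
  using component_subset[OF closed_Compl[OF assms(1)], of a] assms by auto

text \<open>
  Closed sets are stable under complements, so the relation of lying in the same smallest closed set
  is symmetric.
\<close>

lemma component_eq:
  assumes "b \<in> component D p a" "a \<in> arcs D" shows "component D p b = component D p a"
proof -
  have b: "b \<in> arcs D" using assms by (auto simp: component_def)
  have 1: "component D p b \<subseteq> component D p a"
    by (rule component_subset[OF closed_component assms(1)])
  have "a \<in> component D p b"
    using component_disjoint[OF closed_component, of a p b] assms component_self[OF assms(2), of p]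
      component_subset[OF closed_component, of b p a] component_self[OF b, of p] by auto
  from component_subset[OF closed_component this] 1 show ?thesis by auto
qed

lemma components_cases:
  assumes "C \<in> components D p" "closed_arcs D p U" shows "C \<subseteq> U \<or> C \<inter> U = {}"
  using assms component_subset[OF assms(2)] component_disjoint[OF assms(2)]
  by (auto simp: components_def)

lemma components_closed: "C \<in> components D p \<Longrightarrow> closed_arcs D p C"
  by (auto simp: components_def closed_component)

lemma components_nonempty: "C \<in> components D p \<Longrightarrow> C \<noteq> {}"
  using component_self by (auto simp: components_def)

lemma components_eqI: "C \<in> components D p \<Longrightarrow> C' \<in> components D p \<Longrightarrow> a \<in> C \<Longrightarrow> a \<in> C' \<Longrightarrow> C = C'"
  by (auto simp: components_def dest: component_eq)

lemma component_in: "a \<in> arcs D \<Longrightarrow> component D p a \<in> components D p"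
  by (simp add: components_def)

lemma finite_components: "finite (components D p)"
  by (simp add: components_def finite_arcs)

lemma closed_Union_components:
  assumes "closed_arcs D p U" shows "\<Union>{C \<in> components D p. C \<subseteq> U} = U"
  using component_subset[OF assms] component_self component_in closed_subset[OF assms] by fastforce

lemma closed_refines:
  assumes "refines D p q" "closed_arcs D q U" shows "closed_arcs D p U"
proof -
  have "compatible (p c) (\<lambda>k. arc_at D (c, k) \<in> U)" if c: "c \<in> crossings D" for c
  proof (cases "q c = 0")
    case True
    thus ?thesis using assms(2) c compatible_zero by (auto simp: closed_arcs_def)
  next
    case False
    thus ?thesis using assms c by (auto simp: closed_arcs_def refines_def)
  qed
  thus ?thesis using assms(2) by (simp add: closed_arcs_def)
qed

lemma component_refines: "refines D p q \<Longrightarrow> component D p a \<subseteq> component D q a"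
  using closed_refines by (auto simp: component_def)

lemma separates_refines:
  assumes "refines D p q" "separates D q c m" shows "separates D p c m"
proof -
  have "refines D (p(c := m)) (q(c := m))" using assms(1) by (simp add: refines_def)
  thus ?thesis using component_refines assms(2) unfolding separates_def by blast
qed

subsection \<open>Joining the two strands at a crossing\<close>

text \<open>
  Forgetting the marker of a crossing adds the single link between slots \<open>0\<close> and \<open>2\<close>, whatever the
  marker was. So two components are joined, or nothing changes.
\<close>

lemma closed_unresolved:
  assumes "m \<in> {1, -1}" "c \<in> crossings D"
  shows "closed_arcs D (p(c := 0)) U \<longleftrightarrow>
    closed_arcs D (p(c := m)) U \<and> (arc_at D (c, 0) \<in> U \<longleftrightarrow> arc_at D (c, 2) \<in> U)"
proof -
  have "compatible 0 u \<longleftrightarrow> compatible m u \<and> (u 0 \<longleftrightarrow> u 2)" for u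
    using assms(1) by (auto simp: compatible_def)
  thus ?thesis using assms(2) unfolding closed_arcs_def by (auto simp: fun_upd_apply)
qed

lemma refines_unresolved: "refines D (p(c := m)) (p(c := 0))"
  by (auto simp: refines_def)

text \<open>
  A closed set of the finer resolution that contains both or neither of the two strands stays closed.
\<close>

lemma component_unresolved:
  fixes p :: "nat \<Rightarrow> int"
  assumes "m \<in> {1, -1}" "c \<in> crossings D" "a \<in> arcs D"
  defines "T \<equiv> component D (p(c := m)) (arc_at D (c, 0)) \<union> component D (p(c := m)) (arc_at D (c, 2))"
  shows "component D (p(c := 0)) a = (if a \<in> T then T else component D (p(c := m)) a)"
proof -
  let ?q = "p(c := m)" and ?r = "p(c := 0)"
  let ?x = "arc_at D (c, 0)" and ?y = "arc_at D (c, 2)"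
  have x: "?x \<in> arcs D" and y: "?y \<in> arcs D" using arc_in assms by auto
  have T: "closed_arcs D ?r T"
    unfolding closed_unresolved[OF assms(1,2)] T_def
    using closed_Un closed_component component_self[OF x] component_self[OF y] by auto
  have r: "closed_arcs D ?q (component D ?r b)" "(?x \<in> component D ?r b \<longleftrightarrow> ?y \<in> component D ?r b)" for b
    using closed_component[of ?r b] unfolding closed_unresolved[OF assms(1,2)] by auto
  show ?thesis
  proof (cases "a \<in> T")
    case True
    have "?x \<in> component D ?r a"
    proof -
      from True consider "?x \<in> component D ?q a" | "?y \<in> component D ?q a"
        unfolding T_def using component_eq[OF _ x, of a ?q] component_eq[OF _ y, of a ?q]
          component_self[OF x, of ?q] component_self[OF y, of ?q] by auto
      thus ?thesis using component_refines[OF refines_unresolved, of p c m a] r by auto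
    qed
    hence "T \<subseteq> component D ?r a" unfolding T_def
      using component_subset[OF r(1)] r(2) by simp
    thus ?thesis using component_subset[OF T True] True by auto
  next
    case False
    have "?x \<notin> component D ?q a" "?y \<notin> component D ?q a"
      using False component_eq[OF _ assms(3), of _ ?q] component_self[OF assms(3), of ?q]
      unfolding T_def by blast+
    hence "closed_arcs D ?r (component D ?q a)"
      unfolding closed_unresolved[OF assms(1,2)] by (simp add: closed_component)
    hence "component D ?r a \<subseteq> component D ?q a"
      using component_subset component_self[OF assms(3)] by blast
    thus ?thesis using component_refines[OF refines_unresolved, of p c m a] False by auto
  qed
qed

lemma components_unresolved:
  fixes p :: "nat \<Rightarrow> int"
  assumes "m \<in> {1, -1}" "c \<in> crossings D"
  defines "X \<equiv> component D (p(c := m)) (arc_at D (c, 0))"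
    and "Y \<equiv> component D (p(c := m)) (arc_at D (c, 2))"
    and "T \<equiv> component D (p(c := 0)) (arc_at D (c, 0))"
  shows "T = X \<union> Y"
    and "components D (p(c := m)) = insert X (insert Y (components D (p(c := 0)) - {T}))"
    and "T \<in> components D (p(c := 0))" and "X \<noteq> {}" and "Y \<noteq> {}"
    and "separates D p c m \<longleftrightarrow> X \<noteq> Y" and "X \<noteq> Y \<longleftrightarrow> X \<inter> Y = {}"
    and "X \<in> components D (p(c := m))" and "Y \<in> components D (p(c := m))"
    and "arc_at D (c, 0) \<in> X" and "arc_at D (c, 2) \<in> Y"
proof -
  let ?q = "p(c := m)" and ?r = "p(c := 0)"
  let ?x = "arc_at D (c, 0)" and ?y = "arc_at D (c, 2)"
  have x: "?x \<in> arcs D" and y: "?y \<in> arcs D" using arc_in assms by auto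
  note cu = component_unresolved[OF assms(1,2), of _ p, folded X_def Y_def]
  show xX: "?x \<in> X" and yY: "?y \<in> Y" using component_self x y by (auto simp: X_def Y_def)
  show T: "T = X \<union> Y" using cu[OF x] xX by (auto simp: T_def)
  show TT: "T \<in> components D ?r" and XX: "X \<in> components D ?q" and YY: "Y \<in> components D ?q"
    using component_in x y by (auto simp: T_def X_def Y_def)
  show "X \<noteq> {}" "Y \<noteq> {}" using xX yY by auto
  show "X \<noteq> Y \<longleftrightarrow> X \<inter> Y = {}" using components_eqI[OF XX YY] xX by auto
  show "separates D p c m \<longleftrightarrow> X \<noteq> Y"
    using component_eq[OF _ x, of ?y ?q] yY unfolding separates_def X_def Y_def by auto
  have a: "component D ?q a \<in> {X, Y}" if "a \<in> T" for a
    using that component_eq[OF _ x, of a ?q] component_eq[OF _ y, of a ?q] unfolding T X_def Y_def by auto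
  show "components D ?q = insert X (insert Y (components D ?r - {T}))" (is "?L = ?R")
  proof
    show "?L \<subseteq> ?R"
    proof
      fix C assume "C \<in> ?L"
      then obtain b where b: "b \<in> arcs D" "C = component D ?q b" by (auto simp: components_def)
      show "C \<in> ?R"
      proof (cases "b \<in> T")
        case False
        hence "C = component D ?r b" using cu[OF b(1)] b T by auto
        thus ?thesis using b component_in[OF b(1), of ?r] component_self[OF b(1), of ?r] False by auto
      qed (use a b in auto)
    qed
    show "?R \<subseteq> ?L"
    proof
      fix C assume C: "C \<in> ?R"
      show "C \<in> ?L"
      proof (cases "C = X \<or> C = Y")
        case False
        with C obtain b where b: "b \<in> arcs D" "C = component D ?r b" "C \<noteq> T" by (auto simp: components_def)
        hence "C = component D ?q b" using cu[OF b(1)] T by (auto split: if_splits)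
        thus ?thesis using b component_in by auto
      qed (use XX YY in auto)
    qed
  qed
qed

lemma card_components_resolve:
  assumes "m \<in> {1, -1}" "c \<in> crossings D"
  shows "card (components D (p(c := m))) =
    card (components D (p(c := 0))) + of_bool (separates D p c m)"
proof -
  note cu = components_unresolved[OF assms, of p]
  let ?T = "component D (p(c := 0)) (arc_at D (c, 0))"
  let ?X = "component D (p(c := m)) (arc_at D (c, 0))" and ?Y = "component D (p(c := m)) (arc_at D (c, 2))"
  have n: "Z \<notin> components D (p(c := 0)) - {?T}" if "Z \<subseteq> ?T" "Z \<noteq> {}" for Z
    using that components_eqI[OF _ cu(3)] by auto
  have fin: "finite (components D (p(c := 0)) - {?T})" using finite_components by auto
  have c1: "card (components D (p(c := 0))) = Suc (card (components D (p(c := 0)) - {?T}))"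
    using card_Suc_Diff1[OF finite_components cu(3)] by simp
  show ?thesis unfolding cu(2) c1 cu(6)
    using n[of ?X] n[of ?Y] cu(1,4,5) fin by (auto simp: card_insert_if)
qed

text \<open>
  Around any crossing, a set of arcs that is compatible with all other markers has an even number of
  ends, since arcs have two ends and the other crossings take them in pairs.
\<close>

lemma even_ends_at_crossing:
  assumes "c \<in> crossings D" "V \<subseteq> arcs D"
    and V: "\<And>d. d \<in> crossings D \<Longrightarrow> d \<noteq> c \<Longrightarrow> compatible (s d) (\<lambda>k. arc_at D (d, k) \<in> V)"
  shows "even (\<Sum>k<4. of_bool (arc_at D (c, k) \<in> V) :: nat)"
proof -
  let ?g = "\<lambda>d. \<Sum>k<4. of_bool (arc_at D (d, k) \<in> V) :: nat"
  have fin: "finite V" using assms(2) finite_arcs finite_subset by auto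
  have finH: "finite (half_edges D)" by (simp add: half_edges_def finite_crossings)
  have "(\<Sum>d\<in>crossings D. ?g d) = (\<Sum>h\<in>half_edges D. of_bool (arc_at D h \<in> V))"
    unfolding half_edges_def by (subst sum.cartesian_product) (rule sum.cong, auto simp only: case_prod_beta prod.collapse)
  also have "\<dots> = (\<Sum>h\<in>half_edges D. \<Sum>a\<in>V. of_bool (arc_at D h = a))"
    by (rule sum.cong) (use fin in \<open>auto simp: of_bool_def sum.delta'\<close>)
  also have "\<dots> = (\<Sum>a\<in>V. \<Sum>h\<in>half_edges D. of_bool (arc_at D h = a))" by (rule sum.swap)
  also have "\<dots> = (\<Sum>a\<in>V. card {h \<in> half_edges D. arc_at D h = a})"
    by (rule sum.cong) (use finH in \<open>auto simp: of_bool_def sum.If_cases Int_def\<close>)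
  also have "even \<dots>" using even_ends assms(2) by (intro dvd_sum) auto
  finally have "even (?g c + (\<Sum>d\<in>crossings D - {c}. ?g d))"
    using sum.remove[OF finite_crossings assms(1), of ?g] by simp
  moreover have "even (?g d)" if "d \<in> crossings D - {c}" for d
    unfolding sum_lessThan_4 using V[of d] that by (auto simp: compatible_def split: if_splits)
  hence "even (\<Sum>d\<in>crossings D - {c}. ?g d)" by (rule dvd_sum)
  ultimately show ?thesis by simp
qed

text \<open>
  If both smoothings of \<open>c\<close> kept the strands at slots \<open>0\<close> and \<open>2\<close> apart, the intersection of the
  two circles through slot \<open>0\<close> would have exactly one end at \<open>c\<close>.
\<close>

lemma not_both_separate:
  assumes c: "c \<in> crossings D" and s: "\<And>d. d \<in> crossings D \<Longrightarrow> d \<noteq> c \<Longrightarrow> s d \<noteq> 0"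
  shows "\<not> (separates D s c 1 \<and> separates D s c (-1))"
proof
  assume sep: "separates D s c 1 \<and> separates D s c (-1)"
  let ?x = "arc_at D (c, 0)"
  let ?P = "component D (s(c := 1)) ?x" and ?M = "component D (s(c := -1)) ?x"
  have x: "?x \<in> arcs D" using arc_in c by auto
  have P: "closed_arcs D (s(c := 1)) ?P" and M: "closed_arcs D (s(c := -1)) ?M"
    by (rule closed_component)+
  from P c have "compatible 1 (\<lambda>k. arc_at D (c, k) \<in> ?P)" by (force simp: closed_arcs_def)
  hence p: "arc_at D (c, 2) \<notin> ?P" "arc_at D (c, 3) \<notin> ?P"
    using sep by (auto simp: compatible_def separates_def)
  from M c have "compatible (-1) (\<lambda>k. arc_at D (c, k) \<in> ?M)" by (force simp: closed_arcs_def)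
  hence m: "arc_at D (c, 1) \<notin> ?M" using sep by (auto simp: compatible_def separates_def)
  have "even (\<Sum>k<4. of_bool (arc_at D (c, k) \<in> ?P \<inter> ?M) :: nat)"
  proof (rule even_ends_at_crossing[OF c])
    show "?P \<inter> ?M \<subseteq> arcs D" using closed_subset[OF P] by auto
    fix d assume "d \<in> crossings D" "d \<noteq> c"
    with P M have "compatible (s d) (\<lambda>k. arc_at D (d, k) \<in> ?P)" "compatible (s d) (\<lambda>k. arc_at D (d, k) \<in> ?M)"
      by (auto simp: closed_arcs_def)
    thus "compatible (s d) (\<lambda>k. arc_at D (d, k) \<in> ?P \<inter> ?M)"
      by (auto simp: compatible_def split: if_splits)
  qed
  moreover have "(\<Sum>k<4. of_bool (arc_at D (c, k) \<in> ?P \<inter> ?M) :: nat) = 1"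
    using p m component_self[OF x] unfolding sum_lessThan_4 by simp
  ultimately show False by simp
qed

end

section \<open>The genus defect of a partial resolution\<close>

definition fill :: "int \<Rightarrow> (nat \<Rightarrow> int) \<Rightarrow> nat \<Rightarrow> int" where
  "fill m p = (\<lambda>c. if p c = 0 then m else p c)"

definition unresolved :: "link_diagram \<Rightarrow> (nat \<Rightarrow> int) \<Rightarrow> nat set" where
  "unresolved D p = {c \<in> crossings D. p c = 0}"

definition partial_state :: "link_diagram \<Rightarrow> (nat \<Rightarrow> int) \<Rightarrow> bool" where
  "partial_state D p \<longleftrightarrow> (\<forall>c\<in>crossings D. p c \<in> {0, 1, -1})"

text \<open>
  Twice the Turaev genus of the partially resolved diagram: the Turaev surface is a
  ribbon neighbourhood of the 4-valent graph, capped off along the circles of the two extreme states.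
\<close>

definition genus_defect :: "link_diagram \<Rightarrow> (nat \<Rightarrow> int) \<Rightarrow> int" where
  "genus_defect D p = int (card (unresolved D p)) + 2 * int (card (components D p))
     - int (card (components D (fill 1 p))) - int (card (components D (fill (-1) p)))"

context four_valent
begin

lemma finite_unresolved: "finite (unresolved D p)"
  by (simp add: unresolved_def finite_crossings)

lemma unresolved_upd: "m \<noteq> 0 \<Longrightarrow> unresolved D (p(c := m)) = unresolved D p - {c}"
  by (auto simp: unresolved_def)

lemma genus_defect_cong:
  assumes "\<And>c. c \<in> crossings D \<Longrightarrow> p c = q c" shows "genus_defect D p = genus_defect D q"
proof -
  have "unresolved D p = unresolved D q" using assms by (auto simp: unresolved_def)
  moreover have "components D p = components D q" by (rule components_cong[OF assms])
  moreover have "components D (fill m p) = components D (fill m q)" for m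
    by (rule components_cong) (simp add: fill_def assms)
  ultimately show ?thesis by (simp add: genus_defect_def)
qed

text \<open>
  Resolving \<open>c\<close> with marker \<open>m\<close> does not affect the extreme state that is filled with \<open>m\<close>. If it cuts a
  component in two, then in the other extreme state this smoothing separates the strands at \<open>c\<close> as
  well, while the opposite smoothing joins them.
\<close>

lemma genus_defect_resolve_le:
  assumes c: "c \<in> unresolved D p" and m: "m \<in> {1, -1}"
  shows "genus_defect D (p(c := m)) \<le> genus_defect D p"
proof -
  have c': "c \<in> crossings D" and pc: "p c = 0" using c by (auto simp: unresolved_def)
  define q where "q = fill (-m) p"
  have m0: "m \<noteq> 0" and mm: "-m \<in> {1, -1}" using m by auto
  have q0: "q d \<noteq> 0" for d using m0 by (auto simp: q_def fill_def)
  have 1: "fill m (p(c := m)) = fill m p" using pc m0 by (auto simp: fill_def)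
  have 2: "fill (-m) (p(c := m)) = q(c := m)" using m0 by (auto simp: q_def fill_def)
  have 3: "q = q(c := -m)" using pc by (auto simp: q_def fill_def)
  have k: "card (components D (p(c := m))) = card (components D p) + of_bool (separates D p c m)"
    using card_components_resolve[OF m c', of p] pc by (simp add: fun_upd_idem)
  have k1: "card (components D (q(c := m))) = card (components D (q(c := 0))) + of_bool (separates D q c m)"
    by (rule card_components_resolve[OF m c'])
  have k2: "card (components D q) = card (components D (q(c := 0))) + of_bool (separates D q c (-m))"
    using card_components_resolve[OF mm c', of q] 3 by simp
  have u: "int (card (unresolved D (p(c := m)))) = int (card (unresolved D p)) - 1"
    unfolding unresolved_upd[OF m0] using c finite_unresolved[of p]
    by (simp add: card_Diff_singleton) (metis card_gt_0_iff empty_iff of_nat_diff Suc_leI One_nat_def of_nat_1)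
  have s1: "separates D p c m \<Longrightarrow> separates D q c m"
    by (rule separates_refines) (auto simp: refines_def q_def fill_def)
  have s2: "\<not> (separates D q c m \<and> separates D q c (-m))"
    using not_both_separate[OF c', of q] q0 m by auto
  have d: "genus_defect D r = int (card (unresolved D r)) + 2 * int (card (components D r))
     - int (card (components D (fill m r))) - int (card (components D (fill (-m) r)))" for r
    using m by (auto simp: genus_defect_def)
  show ?thesis unfolding d 1 2 k1 k u using k2 s1 s2 by (simp add: q_def)
qed

lemma genus_defect_resolved: "unresolved D p = {} \<Longrightarrow> genus_defect D p = 0"
proof -
  assume u: "unresolved D p = {}"
  hence "components D (fill m p) = components D p" for m
    by (intro components_cong) (auto simp: fill_def unresolved_def)
  thus ?thesis using u by (simp add: genus_defect_def)
qed

text \<open>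
  Resolve all crossings: the defect does not increase on the way and ends at \<open>0\<close>.
\<close>

lemma genus_defect_nonneg: "0 \<le> genus_defect D p"
proof (induction "card (unresolved D p)" arbitrary: p)
  case 0
  thus ?case using genus_defect_resolved finite_unresolved by auto
next
  case (Suc n)
  then obtain c where c: "c \<in> unresolved D p" by (metis card.empty ex_in_conv nat.distinct(1))
  have "n = card (unresolved D (p(c := 1)))"
    using Suc.hyps(2) c finite_unresolved[of p] by (simp add: unresolved_upd)
  from Suc.hyps(1)[OF this] genus_defect_resolve_le[OF c, of 1] show ?case by simp
qed

end

locale turaev_genus_zero = four_valent +
  assumes genus_zero: "genus_defect D (\<lambda>_. 0) \<le> 0"
begin

text \<open>
  Every partial resolution arises from the unresolved diagram, so its defect is squeezed between \<open>0\<close>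
  and the defect of the diagram.
\<close>

lemma genus_defect_zero:
  assumes "partial_state D p" shows "genus_defect D p = 0"
proof -
  have "genus_defect D p \<le> 0" using assms
  proof (induction "card (crossings D - unresolved D p)" arbitrary: p)
    case 0
    hence "crossings D \<subseteq> unresolved D p" using finite_crossings by simp
    hence "genus_defect D p = genus_defect D (\<lambda>_. 0)"
      by (intro genus_defect_cong) (auto simp: unresolved_def)
    thus ?case using genus_zero by simp
  next
    case (Suc n)
    then obtain c where c: "c \<in> crossings D - unresolved D p"
      by (metis card.empty ex_in_conv nat.distinct(1))
    let ?q = "p(c := 0)"
    have "crossings D - unresolved D ?q = crossings D - unresolved D p - {c}" using c
      by (auto simp: unresolved_def split: if_splits)
    hence "n = card (crossings D - unresolved D ?q)"
      using Suc.hyps(2) c finite_crossings by simp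
    moreover have "partial_state D ?q" using Suc.prems by (auto simp: partial_state_def)
    ultimately have "genus_defect D ?q \<le> 0" by (rule Suc.hyps(1))
    moreover have "p c \<in> {1, -1}" using c Suc.prems by (auto simp: partial_state_def unresolved_def)
    moreover have "c \<in> unresolved D ?q" using c by (auto simp: unresolved_def)
    ultimately show ?case using genus_defect_resolve_le[of c ?q "p c"] by simp
  qed
  thus ?thesis using genus_defect_nonneg[of p] by simp
qed

lemma extreme_components:
  assumes "partial_state D p"
  shows "int (card (components D (fill 1 p))) + int (card (components D (fill (-1) p))) =
    int (card (unresolved D p)) + 2 * int (card (components D p))"
  using genus_defect_zero[OF assms] by (simp add: genus_defect_def)

text \<open>So every change of one marker merges two circles or splits one.\<close>

lemma separates_minus_iff:
  assumes c: "c \<in> crossings D" and s: "\<And>d. d \<in> crossings D \<Longrightarrow> d \<noteq> c \<Longrightarrow> s d \<in> {1, -1}"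
  shows "separates D s c (-1) \<longleftrightarrow> \<not> separates D s c 1"
proof -
  let ?p = "s(c := 0)"
  have "partial_state D ?p" using s by (auto simp: partial_state_def)
  note e = extreme_components[OF this]
  have s0: "s d \<noteq> 0" if "d \<in> crossings D" "d \<noteq> c" for d using s[OF that] by auto
  hence "unresolved D ?p = {c}" using c by (auto simp: unresolved_def)
  moreover have "components D (fill m ?p) = components D (s(c := m))" for m
    by (rule components_cong) (use s0 in \<open>auto simp: fill_def\<close>)
  ultimately have "card (components D (s(c := 1))) + card (components D (s(c := -1))) =
      1 + 2 * card (components D (s(c := 0)))" using e by simp
  moreover have "card (components D (s(c := 1))) = card (components D (s(c := 0))) + of_bool (separates D s c 1)"
    "card (components D (s(c := -1))) = card (components D (s(c := 0))) + of_bool (separates D s c (-1))"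
    using card_components_resolve[OF _ c] by auto
  ultimately show ?thesis by (cases "separates D s c 1"; cases "separates D s c (-1)") simp_all
qed

end

section \<open>Circles and faces of an alternating diagram\<close>

text \<open>
  The reachability classes along smoothed strands are the minimal nonempty closed sets.
\<close>

lemma (in four_valent) circles_eq_components:
  assumes "s \<in> kauffman_states D" shows "circles D s = components D s"
proof -
  have sc: "s c \<in> {1, -1}" if "c \<in> crossings D" for c
    using assms that by (auto simp: kauffman_states_def PiE_def Pi_def)
  let ?R = "smoothed_arcs D s"
  have closed: "b \<in> U \<longleftrightarrow> d \<in> U" if "(b, d) \<in> ?R" "closed_arcs D s U" for b d U
  proof -
    from that(1) obtain c k l where ckl: "b = arc_at D (c, k)" "d = arc_at D (c, l)" "c \<in> crossings D"
      "{k, l} \<in> smoothing (s c)" by (auto simp: smoothed_arcs_def)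
    have "compatible (s c) (\<lambda>k. arc_at D (c, k) \<in> U)" using that(2) ckl by (simp add: closed_arcs_def)
    thus ?thesis using ckl(4) sc[OF ckl(3)] unfolding ckl(1,2) compatible_def smoothing_def
      by (auto simp: doubleton_eq_iff)
  qed
  have range: "?R \<subseteq> arcs D \<times> arcs D"
    by (auto simp: smoothed_arcs_def smoothing_def doubleton_eq_iff arc_in split: if_splits)
  have "component D s a = ?R\<^sup>* `` {a}" if a: "a \<in> arcs D" for a
  proof
    have mem: "(arc_at D (c, k), arc_at D (c, l)) \<in> ?R" if "c \<in> crossings D" "{k, l} \<in> smoothing (s c)" for c k l
      using that unfolding smoothed_arcs_def by blast
    have iff: "arc_at D (c, k) \<in> ?R\<^sup>* `` {a} \<longleftrightarrow> arc_at D (c, l) \<in> ?R\<^sup>* `` {a}"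
      if "c \<in> crossings D" "{k, l} \<in> smoothing (s c)" for c k l
      using mem[OF that] mem[of c l k] that by (auto simp: insert_commute intro: rtrancl_into_rtrancl)
    have "compatible (s c) (\<lambda>k. arc_at D (c, k) \<in> ?R\<^sup>* `` {a})" if c: "c \<in> crossings D" for c
      using sc[OF c] iff[OF c, of 0 1] iff[OF c, of 2 3] iff[OF c, of 1 2] iff[OF c, of 3 0]
      unfolding compatible_def smoothing_def by auto
    moreover have "?R\<^sup>* `` {a} \<subseteq> arcs D"
    proof
      fix b assume "b \<in> ?R\<^sup>* `` {a}"
      hence "(a, b) \<in> ?R\<^sup>*" by simp
      thus "b \<in> arcs D" by (induction rule: rtrancl_induct) (use a range in auto)
    qed
    ultimately have "closed_arcs D s (?R\<^sup>* `` {a})" by (simp add: closed_arcs_def)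
    thus "component D s a \<subseteq> ?R\<^sup>* `` {a}" by (rule component_subset) simp
    show "?R\<^sup>* `` {a} \<subseteq> component D s a"
    proof
      fix b assume "b \<in> ?R\<^sup>* `` {a}"
      hence "(a, b) \<in> ?R\<^sup>*" by simp
      thus "b \<in> component D s a"
        by (induction rule: rtrancl_induct) (use a component_self closed[OF _ closed_component] in auto)
    qed
  qed
  hence "components D s = (\<lambda>a. ?R\<^sup>* `` {a}) ` arcs D"
    unfolding components_def by (rule image_cong[OF refl])
  thus ?thesis unfolding circles_def quotient_def by blast
qed

text \<open>
  The orbits of an injective map of a finite set into itself are cycles, so a forward orbit does not
  shrink when it is started one step later.
\<close>

lemma rtrancl_Image_step:
  assumes "finite A" "r \<subseteq> A \<times> A" "A \<subseteq> Domain r" "single_valued r" "single_valued (r\<inverse>)" "(x, y) \<in> r"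
  shows "r\<^sup>* `` {x} = r\<^sup>* `` {y}"
proof -
  \<comment> \<open>the successor map embeds the larger orbit into the smaller one\<close>
  have "\<forall>z\<in>A. \<exists>w. (z, w) \<in> r" using assms(3) by blast
  then obtain f where "\<forall>z\<in>A. (z, f z) \<in> r" using bchoice by metis
  hence f: "(z, f z) \<in> r" if "z \<in> A" for z using that by simp
  have xA: "x \<in> A" and yA: "y \<in> A" using assms(2,6) by auto
  have sub: "r\<^sup>* `` {z} \<subseteq> A" if "z \<in> A" for z
  proof
    fix w assume "w \<in> r\<^sup>* `` {z}"
    hence "(z, w) \<in> r\<^sup>*" by simp
    thus "w \<in> A" by (induction rule: rtrancl_induct) (use assms(2) that in auto)
  qed
  have fin: "finite (r\<^sup>* `` {z})" if "z \<in> A" for z using sub[OF that] assms(1) finite_subset by blast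
  have inj: "inj_on f (r\<^sup>* `` {x})"
  proof (rule inj_onI)
    fix a b assume "a \<in> r\<^sup>* `` {x}" "b \<in> r\<^sup>* `` {x}" "f a = f b"
    hence "(a, f a) \<in> r" "(b, f a) \<in> r" using f sub[OF xA] by (metis subsetD)+
    thus "a = b" using assms(5) by (auto simp: single_valued_def)
  qed
  have "f ` (r\<^sup>* `` {x}) \<subseteq> r\<^sup>* `` {y}"
  proof
    fix w assume "w \<in> f ` (r\<^sup>* `` {x})"
    then obtain z where z: "(x, z) \<in> r\<^sup>*" "w = f z" by auto
    have zw: "(z, w) \<in> r" using f sub[OF xA] z by auto
    from z(1) show "w \<in> r\<^sup>* `` {y}"
    proof (cases rule: converse_rtranclE)
      case base
      thus ?thesis using zw assms(4,6) by (auto simp: single_valued_def)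
    next
      case (step u)
      hence "u = y" using assms(4,6) by (auto simp: single_valued_def)
      thus ?thesis using step zw by (auto intro: rtrancl_into_rtrancl)
    qed
  qed
  hence "card (r\<^sup>* `` {x}) \<le> card (r\<^sup>* `` {y})" using inj fin[OF yA] card_inj_on_le by blast
  moreover have "r\<^sup>* `` {y} \<subseteq> r\<^sup>* `` {x}" using assms(6) by (auto intro: converse_rtrancl_into_rtrancl)
  ultimately show ?thesis using card_seteq[OF fin[OF xA]] by blast
qed

lemma card_image_le_card_image:
  assumes "finite S" "\<And>x y. x \<in> S \<Longrightarrow> y \<in> S \<Longrightarrow> g x = g y \<Longrightarrow> f x = f y"
  shows "card (f ` S) \<le> card (g ` S)"
proof (rule surj_card_le[where f = "\<lambda>v. f (inv_into S g v)"])
  show "finite (g ` S)" using assms by simp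
  show "f ` S \<subseteq> (\<lambda>v. f (inv_into S g v)) ` g ` S"
  proof
    fix w assume "w \<in> f ` S"
    then obtain x where x: "x \<in> S" "w = f x" by auto
    hence "f (inv_into S g (g x)) = w"
      using assms(2)[of "inv_into S g (g x)" x] by (simp add: inv_into_into f_inv_into_f)
    thus "w \<in> (\<lambda>v. f (inv_into S g v)) ` g ` S" using x by force
  qed
qed

lemma link_diagram_four_valent:
  assumes "is_link_diagram D" shows "four_valent D"
proof
  show "finite (crossings D)" "finite (arcs D)" using assms by (auto simp: is_link_diagram_def)
  show "arc_at D (c, k) \<in> arcs D" if "c \<in> crossings D" "k < 4" for c k
    using assms that by (auto simp: is_link_diagram_def half_edges_def)
  show "even (card {h \<in> half_edges D. arc_at D h = a})" if "a \<in> arcs D" for a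
    using assms that by (force simp: is_link_diagram_def)
qed

lemma other_end:
  assumes "is_link_diagram D" "h \<in> half_edges D"
  shows "\<exists>g. g \<noteq> h \<and> {k \<in> half_edges D. arc_at D k = arc_at D h} = {h, g}"
proof -
  let ?S = "{k \<in> half_edges D. arc_at D k = arc_at D h}"
  have h: "h \<in> ?S" using assms by auto
  have "card ?S \<in> {0, 2}" using assms by (auto simp: is_link_diagram_def)
  moreover have "finite ?S" using assms by (auto simp: is_link_diagram_def half_edges_def)
  moreover have "card ?S \<noteq> 0" using h calculation(2) card_0_eq by blast
  ultimately have "card (?S - {h}) = 1" using h by (simp add: card_Diff_singleton)
  then obtain g where g: "?S - {h} = {g}" by (rule card_1_singletonE)
  have "?S = insert h (?S - {h})" using h by blast
  thus ?thesis using g by (intro exI[of _ g]) blast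
qed

lemma alternating_parity:
  assumes "alternating D" "(c, k) \<in> half_edges D" "(d, l) \<in> half_edges D" "(c, k) \<noteq> (d, l)"
    and "arc_at D (c, k) = arc_at D (d, l)"
  shows "even k \<noteq> even l"
proof -
  from bspec[OF assms(1)[unfolded alternating_def] assms(2)]
  have "\<forall>(d, l)\<in>half_edges D. (c, k) \<noteq> (d, l) \<and> arc_at D (c, k) = arc_at D (d, l) \<longrightarrow> even k \<noteq> even l"
    by simp
  from bspec[OF this assms(3)] show ?thesis using assms(4,5) by simp
qed

text \<open>
  Along the boundary of a face of an alternating diagram all corners have the same parity, and they
  are the corners that are cut off by the smoothings of one extreme state. So the faces are the
  circles of the two extreme states.
\<close>

lemma card_faces_le:
  assumes D: "is_link_diagram D" and alt: "alternating D" and b: "b < 2"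
  shows "card ((\<lambda>h. (corner_step D)\<^sup>* `` {h}) ` {h \<in> half_edges D. snd h mod 2 = b})
    \<le> card (components D (\<lambda>_. if b = 0 then 1 else -1))"
proof -
  interpret four_valent D by (rule link_diagram_four_valent[OF D])
  let ?H = "half_edges D" and ?r = "corner_step D"
  let ?face = "\<lambda>h. ?r\<^sup>* `` {h}"
  let ?S = "{h \<in> ?H. snd h mod 2 = b}"
  let ?s = "\<lambda>_::nat. if b = 0 then 1 else -1 :: int"
  have finH: "finite ?H" by (simp add: half_edges_def finite_crossings)
  have next_in: "(c, (k + 1) mod 4) \<in> ?H" if "(c, k) \<in> ?H" for c k
    using that by (auto simp: half_edges_def)
  have step: "?face (c, k) = ?face h" if "((c, k), h) \<in> ?r" for c k h
  proof (rule rtrancl_Image_step[OF finH _ _ _ _ that])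
    show "?r \<subseteq> ?H \<times> ?H" by (auto simp: corner_step_def)
    show "?H \<subseteq> Domain ?r"
    proof
      fix g assume g: "g \<in> ?H"
      obtain c k where ck: "g = (c, k)" by (cases g)
      from other_end[OF D next_in[OF g[unfolded ck]]] obtain h where
        "h \<noteq> (c, (k + 1) mod 4)" "{l \<in> ?H. arc_at D l = arc_at D (c, (k + 1) mod 4)} = {(c, (k + 1) mod 4), h}"
        by blast
      hence "(g, h) \<in> ?r" using g ck by (auto simp: corner_step_def)
      thus "g \<in> Domain ?r" by auto
    qed
    show "single_valued ?r"
    proof (rule single_valuedI)
      fix x y z assume xy: "(x, y) \<in> ?r" and xz: "(x, z) \<in> ?r"
      obtain c k where ck: "x = (c, k)" by (cases x)
      have "(c, k) \<in> ?H" using xy ck by (auto simp: corner_step_def)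
      from other_end[OF D next_in[OF this]] obtain h where
        "{l \<in> ?H. arc_at D l = arc_at D (c, (k + 1) mod 4)} = {(c, (k + 1) mod 4), h}" by blast
      moreover have "y \<in> {l \<in> ?H. arc_at D l = arc_at D (c, (k + 1) mod 4)}" "y \<noteq> (c, (k + 1) mod 4)"
        "z \<in> {l \<in> ?H. arc_at D l = arc_at D (c, (k + 1) mod 4)}" "z \<noteq> (c, (k + 1) mod 4)"
        using xy xz ck by (auto simp: corner_step_def)
      ultimately show "y = z" by blast
    qed
    show "single_valued (?r\<inverse>)"
    proof (rule single_valuedI)
      fix x y z assume "(x, y) \<in> ?r\<inverse>" "(x, z) \<in> ?r\<inverse>"
      then obtain c k d l where ckl: "y = (c, k)" "z = (d, l)" "((c, k), x) \<in> ?r" "((d, l), x) \<in> ?r"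
        by (cases y, cases z) auto
      have kl: "k < 4" "l < 4" using ckl by (auto simp: corner_step_def half_edges_def)
      have x: "x \<in> ?H" using ckl by (auto simp: corner_step_def)
      from other_end[OF D x] obtain h where
        "{l \<in> ?H. arc_at D l = arc_at D x} = {x, h}" by blast
      moreover have "(c, (k + 1) mod 4) \<in> {l \<in> ?H. arc_at D l = arc_at D x}" "x \<noteq> (c, (k + 1) mod 4)"
        "(d, (l + 1) mod 4) \<in> {l \<in> ?H. arc_at D l = arc_at D x}" "x \<noteq> (d, (l + 1) mod 4)"
        using ckl next_in[of c k] next_in[of d l] by (auto simp: corner_step_def)
      ultimately have "(c, (k + 1) mod 4) = h" "(d, (l + 1) mod 4) = h" by simp_all
      hence cd: "c = d" and kl': "(k + 1) mod 4 = (l + 1) mod 4" by auto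
      have "k \<in> {0, 1, 2, 3}" "l \<in> {0, 1, 2, 3}" using kl by auto
      with kl' have "k = l" by auto
      with cd show "y = z" using ckl by simp
    qed
  qed
  have uniq: "g = h" if "g \<in> ?S" "h \<in> ?S" "arc_at D g = arc_at D h" for g h
  proof (rule ccontr)
    assume "g \<noteq> h"
    obtain c k where g: "g = (c, k)" by (cases g)
    obtain d l where h: "h = (d, l)" by (cases h)
    have "even k \<noteq> even l"
      by (rule alternating_parity[OF alt, of c k d l]) (use \<open>g \<noteq> h\<close> that g h in simp_all)
    moreover have "k mod 2 = l mod 2" using that g h by simp
    ultimately show False by presburger
  qed
  have key: "?face h = ?face h'"
    if h: "h \<in> ?S" and h': "h' \<in> ?S" and eq: "component D ?s (arc_at D h) = component D ?s (arc_at D h')" for h h'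
  proof -
    \<comment> \<open>the arcs around one face form a closed set of the extreme state\<close>
    define U where "U = arc_at D ` {g \<in> ?S. ?face g = ?face h}"
    have mem: "arc_at D g \<in> U \<longleftrightarrow> ?face g = ?face h" if "g \<in> ?S" for g
    proof
      assume "arc_at D g \<in> U"
      then obtain g' where "g' \<in> ?S" "?face g' = ?face h" "arc_at D g = arc_at D g'" by (auto simp: U_def)
      thus "?face g = ?face h" using uniq[OF that, of g'] by simp
    next
      assume "?face g = ?face h"
      thus "arc_at D g \<in> U" using that unfolding U_def by blast
    qed
    have pair: "arc_at D (c, k) \<in> U \<longleftrightarrow> arc_at D (c, (k + 1) mod 4) \<in> U" if c: "c \<in> crossings D" "k < 4" "k mod 2 = b" for c k
    proof -
      have ck: "(c, k) \<in> ?H" using c by (auto simp: half_edges_def)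
      from other_end[OF D next_in[OF ck]] obtain g where
        g: "g \<noteq> (c, (k + 1) mod 4)" "{l \<in> ?H. arc_at D l = arc_at D (c, (k + 1) mod 4)} = {(c, (k + 1) mod 4), g}"
        by blast
      hence gH: "g \<in> ?H" "arc_at D g = arc_at D (c, (k + 1) mod 4)" by auto
      obtain d l where dl: "g = (d, l)" by (cases g)
      have "even l \<noteq> even ((k + 1) mod 4)"
        by (rule alternating_parity[OF alt, of d l c "(k + 1) mod 4"])
          (use gH g(1) dl next_in[OF ck] in simp_all)
      hence "l mod 2 = b" using c(2,3) by presburger
      hence "g \<in> ?S" using gH dl by simp
      moreover have "((c, k), g) \<in> ?r" using ck gH g by (auto simp: corner_step_def)
      ultimately show ?thesis using mem[of g] mem[of "(c, k)"] step[of c k g] ck c gH by auto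
    qed
    have "closed_arcs D ?s U"
      unfolding closed_arcs_def
    proof (intro conjI ballI)
      show "U \<subseteq> arcs D" using arc_in by (auto simp: U_def half_edges_def)
      fix c assume c: "c \<in> crossings D"
      show "compatible (?s c) (\<lambda>k. arc_at D (c, k) \<in> U)"
      proof (cases "b = 0")
        case True thus ?thesis using pair[OF c, of 0] pair[OF c, of 2] by (simp add: compatible_def)
      next
        case False
        hence "b = 1" using b by simp
        have "arc_at D (c, 1) \<in> U \<longleftrightarrow> arc_at D (c, 2) \<in> U"
          using pair[OF c, of 1] \<open>b = 1\<close> by (simp add: numeral_2_eq_2)
        moreover have "arc_at D (c, 3) \<in> U \<longleftrightarrow> arc_at D (c, 0) \<in> U"
          using pair[OF c, of 3] \<open>b = 1\<close> by simp
        ultimately show ?thesis using \<open>b = 1\<close> by (simp add: compatible_def)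
      qed
    qed
    moreover have "arc_at D h \<in> U" using mem[OF h] by simp
    ultimately have "component D ?s (arc_at D h) \<subseteq> U" by (rule component_subset)
    moreover have "arc_at D h' \<in> component D ?s (arc_at D h')"
      by (rule component_self) (use h' arc_in in \<open>auto simp: half_edges_def\<close>)
    ultimately have "arc_at D h' \<in> U" using eq subsetD by metis
    thus ?thesis unfolding mem[OF h'] by (rule sym)
  qed
  have "card (?face ` ?S) \<le> card ((\<lambda>h. component D ?s (arc_at D h)) ` ?S)"
  proof (rule card_image_le_card_image)
    show "finite ?S" using finH by simp
    fix g h assume "g \<in> ?S" "h \<in> ?S" "component D ?s (arc_at D g) = component D ?s (arc_at D h)"
    thus "?face g = ?face h" by (rule key)
  qed
  also have "\<dots> \<le> card (components D ?s)"
    using arc_in by (intro card_mono finite_components) (auto simp: components_def half_edges_def)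
  finally show ?thesis .
qed

lemma non_split_components:
  assumes D: "is_link_diagram D" and ns: "non_split D" and ne: "arcs D \<noteq> {}"
  shows "components D (\<lambda>_. 0) = {arcs D}"
proof -
  interpret four_valent D by (rule link_diagram_four_valent[OF D])
  have "component D (\<lambda>_. 0) a = arcs D" if a: "a \<in> arcs D" for a
  proof
    show "component D (\<lambda>_. 0) a \<subseteq> arcs D" by (auto simp: component_def)
    have "b \<in> U" if "(a, b) \<in> (meeting_arcs D)\<^sup>*" "closed_arcs D (\<lambda>_. 0) U" "a \<in> U" for b U
      using that(1)
    proof (induction rule: rtrancl_induct)
      case (step u v)
      then obtain c k l where ckl: "c \<in> crossings D" "k < 4" "l < 4" "u = arc_at D (c, k)" "v = arc_at D (c, l)"
        by (auto simp: meeting_arcs_def)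
      have "compatible 0 (\<lambda>k. arc_at D (c, k) \<in> U)" using that(2) ckl by (auto simp: closed_arcs_def)
      moreover have "k \<in> {0, 1, 2, 3}" "l \<in> {0, 1, 2, 3}" using ckl by auto
      ultimately show ?case using step.IH ckl by (auto simp: compatible_def)
    qed (use that in auto)
    thus "arcs D \<subseteq> component D (\<lambda>_. 0) a" using ns a by (auto simp: component_def non_split_def)
  qed
  thus ?thesis using ne by (auto simp: components_def)
qed

text \<open>
  With Euler's formula the two extreme states of a connected alternating diagram have two circles
  more than there are crossings.
\<close>

lemma alternating_turaev_genus_zero:
  assumes D: "is_link_diagram D" and alt: "alternating D" and ns: "non_split D"
  shows "turaev_genus_zero D"
proof -
  interpret four_valent D by (rule link_diagram_four_valent[OF D])
  show ?thesis
  proof (unfold_locales, cases "crossings D = {}")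
    case True
    thus "genus_defect D (\<lambda>_. 0) \<le> 0" using genus_defect_resolved[of "\<lambda>_. 0"] by (simp add: unresolved_def)
  next
    case False
    let ?N = "card (crossings D)" and ?H = "half_edges D"
    have finH: "finite ?H" by (simp add: half_edges_def finite_crossings)
    obtain c where c: "c \<in> crossings D" using False by auto
    have ne: "arcs D \<noteq> {}" using arc_in[OF c, of 0] by auto
    have touch: "a \<in> arc_at D ` ?H" if a: "a \<in> arcs D" for a
    proof -
      have "(a, arc_at D (c, 0)) \<in> (meeting_arcs D)\<^sup>*" using ns a arc_in[OF c, of 0] by (auto simp: non_split_def)
      thus ?thesis
        by (cases rule: converse_rtranclE) (use c in \<open>force simp: meeting_arcs_def half_edges_def\<close>)+
    qed
    have arcs: "arc_at D ` ?H = arcs D" using touch arc_in by (auto simp: half_edges_def)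
    have two: "card {h \<in> ?H. arc_at D h = a} = 2" if "a \<in> arcs D" for a
    proof -
      obtain h where h: "h \<in> ?H" "a = arc_at D h" using touch[OF \<open>a \<in> arcs D\<close>] by auto
      from other_end[OF D h(1)] h(2) show ?thesis by auto
    qed
    have "2 * card (arcs D) = (\<Sum>a\<in>arcs D. card {h \<in> ?H. arc_at D h = a})" by (simp add: two)
    also have "\<dots> = card ?H"
      using sum.group[OF finH finite_arcs, of "arc_at D" "\<lambda>_. 1::nat"] arcs by simp
    finally have E: "card (arcs D) = 2 * ?N" by (simp add: half_edges_def card_cartesian_product)
    have sub: "(meeting_arcs D)\<^sup>* `` {a} = arcs D" if a: "a \<in> arcs D" for a
    proof
      show "arcs D \<subseteq> (meeting_arcs D)\<^sup>* `` {a}" using ns a by (auto simp: non_split_def)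
      show "(meeting_arcs D)\<^sup>* `` {a} \<subseteq> arcs D"
      proof
        fix b assume "b \<in> (meeting_arcs D)\<^sup>* `` {a}"
        hence "(a, b) \<in> (meeting_arcs D)\<^sup>*" by simp
        thus "b \<in> arcs D" by (induction rule: rtrancl_induct) (use a arc_in in \<open>auto simp: meeting_arcs_def\<close>)
      qed
    qed
    have "arcs D // (meeting_arcs D)\<^sup>* = {arcs D}"
      using sub ne by (auto simp: quotient_def)
    hence F: "card (faces D) = ?N + 2"
      using D E unfolding is_link_diagram_def planar_def arcs by simp
    have "faces D = (\<Union>b\<in>{0, 1}. (\<lambda>h. (corner_step D)\<^sup>* `` {h}) ` {h \<in> ?H. snd h mod 2 = b})"
      unfolding faces_def quotient_def by force
    hence "card (faces D) \<le> (\<Sum>b\<in>{0, 1}. card ((\<lambda>h. (corner_step D)\<^sup>* `` {h}) ` {h \<in> ?H. snd h mod 2 = b}))"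
      using card_UN_le[of "{0, 1::nat}" "\<lambda>b. (\<lambda>h. (corner_step D)\<^sup>* `` {h}) ` {h \<in> ?H. snd h mod 2 = b}"] by simp
    also have "\<dots> \<le> card (components D (\<lambda>_. 1)) + card (components D (\<lambda>_. -1))"
      using card_faces_le[OF D alt, of 0] card_faces_le[OF D alt, of 1] by simp
    finally have "?N + 2 \<le> card (components D (\<lambda>_. 1)) + card (components D (\<lambda>_. -1))" using F by simp
    thus "genus_defect D (\<lambda>_. 0) \<le> 0"
      using non_split_components[OF D ns ne] by (simp add: genus_defect_def fill_def unresolved_def)
  qed
qed

section \<open>The differential on closed sets of arcs\<close>

text \<open>
  An enhanced state is determined by its state and the union \<open>P\<close> of its positive circles, a closed
  set of arcs. Merges and splits become very simple on these sets. In terms of the algebra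
  \<open>\<int>[x]/(x\<^sup>2)\<close>, in which a positive circle carries \<open>x\<close> and a negative one \<open>1\<close>, the set \<open>P\<close> is the
  monomial of the circles in \<open>P\<close>.

  The site of a crossing consists of the one or two circles through it. As a set of arcs it does not
  depend on the marker, since it is the component of the diagram with that crossing unresolved.
\<close>

definition site :: "link_diagram \<Rightarrow> (nat \<Rightarrow> int) \<Rightarrow> nat \<Rightarrow> nat set" where
  "site D s c = component D (s(c := 0)) (arc_at D (c, 0))"

definition degree :: "link_diagram \<Rightarrow> (nat \<Rightarrow> int) \<Rightarrow> nat set \<Rightarrow> int" where
  "degree D s P = 2 * int (card {C \<in> components D s. C \<subseteq> P}) - int (card (components D s))"

text \<open>
  The incidence numbers of Khovanov's differential: the circles away from the crossing keep their
  signs. The condition on the degree says that the grading \<open>j\<close> is preserved.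
\<close>

definition edge :: "link_diagram \<Rightarrow> (nat \<Rightarrow> int) \<Rightarrow> nat \<Rightarrow> nat set \<Rightarrow> nat set \<Rightarrow> bool" where
  "edge D s c P Q \<longleftrightarrow> P - site D s c = Q - site D s c \<and> degree D (s(c := -1)) Q = degree D s P + 1"

definition full_state :: "link_diagram \<Rightarrow> (nat \<Rightarrow> int) \<Rightarrow> bool" where
  "full_state D s \<longleftrightarrow> (\<forall>c\<in>crossings D. s c \<in> {1, -1})"

text \<open>
  The matrix of the deformed differential for \<open>\<int>[x]/(x\<^sup>2 - x)\<close>, in the basis of monomials: a merge
  identifies two variables and a split multiplies by \<open>x\<^sub>1 + x\<^sub>2 - 1\<close>. It does not preserve the grading,
  but it is much easier to handle: the deformed algebra is the ring of integer functions on
  \<open>{0, 1}\<close>, so the states of circles become functions on labellings of the circles.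
\<close>

definition bar_natan :: "link_diagram \<Rightarrow> (nat \<Rightarrow> int) \<Rightarrow> nat \<Rightarrow> nat set \<Rightarrow> nat set \<Rightarrow> int" where
  "bar_natan D s c P Q =
     (if separates D s c 1 then of_bool (Q = (if P \<inter> site D s c = {} then P else P \<union> site D s c))
      else if site D s c \<subseteq> P then of_bool (Q = P)
      else of_bool (Q = P \<union> component D (s(c := -1)) (arc_at D (c, 0)))
         + of_bool (Q = P \<union> component D (s(c := -1)) (arc_at D (c, 2))) - of_bool (Q = P))"

definition edge_sign :: "link_diagram \<Rightarrow> (nat \<Rightarrow> int) \<Rightarrow> nat \<Rightarrow> int" where
  "edge_sign D s c = (-1) ^ card {b \<in> crossings D. s b = -1 \<and> c < b}"

text \<open>
  The sum picks out the crossing at which the markers of the two generators differ.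
\<close>

definition coeff :: "link_diagram \<Rightarrow> (nat \<Rightarrow> int) \<times> nat set \<Rightarrow> (nat \<Rightarrow> int) \<times> nat set \<Rightarrow> int" where
  "coeff D x y = (\<Sum>c\<in>crossings D. if fst x c = 1 \<and> fst y = (fst x)(c := -1)
      then edge_sign D (fst x) c * of_bool (edge D (fst x) c (snd x) (snd y)) else 0)"

lemma compatible_both: "compatible 0 u \<longleftrightarrow> compatible 1 u \<and> compatible (-1) u"
  by (auto simp: compatible_def)

lemma compatible_zero_eq: "compatible 0 u \<Longrightarrow> k < 4 \<Longrightarrow> u k = u 0"
proof -
  assume "compatible 0 u" "k < 4"
  moreover have "k = 0 \<or> k = 1 \<or> k = 2 \<or> k = 3" using \<open>k < 4\<close> by auto
  ultimately show ?thesis by (elim disjE) (simp_all add: compatible_def)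
qed

text \<open>
  The monomials, as functions of the set of circles labelled \<open>1\<close>, are linearly independent.
\<close>

lemma subset_moebius:
  fixes g h :: "'a set \<Rightarrow> int"
  assumes "finite F" "\<And>U. U \<in> F \<Longrightarrow> finite U"
    and eq: "\<And>U. U \<in> F \<Longrightarrow> (\<Sum>Q\<in>F. g Q * of_bool (Q \<subseteq> U)) = (\<Sum>Q\<in>F. h Q * of_bool (Q \<subseteq> U))"
    and "U \<in> F"
  shows "g U = h U"
proof -
  have "finite U" using assms by simp
  thus ?thesis using \<open>U \<in> F\<close>
  proof (induction U rule: finite_psubset_induct)
    case (psubset U)
    have *: "(\<Sum>Q\<in>F. f Q * of_bool (Q \<subseteq> U)) = f U + (\<Sum>Q\<in>F - {U}. f Q * of_bool (Q \<subseteq> U))" for f :: "'a set \<Rightarrow> int"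
      using sum.remove[OF assms(1) psubset.prems, of "\<lambda>Q. f Q * of_bool (Q \<subseteq> U)"] by simp
    have "(\<Sum>Q\<in>F - {U}. g Q * of_bool (Q \<subseteq> U)) = (\<Sum>Q\<in>F - {U}. h Q * of_bool (Q \<subseteq> U))"
    proof (rule sum.cong[OF refl])
      fix Q assume Q: "Q \<in> F - {U}"
      show "g Q * of_bool (Q \<subseteq> U) = h Q * of_bool (Q \<subseteq> U)"
        using psubset.IH[of Q] Q by (cases "Q \<subseteq> U") auto
    qed
    thus ?case using eq[OF psubset.prems] *[of g] *[of h] by linarith
  qed
qed

context four_valent
begin

lemma finite_closed: "finite {Q. closed_arcs D p Q}"
  by (rule finite_subset[of _ "Pow (arcs D)"]) (use closed_subset finite_arcs in auto)

lemma closed_both_markers: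
  assumes "c \<in> crossings D"
  shows "closed_arcs D (s(c := 0)) U \<longleftrightarrow> closed_arcs D (s(c := 1)) U \<and> closed_arcs D (s(c := -1)) U"
  using assms compatible_both unfolding closed_arcs_def by (auto simp: fun_upd_apply)

text \<open>
  The circles away from \<open>c\<close> contribute the same to the degree for either marker, which reduces every
  condition on degrees to the one or two circles through \<open>c\<close>.
\<close>

lemma degree_local:
  fixes s :: "nat \<Rightarrow> int"
  assumes m: "m \<in> {1, -1}" and c: "c \<in> crossings D"
  defines "X \<equiv> component D (s(c := m)) (arc_at D (c, 0))"
    and "Y \<equiv> component D (s(c := m)) (arc_at D (c, 2))"
  shows "degree D (s(c := m)) P =
    2 * int (card {C \<in> components D (s(c := 0)) - {site D s c}. C \<subseteq> P - site D s c})
      - int (card (components D (s(c := 0)) - {site D s c}))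
      + (if separates D s c m then 2 * of_bool (X \<subseteq> P) + 2 * of_bool (Y \<subseteq> P) - 2
         else 2 * of_bool (site D s c \<subseteq> P) - 1)"
proof -
  let ?T = "site D s c"
  let ?O = "components D (s(c := 0)) - {?T}"
  note cu = components_unresolved[OF m c, of s, folded X_def Y_def site_def]
  have dis: "C \<inter> ?T = {}" if "C \<in> ?O" for C using components_eqI[OF _ cu(3), of C] that by auto
  have n: "X \<notin> ?O" "Y \<notin> ?O" using dis[of X] dis[of Y] cu(1,4,5) by auto
  have fin: "finite ?O" using finite_components by auto
  have eq: "{C \<in> ?O. C \<subseteq> P - ?T} = {C \<in> ?O. C \<subseteq> P}" using dis by blast
  have set: "{C \<in> components D (s(c := m)). C \<subseteq> P} =
      {C \<in> {X, Y}. C \<subseteq> P} \<union> {C \<in> ?O. C \<subseteq> P}" unfolding cu(2) by blast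
  have card: "card {C \<in> components D (s(c := m)). C \<subseteq> P} = card {C \<in> {X, Y}. C \<subseteq> P} + card {C \<in> ?O. C \<subseteq> P}"
    unfolding set by (rule card_Un_disjoint) (use n fin in auto)
  have cardO: "card (components D (s(c := m))) = card {X, Y} + card ?O"
    unfolding cu(2) using n fin by (auto simp: card_insert_if)
  show ?thesis
  proof (cases "X = Y")
    case True
    hence "X = ?T" using cu(1) by simp
    hence "{C \<in> {X, Y}. C \<subseteq> P} = (if ?T \<subseteq> P then {?T} else {})" using True by auto
    thus ?thesis using True card cardO cu(6) unfolding degree_def eq by simp
  next
    case False
    have "{C \<in> {X, Y}. C \<subseteq> P} = (if X \<subseteq> P then {X} else {}) \<union> (if Y \<subseteq> P then {Y} else {})" by auto
    hence "int (card {C \<in> {X, Y}. C \<subseteq> P}) = of_bool (X \<subseteq> P) + of_bool (Y \<subseteq> P)"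
      using False by (simp add: card_insert_if)
    thus ?thesis using False card cardO cu(6) unfolding degree_def eq by simp
  qed
qed

text \<open>Sets of arcs that avoid a crossing do not see its marker.\<close>

lemma closed_away:
  assumes "closed_arcs D p U" "\<And>d. d \<in> crossings D \<Longrightarrow> d \<noteq> b \<Longrightarrow> q d = p d"
    and "\<And>k. k < 4 \<Longrightarrow> arc_at D (b, k) \<notin> U"
  shows "closed_arcs D q U"
proof -
  have "compatible (q d) (\<lambda>k. arc_at D (d, k) \<in> U)" if "d \<in> crossings D" for d
    using assms that by (cases "d = b") (auto simp: closed_arcs_def compatible_def)
  thus ?thesis using assms(1) by (auto simp: closed_arcs_def)
qed

lemma component_away:
  assumes "closed_arcs D p U" "\<And>d. d \<in> crossings D \<Longrightarrow> d \<noteq> b \<Longrightarrow> q d = p d"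
    and "\<And>k. k < 4 \<Longrightarrow> arc_at D (b, k) \<notin> U" and "a \<in> U"
  shows "component D q a = component D p a"
proof -
  have U: "closed_arcs D q U" by (rule closed_away[OF assms(1-3)])
  have 1: "component D p a \<subseteq> U" "component D q a \<subseteq> U" using component_subset assms(1,4) U by auto
  have a: "a \<in> arcs D" using assms(4) closed_subset[OF U] by auto
  have "closed_arcs D q (component D p a)"
    by (rule closed_away[OF closed_component assms(2)]) (use 1 assms(3) in auto)
  moreover have "closed_arcs D p (component D q a)"
    by (rule closed_away[OF closed_component, where b = b]) (use 1 assms(2,3) in auto)
  ultimately show ?thesis using component_subset component_self[OF a] by blast
qed

end

context turaev_genus_zero
begin

text \<open>
  The merge and split rules of Khovanov homology in terms of closed sets. The last two statements say
  that Khovanov's differential is the part of top degree of the deformed one.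
\<close>

lemma edge_cases:
  assumes s: "full_state D s" and c: "c \<in> crossings D" "s c = 1"
    and P: "closed_arcs D s P" and Q: "closed_arcs D (s(c := -1)) Q"
  defines "X \<equiv> component D (s(c := -1)) (arc_at D (c, 0))"
    and "Y \<equiv> component D (s(c := -1)) (arc_at D (c, 2))"
  shows "separates D s c 1 \<Longrightarrow>
      edge D s c P Q \<longleftrightarrow> \<not> site D s c \<subseteq> P \<and> Q = (if P \<inter> site D s c = {} then P else P \<union> site D s c)"
    and "\<not> separates D s c 1 \<Longrightarrow>
      edge D s c P Q \<longleftrightarrow> (if site D s c \<subseteq> P then Q = P else Q = P \<union> X \<or> Q = P \<union> Y)"
    and "bar_natan D s c P Q \<noteq> 0 \<Longrightarrow> degree D (s(c := -1)) Q \<le> degree D s P + 1"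
    and "degree D (s(c := -1)) Q = degree D s P + 1 \<Longrightarrow> bar_natan D s c P Q = of_bool (edge D s c P Q)"
proof -
  let ?T = "site D s c" and ?t = "s(c := -1)"
  have s1: "s(c := 1) = s" using c by (simp add: fun_upd_idem)
  have full: "s d \<in> {1, -1}" if "d \<in> crossings D" for d using s that by (simp add: full_state_def)
  have sep: "separates D s c (-1) \<longleftrightarrow> \<not> separates D s c 1"
    by (rule separates_minus_iff[OF c(1) full])
  define A where "A = component D s (arc_at D (c, 0))"
  define B where "B = component D s (arc_at D (c, 2))"
  note cs = components_unresolved[of 1 c s, OF _ c(1), unfolded s1, folded A_def B_def site_def, simplified]
  note ct = components_unresolved[of "-1" c s, OF _ c(1), folded X_def Y_def site_def, simplified]
  note dl = degree_local[of 1 c s P, OF _ c(1), unfolded s1, folded A_def B_def, simplified]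
  note dt = degree_local[of "-1" c s Q, OF _ c(1), folded X_def Y_def, simplified]
  have A: "A \<subseteq> P \<or> A \<inter> P = {}" and B: "B \<subseteq> P \<or> B \<inter> P = {}"
    using components_cases[OF _ P] cs by auto
  have X: "X \<subseteq> Q \<or> X \<inter> Q = {}" and Y: "Y \<subseteq> Q \<or> Y \<inter> Q = {}"
    using components_cases[OF _ Q] ct by auto
  have e: "edge D s c P Q \<longleftrightarrow> P - ?T = Q - ?T \<and>
     (if separates D s c 1
      then (of_bool (?T \<subseteq> Q) :: int) = of_bool (A \<subseteq> P) + of_bool (B \<subseteq> P)
      else of_bool (X \<subseteq> Q) + of_bool (Y \<subseteq> Q) = (of_bool (?T \<subseteq> P) + 1 :: int))"
  proof (cases "P - ?T = Q - ?T")
    case True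
    thus ?thesis unfolding edge_def dl dt sep by (simp add: True)
  qed (simp add: edge_def)
  show merge: "edge D s c P Q \<longleftrightarrow> \<not> ?T \<subseteq> P \<and> Q = (if P \<inter> ?T = {} then P else P \<union> ?T)"
    if m: "separates D s c 1"
  proof -
    have AB: "A \<inter> B = {}" "?T = A \<union> B" using m cs by auto
    have T: "?T \<subseteq> Q \<or> ?T \<inter> Q = {}" using m sep ct X by auto
    show ?thesis
    proof (cases "P \<inter> ?T = {}")
      case True
      hence "\<not> A \<subseteq> P" "\<not> B \<subseteq> P" using AB cs by auto
      thus ?thesis using e m T True AB by (auto simp: of_bool_def)
    next
      case False
      hence AP: "A \<subseteq> P \<or> B \<subseteq> P" using A B AB by blast
      have "edge D s c P Q \<longleftrightarrow> P - ?T = Q - ?T \<and> (?T \<subseteq> Q \<longleftrightarrow> (A \<subseteq> P) \<noteq> (B \<subseteq> P)) \<and> \<not> (A \<subseteq> P \<and> B \<subseteq> P)"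
        using e m by (auto simp: of_bool_def)
      also have "\<dots> \<longleftrightarrow> P - ?T = Q - ?T \<and> ?T \<subseteq> Q \<and> \<not> ?T \<subseteq> P" using AP AB by blast
      also have "\<dots> \<longleftrightarrow> \<not> ?T \<subseteq> P \<and> Q = P \<union> ?T" by blast
      finally show ?thesis using False by simp
    qed
  qed
  have XY: "X \<inter> Y = {}" if "\<not> separates D s c 1" using that sep ct by simp
  show split: "edge D s c P Q \<longleftrightarrow> (if ?T \<subseteq> P then Q = P else Q = P \<union> X \<or> Q = P \<union> Y)"
    if m: "\<not> separates D s c 1"
  proof -
    have T: "?T \<subseteq> P \<or> ?T \<inter> P = {}" using m cs A by auto
    have XT: "?T = X \<union> Y" "X \<noteq> {}" "Y \<noteq> {}" using ct by auto
    show ?thesis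
    proof (cases "?T \<subseteq> P")
      case True
      thus ?thesis using e m XT X Y by (auto simp: of_bool_def)
    next
      case False
      hence TP: "?T \<inter> P = {}" using T by simp
      show ?thesis
      proof
        assume "edge D s c P Q"
        hence PQ: "P - ?T = Q - ?T" and "X \<subseteq> Q \<and> \<not> Y \<subseteq> Q \<or> \<not> X \<subseteq> Q \<and> Y \<subseteq> Q"
          using e m False by (simp_all add: of_bool_def split: if_splits)
        hence "X \<subseteq> Q \<and> Y \<inter> Q = {} \<or> X \<inter> Q = {} \<and> Y \<subseteq> Q" using X Y by blast
        moreover have "Q \<inter> ?T = (Q \<inter> X) \<union> (Q \<inter> Y)" "P = P - ?T" using XT TP by blast+
        ultimately have "Q = P \<union> X \<or> Q = P \<union> Y" using PQ by blast
        thus "if ?T \<subseteq> P then Q = P else Q = P \<union> X \<or> Q = P \<union> Y" using False by simp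
      next
        assume "if ?T \<subseteq> P then Q = P else Q = P \<union> X \<or> Q = P \<union> Y"
        hence Q: "Q = P \<union> X \<or> Q = P \<union> Y" using False by simp
        have "\<not> Y \<subseteq> P \<union> X" "\<not> X \<subseteq> P \<union> Y" using XT TP XY[OF m] by blast+
        hence "(X \<subseteq> Q) \<noteq> (Y \<subseteq> Q)" using Q by blast
        moreover have "P - ?T = P" "(P \<union> X) - ?T = P" "(P \<union> Y) - ?T = P" using XT TP by blast+
        hence "P - ?T = Q - ?T" using Q by metis
        ultimately show "edge D s c P Q" unfolding e using m False by simp
      qed
    qed
  qed
  have bn: "if separates D s c 1 then Q = (if P \<inter> ?T = {} then P else P \<union> ?T)
      else if ?T \<subseteq> P then Q = P else Q = P \<union> X \<or> Q = P \<union> Y \<or> Q = P"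
    if "bar_natan D s c P Q \<noteq> 0"
    by (rule ccontr) (use that in \<open>simp add: bar_natan_def X_def Y_def split: if_splits\<close>)
  have PQ: "P - ?T = Q - ?T" if "bar_natan D s c P Q \<noteq> 0"
  proof -
    from bn[OF that] have "Q = P \<or> Q = P \<union> ?T \<or> Q = P \<union> X \<or> Q = P \<union> Y" by metis
    thus ?thesis using ct(1) by (elim disjE) blast+
  qed
  show le: "degree D ?t Q \<le> degree D s P + 1" if "bar_natan D s c P Q \<noteq> 0"
  proof (cases "separates D s c 1")
    case True
    have "A \<subseteq> P \<or> B \<subseteq> P" if "?T \<subseteq> Q"
    proof -
      have "P \<inter> ?T \<noteq> {}" using bn[OF \<open>bar_natan D s c P Q \<noteq> 0\<close>] True that ct(1,4) by (auto split: if_splits)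
      thus ?thesis using A B cs(1) by blast
    qed
    thus ?thesis unfolding dl dt sep PQ[OF that] using True by auto
  next
    case False
    have "\<not> (X \<subseteq> Q \<and> Y \<subseteq> Q)" if "\<not> ?T \<subseteq> P"
    proof -
      have "?T \<inter> P = {}" using that False cs A by auto
      moreover have "Q = P \<or> Q = P \<union> X \<or> Q = P \<union> Y"
        using bn[OF \<open>bar_natan D s c P Q \<noteq> 0\<close>] that False by metis
      ultimately show ?thesis using XY[OF False] ct(1,4,5) by blast
    qed
    thus ?thesis unfolding dl dt sep PQ[OF that] using False by auto
  qed
  show "bar_natan D s c P Q = of_bool (edge D s c P Q)" if d: "degree D ?t Q = degree D s P + 1"
  proof (cases "separates D s c 1")
    case True
    have "\<not> ?T \<subseteq> P" if "Q = (if P \<inter> ?T = {} then P else P \<union> ?T)"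
    proof
      assume T: "?T \<subseteq> P"
      hence "A \<subseteq> P" "B \<subseteq> P" "Q - ?T = P - ?T" using that cs(1) by (auto split: if_splits)
      thus False using d True unfolding dl dt sep by (auto simp: of_bool_def split: if_splits)
    qed
    hence "edge D s c P Q \<longleftrightarrow> Q = (if P \<inter> ?T = {} then P else P \<union> ?T)"
      using merge[OF True] by blast
    thus ?thesis using True by (simp only: bar_natan_def if_True)
  next
    case False
    show ?thesis
    proof (cases "?T \<subseteq> P")
      case True
      thus ?thesis using split[OF False] False by (auto simp: bar_natan_def)
    next
      case T: False
      hence TP: "?T \<inter> P = {}" using False cs A by auto
      have "Q \<noteq> P"
      proof
        assume "Q = P"
        hence "\<not> X \<subseteq> Q" "\<not> Y \<subseteq> Q" using TP ct(1,4,5) by blast+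
        thus False using d T \<open>Q = P\<close> False unfolding dl dt sep by simp
      qed
      moreover have "P \<union> X \<noteq> P \<union> Y" using TP ct(1,4,5) XY[OF False] by blast
      ultimately show ?thesis using split[OF False] False T
        unfolding bar_natan_def X_def[symmetric] Y_def[symmetric] by auto
    qed
  qed
qed

text \<open>
  As a map of functions on labellings, a merge is restriction to the labellings that agree on the two
  circles, and a split is extension by zero followed by multiplication by \<open>x\<^sub>1 + x\<^sub>2 - 1\<close>, which is
  \<open>1\<close> or \<open>-1\<close> where the two labels agree.
\<close>

definition edge_weight :: "(nat \<Rightarrow> int) \<Rightarrow> nat \<Rightarrow> nat set \<Rightarrow> int" where
  "edge_weight s c U = (if separates D s c 1 \<or> arc_at D (c, 0) \<in> U then 1 else -1)"

text \<open>
  The coefficients above are those of the map of functions just described, applied to the monomial of \<open>P\<close>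
  and evaluated at the labelling with value \<open>1\<close> on \<open>U\<close>.
\<close>

lemma bar_natan_expand:
  assumes s: "full_state D s" and c: "c \<in> crossings D" "s c = 1"
    and P: "closed_arcs D s P" and U: "closed_arcs D (s(c := -1)) U"
  shows "(\<Sum>Q | closed_arcs D (s(c := -1)) Q. bar_natan D s c P Q * of_bool (Q \<subseteq> U)) =
    of_bool (closed_arcs D s U) * (of_bool (P \<subseteq> U) * edge_weight s c U)"
proof -
  let ?T = "site D s c" and ?t = "s(c := -1)" and ?F = "{Q. closed_arcs D (s(c := -1)) Q}"
  have s1: "s(c := 1) = s" using c by (simp add: fun_upd_idem)
  have full: "s d \<in> {1, -1}" if "d \<in> crossings D" for d using s that by (simp add: full_state_def)
  have sep: "separates D s c (-1) \<longleftrightarrow> \<not> separates D s c 1"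
    by (rule separates_minus_iff[OF c(1) full])
  define A where "A = component D s (arc_at D (c, 0))"
  define B where "B = component D s (arc_at D (c, 2))"
  define X where "X = component D (s(c := -1)) (arc_at D (c, 0))"
  define Y where "Y = component D (s(c := -1)) (arc_at D (c, 2))"
  note cs = components_unresolved[of 1 c s, OF _ c(1), unfolded s1, folded A_def B_def site_def, simplified]
  note ct = components_unresolved[of "-1" c s, OF _ c(1), folded X_def Y_def site_def, simplified]
  have A: "A \<subseteq> P \<or> A \<inter> P = {}" and B: "B \<subseteq> P \<or> B \<inter> P = {}"
    using components_cases[OF _ P] cs by auto
  have X: "X \<subseteq> U \<or> X \<inter> U = {}" and Y: "Y \<subseteq> U \<or> Y \<inter> U = {}"
    using components_cases[OF _ U] ct by auto
  have both: "closed_arcs D (s(c := 0)) Q \<longleftrightarrow> closed_arcs D s Q \<and> closed_arcs D ?t Q" for Q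
    using closed_both_markers[OF c(1), of s] s1 by simp
  have xT: "arc_at D (c, 0) \<in> ?T" and yT: "arc_at D (c, 2) \<in> ?T" using ct(1,10,11) by blast+
  have link: "closed_arcs D (s(c := 0)) V \<longleftrightarrow> closed_arcs D (s(c := m)) V" if "m \<in> {1, -1}" "?T \<subseteq> V \<or> ?T \<inter> V = {}" for m V
    unfolding closed_unresolved[OF that(1) c(1)] using that(2) xT yT by blast
  have cU: "closed_arcs D s U \<longleftrightarrow> (?T \<subseteq> U \<or> ?T \<inter> U = {})"
    using link[of "-1" U] U both components_cases[OF cs(3), of U] by blast
  have T: "closed_arcs D s ?T" "closed_arcs D ?t ?T" using both components_closed[OF cs(3)] by auto
  have fin: "finite ?F" by (rule finite_closed)
  have delta: "(\<Sum>Q | closed_arcs D ?t Q. of_bool (Q = R) * of_bool (Q \<subseteq> U)) = (of_bool (R \<subseteq> U) :: int)"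
    if "closed_arcs D ?t R" for R
  proof -
    have "(\<Sum>Q\<in>?F. of_bool (Q = R) * of_bool (Q \<subseteq> U)) = (\<Sum>Q\<in>?F. if Q = R then of_bool (R \<subseteq> U) else (0 :: int))"
      by (rule sum.cong) auto
    thus ?thesis using that fin by simp
  qed
  have cP: "closed_arcs D ?t P" if "?T \<subseteq> P \<or> ?T \<inter> P = {}"
    using link[of 1 P] that P both s1 by simp
  show ?thesis
  proof (cases "separates D s c 1")
    case True
    let ?R = "if P \<inter> ?T = {} then P else P \<union> ?T"
    have "closed_arcs D s (P \<union> ?T)" by (rule closed_Un[OF P T(1)])
    hence "closed_arcs D ?t (P \<union> ?T)" using link[of 1 "P \<union> ?T"] s1 both by simp
    hence R: "closed_arcs D ?t ?R" using cP by (simp add: Int_commute)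
    have TU: "?T \<subseteq> U \<or> ?T \<inter> U = {}" using True sep ct X by auto
    have "(\<Sum>Q | closed_arcs D ?t Q. bar_natan D s c P Q * of_bool (Q \<subseteq> U)) = of_bool (?R \<subseteq> U)"
      using delta[OF R] True by (simp only: bar_natan_def if_True)
    also have "?R \<subseteq> U \<longleftrightarrow> P \<subseteq> U" using TU by auto
    finally show ?thesis using True cU TU by (simp only:) (simp add: edge_weight_def)
  next
    case False
    hence AT: "A = ?T" using cs by auto
    show ?thesis
    proof (cases "?T \<subseteq> P")
      case True
      have e: "(\<Sum>Q | closed_arcs D ?t Q. bar_natan D s c P Q * of_bool (Q \<subseteq> U)) = of_bool (P \<subseteq> U)"
        using delta[OF cP[OF disjI1[OF True]]] True False by (simp only: bar_natan_def if_True if_False)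
      have "closed_arcs D s U \<and> arc_at D (c, 0) \<in> U" if "P \<subseteq> U" using that True cU xT by auto
      thus ?thesis unfolding e by (auto simp: edge_weight_def)
    next
      case T': False
      hence TP: "?T \<inter> P = {}" using A AT by auto
      have cX: "closed_arcs D ?t (P \<union> X)" "closed_arcs D ?t (P \<union> Y)"
        using closed_Un cP TP components_closed ct by auto
      have e: "(\<Sum>Q | closed_arcs D ?t Q. bar_natan D s c P Q * of_bool (Q \<subseteq> U)) =
        of_bool (P \<union> X \<subseteq> U) + of_bool (P \<union> Y \<subseteq> U) - of_bool (P \<subseteq> U)"
        using delta[OF cX(1)] delta[OF cX(2)] delta[OF cP[OF disjI2[OF TP]]] TP False T'
        unfolding bar_natan_def X_def[symmetric] Y_def[symmetric]
        by (simp only: if_False if_True sum.distrib sum_subtractf distrib_right left_diff_distrib)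
      have x: "arc_at D (c, 0) \<in> U \<longleftrightarrow> X \<subseteq> U" using X ct(10) by blast
      have "?T \<subseteq> U \<longleftrightarrow> X \<subseteq> U \<and> Y \<subseteq> U" "?T \<inter> U = {} \<longleftrightarrow> \<not> X \<subseteq> U \<and> \<not> Y \<subseteq> U"
        using X Y ct(1,4,5) by blast+
      thus ?thesis unfolding e edge_weight_def x cU using False by auto
    qed
  qed
qed


lemma card_components_change:
  assumes s: "full_state D s" and c: "c \<in> crossings D" "s c = 1"
  shows "int (card (components D (s(c := -1)))) =
    int (card (components D s)) + (if separates D s c 1 then -1 else 1)"
proof -
  have s1: "s(c := 1) = s" using c by (simp add: fun_upd_idem)
  have "separates D s c (-1) \<longleftrightarrow> \<not> separates D s c 1"
    using s by (intro separates_minus_iff[OF c(1)]) (simp add: full_state_def)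
  thus ?thesis using card_components_resolve[of 1 c s] card_components_resolve[of "-1" c s] c s1 by auto
qed

text \<open>
  Whether the strands at \<open>a\<close> belong to one circle can change with the marker of \<open>b\<close> only if this circle
  passes through \<open>b\<close>.
\<close>

lemma separates_away:
  assumes ab: "a \<in> crossings D" "a \<noteq> b" "s a = 1"
    and U: "closed_arcs D s U" and b: "\<And>k. k < 4 \<Longrightarrow> arc_at D (b, k) \<notin> U" and x: "arc_at D (a, 0) \<in> U"
  shows "separates D (s(b := m)) a 1 = separates D s a 1"
proof -
  have "(s(b := m))(a := 1) = s(b := m)" "s(a := 1) = s" using ab by (simp_all add: fun_upd_idem)
  moreover have "component D (s(b := m)) (arc_at D (a, 0)) = component D s (arc_at D (a, 0))"
    by (rule component_away[OF U _ b x]) auto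
  ultimately show ?thesis by (simp add: separates_def)
qed

text \<open>
  On the labellings that survive both edges of a square, all four arcs at either crossing agree. If the
  square splits at different crossings along its two paths, then the two crossings lie on a common
  circle, hence carry the same label.
\<close>

lemma edge_weight_square:
  assumes s: "full_state D s" and ab: "a \<in> crossings D" "b \<in> crossings D" "a \<noteq> b" "s a = 1" "s b = 1"
    and U: "closed_arcs D s U" "closed_arcs D (s(a := -1, b := -1)) U"
  shows "closed_arcs D (s(a := -1)) U"
    and "edge_weight (s(a := -1)) b U * edge_weight s a U = edge_weight (s(b := -1)) a U * edge_weight s b U"
proof -
  have compat: "compatible (s d) (\<lambda>k. arc_at D (d, k) \<in> U)"
    "compatible ((s(a := -1, b := -1)) d) (\<lambda>k. arc_at D (d, k) \<in> U)" if "d \<in> crossings D" for d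
    using U that unfolding closed_arcs_def by blast+
  show "closed_arcs D (s(a := -1)) U"
    unfolding closed_arcs_def
  proof (intro conjI ballI)
    fix d assume d: "d \<in> crossings D"
    show "compatible ((s(a := -1)) d) (\<lambda>k. arc_at D (d, k) \<in> U)"
      using compat[OF d] ab by (cases "d = a"; cases "d = b") auto
  qed (use closed_subset[OF U(1)] in auto)
  have all4: "arc_at D (d, k) \<in> U \<longleftrightarrow> arc_at D (d, 0) \<in> U" if "d \<in> {a, b}" "k < 4" for d k
  proof -
    have "d \<in> crossings D" using that ab by auto
    hence "compatible 1 (\<lambda>k. arc_at D (d, k) \<in> U)" "compatible (-1) (\<lambda>k. arc_at D (d, k) \<in> U)"
      using compat[of d] that ab by auto
    hence "compatible 0 (\<lambda>k. arc_at D (d, k) \<in> U)" by (simp only: compatible_both simp_thms)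
    thus ?thesis by (rule compatible_zero_eq[OF _ that(2)])
  qed
  have fa: "full_state D (s(a := -1))" and fb: "full_state D (s(b := -1))"
    using s by (auto simp: full_state_def)
  have sw: "s(a := -1, b := -1) = s(b := -1, a := -1)" using ab by (simp add: fun_upd_twist)
  have b1: "(s(a := -1)) b = 1" and a1: "(s(b := -1)) a = 1" using ab by auto
  let ?e = "\<lambda>r c. if separates D r c 1 then -1 else 1 :: int"
  have k: "?e s a + ?e (s(a := -1)) b = ?e s b + ?e (s(b := -1)) a"
    using card_components_change[OF s ab(1,4)] card_components_change[OF fa ab(2) b1, unfolded sw]
      card_components_change[OF s ab(2,5)] card_components_change[OF fb ab(1) a1] by linarith
  show "edge_weight (s(a := -1)) b U * edge_weight s a U = edge_weight (s(b := -1)) a U * edge_weight s b U"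
  proof (cases "separates D s a 1 = separates D (s(b := -1)) a 1")
    case True
    hence "separates D s b 1 = separates D (s(a := -1)) b 1"
      using k by (simp split: if_splits)
    thus ?thesis using True by (simp add: edge_weight_def)
  next
    case False
    hence e: "separates D s b 1 = separates D s a 1" "separates D (s(a := -1)) b 1 = separates D (s(b := -1)) a 1"
      using k by (simp_all split: if_splits)
    have "arc_at D (a, 0) \<in> U \<longleftrightarrow> arc_at D (b, 0) \<in> U"
    proof (rule ccontr)
      assume n: "(arc_at D (a, 0) \<in> U) \<noteq> (arc_at D (b, 0) \<in> U)"
      define V where "V = (if arc_at D (a, 0) \<in> U then U else arcs D - U)"
      have "closed_arcs D s V" using U closed_Compl by (simp add: V_def)
      moreover have "arc_at D (b, k) \<notin> V" if "k < 4" for k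
        using n all4[of b k] that by (auto simp: V_def)
      moreover have "arc_at D (a, 0) \<in> V" using arc_in[OF ab(1), of 0] by (simp add: V_def)
      ultimately have "separates D (s(b := -1)) a 1 = separates D s a 1"
        using separates_away[of a b s V "-1"] ab by blast
      thus False using False by simp
    qed
    thus ?thesis using e by (simp add: edge_weight_def)
  qed
qed

text \<open>
  Both paths around a square of the deformed cube send a function \<open>f\<close> on labellings to the same
  multiple of its restriction. Comparing coefficients of the basis of monomials and keeping the terms
  of top degree gives the commutativity of the squares of Khovanov's cube.
\<close>

lemma edge_square:
  assumes s: "full_state D s" and ab: "a \<in> crossings D" "b \<in> crossings D" "a \<noteq> b" "s a = 1" "s b = 1"
    and P: "closed_arcs D s P" and Q: "closed_arcs D (s(a := -1, b := -1)) Q"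
  shows "(\<Sum>R | closed_arcs D (s(a := -1)) R. of_bool (edge D s a P R) * of_bool (edge D (s(a := -1)) b R Q)) =
    (\<Sum>R | closed_arcs D (s(b := -1)) R. of_bool (edge D s b P R) * of_bool (edge D (s(b := -1)) a R Q) :: int)"
proof -
  let ?F = "{Q. closed_arcs D (s(a := -1, b := -1)) Q}"
  have sw: "s(b := -1, a := -1) = s(a := -1, b := -1)" using ab by (simp add: fun_upd_twist)
  define G where "G a b Q = (\<Sum>R | closed_arcs D (s(a := -1)) R.
    bar_natan D s a P R * bar_natan D (s(a := -1)) b R Q)" for a b Q
  have full: "full_state D (s(c := -1))" for c using s by (auto simp: full_state_def)
  have G: "(\<Sum>Q\<in>?F. G a b Q * of_bool (Q \<subseteq> U)) =
      of_bool (closed_arcs D s U) * (of_bool (P \<subseteq> U) * (edge_weight (s(a := -1)) b U * edge_weight s a U))"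
    if c: "a \<in> crossings D" "b \<in> crossings D" "a \<noteq> b" "s a = 1" "s b = 1"
      and F: "?F = {Q. closed_arcs D (s(a := -1, b := -1)) Q}" and U: "closed_arcs D (s(a := -1, b := -1)) U"
    for a b U
  proof -
    let ?w = "of_bool (closed_arcs D (s(a := -1)) U) * edge_weight (s(a := -1)) b U"
    have b1: "(s(a := -1)) b = 1" using c by simp
    have "(\<Sum>Q\<in>?F. G a b Q * of_bool (Q \<subseteq> U)) =
      (\<Sum>R | closed_arcs D (s(a := -1)) R. bar_natan D s a P R *
        (\<Sum>Q\<in>?F. bar_natan D (s(a := -1)) b R Q * of_bool (Q \<subseteq> U)))"
      unfolding G_def sum_distrib_right sum_distrib_left
      by (subst sum.swap) (simp only: mult.assoc)
    also have "\<dots> = (\<Sum>R | closed_arcs D (s(a := -1)) R. ?w * (bar_natan D s a P R * of_bool (R \<subseteq> U)))"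
      unfolding F using bar_natan_expand[OF full c(2) b1 _ U]
      by (intro sum.cong refl) (simp add: mult_ac)
    also have "\<dots> = ?w * (\<Sum>R | closed_arcs D (s(a := -1)) R. bar_natan D s a P R * of_bool (R \<subseteq> U))"
      by (simp only: sum_distrib_left)
    also have "\<dots> = of_bool (closed_arcs D s U) * (of_bool (P \<subseteq> U) * (edge_weight (s(a := -1)) b U * edge_weight s a U))"
      using bar_natan_expand[OF s c(1,4) P] edge_weight_square(1)[OF s c _ U]
      by (cases "closed_arcs D (s(a := -1)) U"; cases "closed_arcs D s U") auto
    finally show ?thesis .
  qed
  have "G a b Q = G b a Q"
  proof (rule subset_moebius[of ?F])
    show "finite ?F" by (rule finite_closed)
    show "finite U" if "U \<in> ?F" for U using that closed_subset finite_arcs finite_subset by blast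
    show "Q \<in> ?F" using Q by simp
    fix U assume "U \<in> ?F"
    hence U: "closed_arcs D (s(a := -1, b := -1)) U" by simp
    show "(\<Sum>Q\<in>?F. G a b Q * of_bool (Q \<subseteq> U)) = (\<Sum>Q\<in>?F. G b a Q * of_bool (Q \<subseteq> U))"
    proof (cases "closed_arcs D s U")
      case True
      thus ?thesis using G[OF ab refl U] G[of b a U] ab sw U edge_weight_square(2)[OF s ab True U] by simp
    next
      case False
      thus ?thesis using G[OF ab refl U] G[of b a U] ab sw U by simp
    qed
  qed
  moreover have "(\<Sum>R | closed_arcs D (s(a := -1)) R. of_bool (edge D s a P R) * of_bool (edge D (s(a := -1)) b R Q)) =
    (if degree D (s(a := -1, b := -1)) Q = degree D s P + 2 then G a b Q else 0)"
    if c: "a \<in> crossings D" "b \<in> crossings D" "a \<noteq> b" "s a = 1" "s b = 1"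
      and Q: "closed_arcs D (s(a := -1, b := -1)) Q" for a b
  proof (cases "degree D (s(a := -1, b := -1)) Q = degree D s P + 2")
    case True
    have b1: "(s(a := -1)) b = 1" using c by simp
    have "of_bool (edge D s a P R) * of_bool (edge D (s(a := -1)) b R Q) =
      bar_natan D s a P R * bar_natan D (s(a := -1)) b R Q" if R: "closed_arcs D (s(a := -1)) R" for R
    proof (cases "degree D (s(a := -1)) R = degree D s P + 1")
      case d: True
      thus ?thesis using edge_cases(4)[OF s c(1,4) P R] edge_cases(4)[OF full c(2) b1 R Q] True by simp
    next
      case d: False
      have "bar_natan D s a P R = 0 \<or> bar_natan D (s(a := -1)) b R Q = 0"
        using edge_cases(3)[OF s c(1,4) P R] edge_cases(3)[OF full c(2) b1 R Q] True d by linarith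
      moreover have "\<not> edge D s a P R" using d by (simp add: edge_def)
      ultimately show ?thesis by auto
    qed
    thus ?thesis using True unfolding G_def by (auto intro: sum.cong)
  next
    case False
    hence "of_bool (edge D s a P R) * of_bool (edge D (s(a := -1)) b R Q) = (0 :: int)" for R
      by (auto simp: edge_def)
    thus ?thesis using False by (simp only: sum.neutral_const if_False)
  qed
  ultimately show ?thesis using ab Q sw by simp
qed

text \<open>
  Changing the marker of the smaller crossing first does not affect the sign of the other change,
  while in the opposite order one more negative marker is counted.
\<close>

lemma edge_sign_swap:
  assumes "a \<in> crossings D" "b \<in> crossings D" "a \<noteq> b" "s a = 1" "s b = 1"
  shows "edge_sign D s a * edge_sign D (s(a := -1)) b = - (edge_sign D s b * edge_sign D (s(b := -1)) a)"
proof -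
  have *: "edge_sign D (s(a := -1)) b = (if b < a then - edge_sign D s b else edge_sign D s b)"
    if "a \<in> crossings D" "a \<noteq> b" "s a = 1" for a b
  proof -
    let ?A = "{d \<in> crossings D. s d = -1 \<and> b < d}"
    have eq: "{d \<in> crossings D. (s(a := -1)) d = -1 \<and> b < d} = (if b < a then insert a ?A else ?A)"
      using that by auto
    have "finite ?A" "a \<notin> ?A" using that finite_crossings by auto
    hence "card (insert a ?A) = Suc (card ?A)" by (rule card_insert_disjoint)
    hence "card (if b < a then insert a ?A else ?A) = (if b < a then Suc (card ?A) else card ?A)"
      by (cases "b < a") (simp_all only: if_True if_False)
    thus ?thesis unfolding edge_sign_def eq by (simp del: fun_upd_apply)
  qed
  show ?thesis using *[of a b] *[of b a] assms by auto
qed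

text \<open>
  The two orders in which a pair of crossings can be changed cancel.
\<close>

lemma coeff_square_zero:
  assumes x: "s \<in> kauffman_states D" "closed_arcs D s P"
    and z: "u \<in> kauffman_states D" "closed_arcs D u Q"
  shows "(\<Sum>y\<in>(SIGMA r:kauffman_states D. {R. closed_arcs D r R}). coeff D (s, P) y * coeff D y (u, Q)) = 0"
proof -
  let ?C = "crossings D" and ?K = "kauffman_states D"
  have full: "full_state D s" using x by (auto simp: full_state_def kauffman_states_def PiE_def Pi_def)
  have finK: "finite ?K" unfolding kauffman_states_def by (intro finite_PiE finite_crossings) auto
  have upd: "s(a := -1) \<in> ?K" if "a \<in> ?C" for a
    using x that by (auto simp: kauffman_states_def PiE_def extensional_def Pi_def)
  \<comment> \<open>the contribution of changing first \<open>a\<close> and then \<open>b\<close>\<close>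
  define t where "t a b = (if s a = 1 \<and> (s(a := -1)) b = 1 \<and> u = s(a := -1, b := -1)
    then edge_sign D s a * edge_sign D (s(a := -1)) b *
      (\<Sum>R | closed_arcs D (s(a := -1)) R. of_bool (edge D s a P R) * of_bool (edge D (s(a := -1)) b R Q))
    else 0)" for a b
  let ?f = "\<lambda>a r R. if s a = 1 \<and> r = s(a := -1) then edge_sign D s a * of_bool (edge D s a P R) else 0"
  let ?g = "\<lambda>b r R. if r b = 1 \<and> u = r(b := -1) then edge_sign D r b * of_bool (edge D r b R Q) else 0"
  have inner: "(\<Sum>r\<in>?K. \<Sum>R | closed_arcs D r R. ?f a r R * ?g b r R) = t a b" if "a \<in> ?C" for a b
  proof -
    have "(\<Sum>r\<in>?K. \<Sum>R | closed_arcs D r R. ?f a r R * ?g b r R) =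
      (\<Sum>r\<in>?K. if r = s(a := -1) then t a b else 0)"
    proof (rule sum.cong[OF refl])
      fix r assume "r \<in> ?K"
      show "(\<Sum>R | closed_arcs D r R. ?f a r R * ?g b r R) = (if r = s(a := -1) then t a b else 0)"
      proof (cases "r = s(a := -1) \<and> s a = 1 \<and> r b = 1 \<and> u = r(b := -1)")
        case True
        thus ?thesis by (simp add: t_def sum_distrib_left mult_ac)
      next
        case False
        hence "(\<Sum>R | closed_arcs D r R. ?f a r R * ?g b r R) = 0" by (intro sum.neutral) auto
        thus ?thesis using False by (auto simp: t_def)
      qed
    qed
    thus ?thesis using finK upd[OF that] by simp
  qed
  have "(\<Sum>y\<in>(SIGMA r:?K. {R. closed_arcs D r R}). coeff D (s, P) y * coeff D y (u, Q)) =
    (\<Sum>r\<in>?K. \<Sum>R | closed_arcs D r R. coeff D (s, P) (r, R) * coeff D (r, R) (u, Q))"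
    using finK finite_closed by (subst sum.Sigma) auto
  also have "\<dots> = (\<Sum>r\<in>?K. \<Sum>R | closed_arcs D r R. \<Sum>a\<in>?C. \<Sum>b\<in>?C. ?f a r R * ?g b r R)"
    unfolding coeff_def fst_conv snd_conv by (simp only: sum_product)
  also have "\<dots> = (\<Sum>r\<in>?K. \<Sum>a\<in>?C. \<Sum>R | closed_arcs D r R. \<Sum>b\<in>?C. ?f a r R * ?g b r R)"
    by (subst sum.swap) (rule refl)
  also have "\<dots> = (\<Sum>r\<in>?K. \<Sum>a\<in>?C. \<Sum>b\<in>?C. \<Sum>R | closed_arcs D r R. ?f a r R * ?g b r R)"
    by (intro sum.cong refl sum.swap)
  also have "\<dots> = (\<Sum>a\<in>?C. \<Sum>r\<in>?K. \<Sum>b\<in>?C. \<Sum>R | closed_arcs D r R. ?f a r R * ?g b r R)"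
    by (rule sum.swap)
  also have "\<dots> = (\<Sum>a\<in>?C. \<Sum>b\<in>?C. \<Sum>r\<in>?K. \<Sum>R | closed_arcs D r R. ?f a r R * ?g b r R)"
    by (intro sum.cong refl sum.swap)
  also have "\<dots> = (\<Sum>a\<in>?C. \<Sum>b\<in>?C. t a b)" by (intro sum.cong refl inner) auto
  finally have sum: "(\<Sum>y\<in>(SIGMA r:?K. {R. closed_arcs D r R}). coeff D (s, P) y * coeff D y (u, Q)) =
    (\<Sum>a\<in>?C. \<Sum>b\<in>?C. t a b)" .
  have anti: "t a b = - t b a" if ab: "a \<in> ?C" "b \<in> ?C" for a b
  proof (cases "s a = 1 \<and> s b = 1 \<and> a \<noteq> b \<and> u = s(a := -1, b := -1)")
    case True
    have sw: "s(b := -1, a := -1) = s(a := -1, b := -1)" using True by (simp add: fun_upd_twist)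
    have "edge_sign D s a * edge_sign D (s(a := -1)) b * X = - (edge_sign D s b * edge_sign D (s(b := -1)) a * X)" for X
      using edge_sign_swap[OF ab] True by simp
    thus ?thesis using edge_square[OF full ab _ _ _ x(2), of Q] True z(2) sw by (simp add: t_def)
  next
    case False
    hence "t a b = 0" by (auto simp: t_def split: if_splits)
    moreover have "t b a = 0"
    proof -
      have "\<not> (s b = 1 \<and> (s(b := -1)) a = 1 \<and> u = s(b := -1, a := -1))"
      proof
        assume A: "s b = 1 \<and> (s(b := -1)) a = 1 \<and> u = s(b := -1, a := -1)"
        hence "a \<noteq> b" by auto
        thus False using A False by (auto simp: fun_upd_twist)
      qed
      thus ?thesis unfolding t_def by (rule if_not_P)
    qed
    ultimately show ?thesis by simp
  qed
  have "(\<Sum>a\<in>?C. \<Sum>b\<in>?C. t a b) = (\<Sum>a\<in>?C. \<Sum>b\<in>?C. - t b a)" by (intro sum.cong refl anti) auto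
  also have "\<dots> = - (\<Sum>a\<in>?C. \<Sum>b\<in>?C. t b a)" by (simp add: sum_negf)
  also have "(\<Sum>a\<in>?C. \<Sum>b\<in>?C. t b a) = (\<Sum>a\<in>?C. \<Sum>b\<in>?C. t a b)" by (rule sum.swap)
  finally show ?thesis unfolding sum by simp
qed

end

section \<open>Exactness for complexes with a finite basis\<close>

text \<open>
  A complex is given by the matrix \<open>M\<close> of its differential; \<open>A\<close>, \<open>B\<close> and \<open>C\<close> are bases of three
  consecutive chain groups, and chains are functions of which only the values on the basis matter.
  Only the inclusion of the cycles in the boundaries is asked for.
\<close>

definition exact_at :: "('g \<Rightarrow> 'g \<Rightarrow> int) \<Rightarrow> 'g set \<Rightarrow> 'g set \<Rightarrow> 'g set \<Rightarrow> bool" where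
  "exact_at M A B C \<longleftrightarrow> (\<forall>f. (\<forall>z\<in>C. (\<Sum>y\<in>B. f y * M y z) = 0) \<longrightarrow>
     (\<exists>h. \<forall>y\<in>B. (\<Sum>x\<in>A. h x * M x y) = f y))"

text \<open>
  The middle part of the long exact sequence of a subcomplex (index \<open>2\<close>) and its quotient (index
  \<open>1\<close>): a cycle is first corrected by a boundary so that its image in the quotient vanishes. The
  result is a cycle of the subcomplex because \<open>d\<^sup>2 = 0\<close>.
\<close>

lemma exact_extension:
  fixes M :: "'g \<Rightarrow> 'g \<Rightarrow> int"
  assumes fin: "finite A1" "finite A2" "finite B1" "finite B2"
    and dis: "A1 \<inter> A2 = {}" "B1 \<inter> B2 = {}"
    and sub: "\<And>x y. x \<in> A2 \<Longrightarrow> y \<in> B1 \<Longrightarrow> M x y = 0" "\<And>x y. x \<in> B2 \<Longrightarrow> y \<in> C1 \<Longrightarrow> M x y = 0"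
    and sq: "\<And>x z. x \<in> A1 \<Longrightarrow> z \<in> C2 \<Longrightarrow> (\<Sum>y\<in>B1 \<union> B2. M x y * M y z) = 0"
    and ex: "exact_at M A1 B1 C1" "exact_at M A2 B2 C2"
  shows "exact_at M (A1 \<union> A2) (B1 \<union> B2) (C1 \<union> C2)"
  unfolding exact_at_def
proof (intro allI impI)
  fix f :: "'g \<Rightarrow> int" assume cyc: "\<forall>z\<in>C1 \<union> C2. (\<Sum>y\<in>B1 \<union> B2. f y * M y z) = 0"
  have U: "(\<Sum>y\<in>B1 \<union> B2. F y) = (\<Sum>y\<in>B1. F y) + (\<Sum>y\<in>B2. F y)" for F :: "'g \<Rightarrow> int"
    using fin dis by (simp add: sum.union_disjoint)
  have "\<forall>z\<in>C1. (\<Sum>y\<in>B1. f y * M y z) = 0"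
  proof
    fix z assume z: "z \<in> C1"
    have "(\<Sum>y\<in>B2. f y * M y z) = 0" using sub(2) z by (intro sum.neutral) auto
    thus "(\<Sum>y\<in>B1. f y * M y z) = 0" using cyc z U[of "\<lambda>y. f y * M y z"] by auto
  qed
  then obtain h1 where h1: "\<And>y. y \<in> B1 \<Longrightarrow> (\<Sum>x\<in>A1. h1 x * M x y) = f y"
    using ex(1) unfolding exact_at_def by blast
  define f' where "f' y = f y - (\<Sum>x\<in>A1. h1 x * M x y)" for y
  have "\<forall>z\<in>C2. (\<Sum>y\<in>B2. f' y * M y z) = 0"
  proof
    fix z assume z: "z \<in> C2"
    have "(\<Sum>y\<in>B1. f' y * M y z) = 0" using h1 by (intro sum.neutral) (simp add: f'_def)
    hence "(\<Sum>y\<in>B2. f' y * M y z) = (\<Sum>y\<in>B1 \<union> B2. f' y * M y z)"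
      using U[of "\<lambda>y. f' y * M y z"] by simp
    also have "\<dots> = (\<Sum>y\<in>B1 \<union> B2. f y * M y z) - (\<Sum>y\<in>B1 \<union> B2. \<Sum>x\<in>A1. h1 x * (M x y * M y z))"
      by (simp add: f'_def left_diff_distrib sum_subtractf sum_distrib_right mult.assoc)
    also have "(\<Sum>y\<in>B1 \<union> B2. \<Sum>x\<in>A1. h1 x * (M x y * M y z)) = (\<Sum>x\<in>A1. h1 x * (\<Sum>y\<in>B1 \<union> B2. M x y * M y z))"
      by (subst sum.swap) (simp only: sum_distrib_left)
    also have "\<dots> = 0" using sq[OF _ z] by (intro sum.neutral) auto
    finally show "(\<Sum>y\<in>B2. f' y * M y z) = 0" using cyc z by simp
  qed
  then obtain h2 where h2: "\<And>y. y \<in> B2 \<Longrightarrow> (\<Sum>x\<in>A2. h2 x * M x y) = f' y"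
    using ex(2) unfolding exact_at_def by blast
  define h where "h x = (if x \<in> A1 then h1 x else h2 x)" for x
  have "(\<Sum>x\<in>A1 \<union> A2. h x * M x y) = f y" if y: "y \<in> B1 \<union> B2" for y
  proof -
    have "(\<Sum>x\<in>A1 \<union> A2. h x * M x y) = (\<Sum>x\<in>A1. h x * M x y) + (\<Sum>x\<in>A2. h x * M x y)"
      using fin dis by (simp add: sum.union_disjoint)
    also have "(\<Sum>x\<in>A1. h x * M x y) = (\<Sum>x\<in>A1. h1 x * M x y)" by (rule sum.cong) (auto simp: h_def)
    also have "(\<Sum>x\<in>A2. h x * M x y) = (\<Sum>x\<in>A2. h2 x * M x y)"
      by (rule sum.cong) (use dis in \<open>auto simp: h_def\<close>)
    finally have e: "(\<Sum>x\<in>A1 \<union> A2. h x * M x y) = (\<Sum>x\<in>A1. h1 x * M x y) + (\<Sum>x\<in>A2. h2 x * M x y)" .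
    show ?thesis
    proof (cases "y \<in> B1")
      case True
      have "(\<Sum>x\<in>A2. h2 x * M x y) = 0" using sub(1) True by (intro sum.neutral) auto
      thus ?thesis using e h1[OF True] by simp
    next
      case False
      thus ?thesis using e h2[of y] y by (simp add: f'_def)
    qed
  qed
  thus "\<exists>h. \<forall>y\<in>B1 \<union> B2. (\<Sum>x\<in>A1 \<union> A2. h x * M x y) = f y" by blast
qed

text \<open>The cone of an isomorphism is exact: the unit entries allow Gaussian elimination.\<close>

lemma exact_cone:
  fixes M :: "'g \<Rightarrow> 'g \<Rightarrow> int"
  assumes fin: "finite U0" "finite V0" "finite U1" "finite V1"
    and dis: "U0 \<inter> V0 = {}" "U1 \<inter> V1 = {}"
    and g: "bij_betw g U0 V1" "inj_on g U1" "g ` U1 \<subseteq> V2"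
    and unit: "\<And>u. \<mu> u * \<mu> u = 1"
    and M: "\<And>u v. u \<in> U0 \<Longrightarrow> v \<in> V1 \<Longrightarrow> M u v = (if v = g u then \<mu> u else 0)"
      "\<And>u v. u \<in> U1 \<Longrightarrow> v \<in> V2 \<Longrightarrow> M u v = (if v = g u then \<mu> u else 0)"
    and sq: "\<And>x z. x \<in> U0 \<Longrightarrow> z \<in> V2 \<Longrightarrow> (\<Sum>y\<in>U1 \<union> V1. M x y * M y z) = 0"
  shows "exact_at M (U0 \<union> V0) (U1 \<union> V1) (U2 \<union> V2)"
  unfolding exact_at_def
proof (intro allI impI)
  fix f :: "'g \<Rightarrow> int" assume cyc: "\<forall>z\<in>U2 \<union> V2. (\<Sum>y\<in>U1 \<union> V1. f y * M y z) = 0"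
  define h where "h x = (if x \<in> U0 then \<mu> x * f (g x) else 0)" for x
  have hs: "(\<Sum>x\<in>U0 \<union> V0. h x * M x y) = (\<Sum>x\<in>U0. h x * M x y)" for y
    by (rule sum.mono_neutral_right) (use fin in \<open>auto simp: h_def\<close>)
  define f' where "f' y = f y - (\<Sum>x\<in>U0. h x * M x y)" for y
  have V: "f' v = 0" if v: "v \<in> V1" for v
  proof -
    obtain u where u: "u \<in> U0" "v = g u" using g(1) v by (auto simp: bij_betw_def)
    have "(\<Sum>x\<in>U0. h x * M x v) = (\<Sum>x\<in>U0. if x = u then f v else 0)"
    proof (rule sum.cong[OF refl])
      fix x assume x: "x \<in> U0"
      have "g x = g u \<longleftrightarrow> x = u" using g(1) x u by (auto simp: bij_betw_def inj_on_def)
      moreover have "\<mu> u * f v * \<mu> u = f v" using unit[of u] by (simp add: mult.commute mult.left_commute)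
      ultimately show "h x * M x v = (if x = u then f v else 0)" using M(1)[OF x v] x u by (auto simp: h_def)
    qed
    thus ?thesis using fin(1) u(1) by (simp add: f'_def)
  qed
  have "f' u = 0" if u: "u \<in> U1" for u
  proof -
    have z: "g u \<in> V2" using g(3) u by auto
    have "(\<Sum>y\<in>U1 \<union> V1. f' y * M y (g u)) =
        (\<Sum>y\<in>U1 \<union> V1. f y * M y (g u)) - (\<Sum>y\<in>U1 \<union> V1. \<Sum>x\<in>U0. h x * (M x y * M y (g u)))"
      by (simp add: f'_def left_diff_distrib sum_subtractf sum_distrib_right mult.assoc)
    also have "(\<Sum>y\<in>U1 \<union> V1. \<Sum>x\<in>U0. h x * (M x y * M y (g u))) =
        (\<Sum>x\<in>U0. h x * (\<Sum>y\<in>U1 \<union> V1. M x y * M y (g u)))"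
      by (subst sum.swap) (simp only: sum_distrib_left)
    also have "\<dots> = 0" using sq[OF _ z] by (intro sum.neutral) auto
    finally have 0: "(\<Sum>y\<in>U1 \<union> V1. f' y * M y (g u)) = 0" using cyc z by simp
    have "(\<Sum>y\<in>U1 \<union> V1. f' y * M y (g u)) = (\<Sum>y\<in>U1. f' y * M y (g u))"
      by (rule sum.mono_neutral_right) (use fin V in auto)
    also have "\<dots> = (\<Sum>y\<in>U1. if y = u then f' u * \<mu> u else 0)"
    proof (rule sum.cong[OF refl])
      fix y assume y: "y \<in> U1"
      have "g u = g y \<longleftrightarrow> y = u" using g(2) y u by (auto simp: inj_on_def)
      thus "f' y * M y (g u) = (if y = u then f' u * \<mu> u else 0)" using M(2)[OF y z] by auto
    qed
    finally have "f' u * \<mu> u = 0" using 0 fin(3) u by simp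
    thus ?thesis using unit[of u] by auto
  qed
  hence "\<forall>y\<in>U1 \<union> V1. (\<Sum>x\<in>U0 \<union> V0. h x * M x y) = f y"
    using V hs by (auto simp: f'_def)
  thus "\<exists>h. \<forall>y\<in>U1 \<union> V1. (\<Sum>x\<in>U0 \<union> V0. h x * M x y) = f y" by blast
qed

text \<open>
  The signs \<open>\<epsilon>\<close> and \<open>\<mu>\<close> allow for maps that commute with the differentials up to sign only.
\<close>

lemma exact_reindex:
  fixes M :: "'g \<Rightarrow> 'g \<Rightarrow> int" and M' :: "'h \<Rightarrow> 'h \<Rightarrow> int"
  assumes g: "bij_betw g A A'" "bij_betw g B B'" "g ` C \<subseteq> C'"
    and unit: "\<And>x. \<mu> x * \<mu> x = 1" "\<epsilon> * \<epsilon> = 1"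
    and M: "\<And>x y. x \<in> A \<Longrightarrow> y \<in> B \<Longrightarrow> M' (g x) (g y) = \<epsilon> * \<mu> x * \<mu> y * M x y"
      "\<And>x y. x \<in> B \<Longrightarrow> y \<in> C \<Longrightarrow> M' (g x) (g y) = \<epsilon> * \<mu> x * \<mu> y * M x y"
    and C: "C' \<subseteq> g ` C"
    and ex: "exact_at M' A' B' C'"
  shows "exact_at M A B C"
  unfolding exact_at_def
proof (intro allI impI)
  fix f :: "'g \<Rightarrow> int" assume cyc: "\<forall>z\<in>C. (\<Sum>y\<in>B. f y * M y z) = 0"
  define F where "F y' = \<mu> (inv_into B g y') * f (inv_into B g y')" for y'
  have F: "F (g y) = \<mu> y * f y" if "y \<in> B" for y
    using that g(2) by (simp add: F_def bij_betw_def)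
  have "\<forall>z'\<in>C'. (\<Sum>y'\<in>B'. F y' * M' y' z') = 0"
  proof
    fix z' assume "z' \<in> C'"
    then obtain z where z: "z \<in> C" "z' = g z" using C by auto
    have "(\<Sum>y'\<in>B'. F y' * M' y' z') = (\<Sum>y\<in>B. F (g y) * M' (g y) z')"
      using sum.reindex_bij_betw[OF g(2), of "\<lambda>y'. F y' * M' y' z'"] by simp
    also have "\<dots> = (\<Sum>y\<in>B. \<epsilon> * \<mu> z * (f y * M y z))"
    proof (rule sum.cong[OF refl])
      fix y assume y: "y \<in> B"
      have "F (g y) * M' (g y) z' = (\<mu> y * \<mu> y) * (\<epsilon> * \<mu> z * (f y * M y z))"
        using F[OF y] M(2)[OF y z(1)] z(2) by (simp add: mult_ac)
      thus "F (g y) * M' (g y) z' = \<epsilon> * \<mu> z * (f y * M y z)" by (simp add: unit)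
    qed
    also have "\<dots> = 0" using cyc z(1) by (simp add: sum_distrib_left[symmetric])
    finally show "(\<Sum>y'\<in>B'. F y' * M' y' z') = 0" .
  qed
  then obtain H where H: "\<And>y'. y' \<in> B' \<Longrightarrow> (\<Sum>x'\<in>A'. H x' * M' x' y') = F y'"
    using ex unfolding exact_at_def by blast
  have "(\<Sum>x\<in>A. (\<epsilon> * \<mu> x * H (g x)) * M x y) = f y" if y: "y \<in> B" for y
  proof -
    have "(\<Sum>x\<in>A. (\<epsilon> * \<mu> x * H (g x)) * M x y) = (\<Sum>x\<in>A. \<mu> y * (H (g x) * M' (g x) (g y)))"
    proof (rule sum.cong[OF refl])
      fix x assume x: "x \<in> A"
      have "\<mu> y * (H (g x) * M' (g x) (g y)) = (\<mu> y * \<mu> y) * ((\<epsilon> * \<mu> x * H (g x)) * M x y)"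
        using M(1)[OF x y] by (simp add: mult_ac)
      thus "(\<epsilon> * \<mu> x * H (g x)) * M x y = \<mu> y * (H (g x) * M' (g x) (g y))"
        by (simp only: unit mult_1_left)
    qed
    also have "\<dots> = \<mu> y * (\<Sum>x'\<in>A'. H x' * M' x' (g y))"
      using sum.reindex_bij_betw[OF g(1), of "\<lambda>x'. H x' * M' x' (g y)"] by (simp add: sum_distrib_left[symmetric])
    also have "\<dots> = \<mu> y * F (g y)" using H g(2) y by (auto simp: bij_betw_def)
    also have "\<dots> = (\<mu> y * \<mu> y) * f y" using F[OF y] by simp
    finally show ?thesis by (simp add: unit)
  qed
  thus "\<exists>h. \<forall>y\<in>B. (\<Sum>x\<in>A. h x * M x y) = f y"
    by (intro exI[of _ "\<lambda>x. \<epsilon> * \<mu> x * H (g x)"] ballI)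
qed

lemma exact_reindex_inverse:
  fixes M :: "'g \<Rightarrow> 'g \<Rightarrow> int" and M' :: "'h \<Rightarrow> 'h \<Rightarrow> int"
  assumes g: "bij_betw g A A'" "bij_betw g B B'" "bij_betw g C C'" "inj_on g (A \<union> B \<union> C)"
    and unit: "\<And>x. \<mu> x * \<mu> x = 1" "\<epsilon> * \<epsilon> = 1"
    and M: "\<And>x y. x \<in> A \<Longrightarrow> y \<in> B \<Longrightarrow> M' (g x) (g y) = \<epsilon> * \<mu> x * \<mu> y * M x y"
      "\<And>x y. x \<in> B \<Longrightarrow> y \<in> C \<Longrightarrow> M' (g x) (g y) = \<epsilon> * \<mu> x * \<mu> y * M x y"
    and ex: "exact_at M A B C"
  shows "exact_at M' A' B' C'"
proof -
  let ?i = "inv_into (A \<union> B \<union> C) g"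
  have i: "?i (g x) = x" if "x \<in> A \<union> B \<union> C" for x using that g(4) by simp
  have bij: "bij_betw ?i S' S" if "bij_betw g S S'" "S \<subseteq> A \<union> B \<union> C" for S S'
    by (rule bij_betw_inv_into_subset[OF _ that(2)]) (use g(4) that in \<open>auto simp: bij_betw_def\<close>)
  have flip: "x = \<epsilon> * a * b * y" if "y = \<epsilon> * a * b * x" "a * a = 1" "b * b = 1" for x y a b :: int
  proof -
    have "\<epsilon> * a * b * y = (\<epsilon> * \<epsilon>) * (a * a) * (b * b) * x" unfolding that(1) by (simp only: mult_ac)
    thus ?thesis using that unit(2) by simp
  qed
  show ?thesis
  proof (rule exact_reindex[where g = ?i and \<mu> = "\<lambda>x'. \<mu> (?i x')" and \<epsilon> = \<epsilon>, OF _ _ _ _ unit(2) _ _ _ ex])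
    show "bij_betw ?i A' A" "bij_betw ?i B' B" by (rule bij; use g in auto)+
    have "bij_betw ?i C' C" by (rule bij) (use g in auto)
    thus "?i ` C' \<subseteq> C" "C \<subseteq> ?i ` C'" by (auto simp: bij_betw_def)
    show "\<mu> (?i x) * \<mu> (?i x) = 1" for x by (rule unit)
    show "M (?i x) (?i y) = \<epsilon> * \<mu> (?i x) * \<mu> (?i y) * M' x y" if "x \<in> A'" "y \<in> B'" for x y
    proof -
      from that g obtain a b where ab: "a \<in> A" "b \<in> B" "x = g a" "y = g b" by (auto simp: bij_betw_def)
      have "M a b = \<epsilon> * \<mu> a * \<mu> b * M' (g a) (g b)" by (rule flip[OF M(1)[OF ab(1,2)] unit(1) unit(1)])
      thus ?thesis using ab i by simp
    qed
    show "M (?i x) (?i y) = \<epsilon> * \<mu> (?i x) * \<mu> (?i y) * M' x y" if "x \<in> B'" "y \<in> C'" for x y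
    proof -
      from that g obtain a b where ab: "a \<in> B" "b \<in> C" "x = g a" "y = g b" by (auto simp: bij_betw_def)
      have "M a b = \<epsilon> * \<mu> a * \<mu> b * M' (g a) (g b)" by (rule flip[OF M(2)[OF ab(1,2)] unit(1) unit(1)])
      thus ?thesis using ab i by simp
    qed
  qed
qed

text \<open>
  For the two ends of a cone over an isomorphism \<open>g\<close>, the relation \<open>d\<^sup>2 = 0\<close> says that \<open>g\<close> is a chain
  map up to signs.
\<close>

lemma cone_map_sign:
  fixes M :: "'g \<Rightarrow> 'g \<Rightarrow> int"
  assumes fin: "finite B" and u: "u' \<in> B" "g u \<in> B" "u' \<noteq> g u"
    and other: "\<And>y. y \<in> B \<Longrightarrow> y \<noteq> u' \<Longrightarrow> y \<noteq> g u \<Longrightarrow> M u y * M y (g u') = 0"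
    and sq: "(\<Sum>y\<in>B. M u y * M y (g u')) = 0"
    and unit: "\<mu> * \<mu> = 1" "\<mu>' * \<mu>' = 1" and M: "M u (g u) = \<mu>" "M u' (g u') = \<mu>'"
  shows "M (g u) (g u') = (-1) * \<mu> * \<mu>' * M u u'"
proof -
  have "(\<Sum>y\<in>B. M u y * M y (g u')) = (\<Sum>y\<in>{u', g u}. M u y * M y (g u'))"
    by (rule sum.mono_neutral_right) (use fin u other in auto)
  also have "\<dots> = M u u' * \<mu>' + \<mu> * M (g u) (g u')" using u M by simp
  finally have "\<mu> * M (g u) (g u') = - (M u u' * \<mu>')" using sq by simp
  hence "(\<mu> * \<mu>) * M (g u) (g u') = - (\<mu> * \<mu>' * M u u')" by (simp add: mult_ac)
  thus ?thesis using unit by simp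
qed

section \<open>The complexes of partial resolutions\<close>

text \<open>
  The generators of the complex of a partial resolution are generators of the whole complex, so that
  no smaller diagrams have to be drawn and the signs of the differential never change.
\<close>

definition cells :: "link_diagram \<Rightarrow> (nat \<Rightarrow> int) \<Rightarrow> int \<Rightarrow> int \<Rightarrow> ((nat \<Rightarrow> int) \<times> nat set) set" where
  "cells D p i j = {(s, P). s \<in> kauffman_states D \<and> refines D s p \<and> closed_arcs D s P \<and>
     (\<Sum>c\<in>crossings D. s c) = i \<and> i + 2 * degree D s P = j}"

lemma full_state_kauffman: "s \<in> kauffman_states D \<Longrightarrow> full_state D s"
  by (auto simp: full_state_def kauffman_states_def PiE_def Pi_def)

lemma kauffman_upd: "s \<in> kauffman_states D \<Longrightarrow> c \<in> crossings D \<Longrightarrow> m \<in> {1, -1} \<Longrightarrow> s(c := m) \<in> kauffman_states D"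
  by (auto simp: kauffman_states_def PiE_def extensional_def Pi_def)

lemma coeff_nonzeroD:
  assumes "coeff D (s, P) (u, Q) \<noteq> 0"
  obtains c where "c \<in> crossings D" "s c = 1" "u = s(c := -1)" "edge D s c P Q"
proof -
  from assms obtain c where "c \<in> crossings D" "(if s c = 1 \<and> u = s(c := -1)
      then edge_sign D s c * of_bool (edge D s c P Q) else 0) \<noteq> 0"
    unfolding coeff_def fst_conv snd_conv by (rule sum.not_neutral_contains_not_neutral)
  thus ?thesis using that by (auto split: if_splits)
qed

context four_valent
begin

lemma finite_cells: "finite (cells D p i j)"
proof (rule finite_subset)
  show "cells D p i j \<subseteq> kauffman_states D \<times> Pow (arcs D)"
    using closed_subset by (auto simp: cells_def)
  show "finite (kauffman_states D \<times> Pow (arcs D))"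
    unfolding kauffman_states_def using finite_arcs finite_crossings by (intro finite_cartesian_product finite_PiE) auto
qed

lemma sum_upd:
  assumes "c \<in> crossings D"
  shows "(\<Sum>d\<in>crossings D. (s(c := m)) d) = (\<Sum>d\<in>crossings D. s d) - s c + (m :: int)"
  using sum.remove[OF finite_crossings assms, of s] sum.remove[OF finite_crossings assms, of "s(c := m)"] by simp

lemma coeff_upd:
  assumes c: "c \<in> crossings D" "s c = 1"
  shows "coeff D (s, P) (s(c := -1), Q) = edge_sign D s c * of_bool (edge D s c P Q)"
proof -
  have eq: "s d = 1 \<and> s(c := -1) = s(d := -1) \<longleftrightarrow> d = c" for d
  proof
    assume a: "s d = 1 \<and> s(c := -1) = s(d := -1)"
    hence "(s(c := -1)) d = -1" by (metis fun_upd_same)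
    thus "d = c" using conjunct1[OF a] by (auto simp: fun_upd_apply split: if_splits)
  next
    assume "d = c" thus "s d = 1 \<and> s(c := -1) = s(d := -1)" using c by simp
  qed
  have "coeff D (s, P) (s(c := -1), Q) =
    (\<Sum>d\<in>crossings D. if d = c then edge_sign D s c * of_bool (edge D s c P Q) else 0)"
    unfolding coeff_def fst_conv snd_conv eq by (rule sum.cong) auto
  thus ?thesis using c finite_crossings by simp
qed

text \<open>
  Resolving a crossing splits the complex into the quotient with the positive marker and the subcomplex
  with the negative one.
\<close>

lemma cells_resolve:
  assumes "c \<in> unresolved D p"
  shows "cells D p i j = cells D (p(c := 1)) i j \<union> cells D (p(c := -1)) i j"
    and "cells D (p(c := 1)) i j \<inter> cells D (p(c := -1)) i' j' = {}"
proof -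
  have c: "c \<in> crossings D" "p c = 0" using assms by (auto simp: unresolved_def)
  have "refines D s p \<longleftrightarrow> refines D s (p(c := 1)) \<or> refines D s (p(c := -1))" if "s \<in> kauffman_states D" for s
    using full_state_kauffman[OF that] c unfolding full_state_def refines_def by auto
  thus "cells D p i j = cells D (p(c := 1)) i j \<union> cells D (p(c := -1)) i j"
    unfolding cells_def by blast
  show "cells D (p(c := 1)) i j \<inter> cells D (p(c := -1)) i' j' = {}"
  proof (rule ccontr)
    assume "\<not> ?thesis"
    then obtain s where "refines D s (p(c := 1))" "refines D s (p(c := -1))" by (auto simp: cells_def)
    hence "s c = 1" "s c = -1" using c by (auto simp: refines_def)
    thus False by simp
  qed
qed

lemma coeff_marker_zero:
  assumes "c \<in> crossings D" "x \<in> cells D (p(c := -1)) i j" "y \<in> cells D (p(c := 1)) i' j'"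
  shows "coeff D x y = 0"
proof (rule ccontr)
  assume nz: "coeff D x y \<noteq> 0"
  obtain s P u Q where xy: "x = (s, P)" "y = (u, Q)" by (cases x, cases y)
  have "s c = -1" "u c = 1" using assms xy by (auto simp: cells_def refines_def)
  moreover from nz xy obtain d where "u = s(d := -1)" using coeff_nonzeroD by metis
  ultimately show False by (auto split: if_splits)
qed

end

text \<open>
  The generators between two generators of a partial resolution belong to that resolution, too.
\<close>

lemma (in turaev_genus_zero) cells_square_zero:
  assumes x: "x \<in> cells D p (i + 2) j" and z: "z \<in> cells D p (i - 2) j"
  shows "(\<Sum>y\<in>cells D p i j. coeff D x y * coeff D y z) = 0"
proof -
  obtain s P where xs: "x = (s, P)" by (cases x)
  obtain u Q where zu: "z = (u, Q)" by (cases z)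
  have x': "s \<in> kauffman_states D" "closed_arcs D s P" "refines D s p" "(\<Sum>c\<in>crossings D. s c) = i + 2"
    "i + 2 + 2 * degree D s P = j" using x xs by (auto simp: cells_def)
  have z': "u \<in> kauffman_states D" "closed_arcs D u Q" "refines D u p" using z zu by (auto simp: cells_def)
  let ?G = "SIGMA r:kauffman_states D. {R. closed_arcs D r R}"
  have "(\<Sum>y\<in>?G. coeff D x y * coeff D y z) = (\<Sum>y\<in>cells D p i j. coeff D x y * coeff D y z)"
  proof (rule sum.mono_neutral_right)
    show "finite ?G" unfolding kauffman_states_def
      by (intro finite_SigmaI finite_PiE finite_crossings finite_closed) auto
    show "cells D p i j \<subseteq> ?G" by (auto simp: cells_def)
    show "\<forall>y\<in>?G - cells D p i j. coeff D x y * coeff D y z = 0"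
    proof (rule ballI, rule ccontr)
      fix y assume y: "y \<in> ?G - cells D p i j" and nz: "coeff D x y * coeff D y z \<noteq> 0"
      obtain r R where yr: "y = (r, R)" by (cases y)
      from nz xs yr obtain a where a: "a \<in> crossings D" "s a = 1" "r = s(a := -1)" "edge D s a P R"
        using coeff_nonzeroD[of D s P r R] by auto
      from nz zu yr obtain b where b: "b \<in> crossings D" "r b = 1" "u = r(b := -1)"
        using coeff_nonzeroD[of D r R u Q] by auto
      have "r d = p d" if d: "d \<in> crossings D" "p d \<noteq> 0" for d
      proof -
        have sd: "s d = p d" and ud: "u d = p d" using x'(3) z'(3) d by (auto simp: refines_def)
        show ?thesis
        proof (cases "d = a")
          case True
          hence "r d = -1" using a by simp
          hence "u d = -1" using b by auto
          thus ?thesis using \<open>r d = -1\<close> ud by simp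
        next
          case False thus ?thesis using a sd by simp
        qed
      qed
      moreover have "(\<Sum>c\<in>crossings D. r c) = i" using sum_upd[OF a(1), of s "-1"] a x' by simp
      moreover have "i + 2 * degree D r R = j" using a x' by (auto simp: edge_def)
      ultimately have "y \<in> cells D p i j" using y yr by (auto simp: cells_def refines_def)
      thus False using y by simp
    qed
  qed
  thus ?thesis using coeff_square_zero[OF x'(1,2) z'(1,2)] xs zu by simp
qed

section \<open>Removing a kink\<close>

text \<open>
  Smoothing \<open>c\<close> with marker \<open>m\<close> splits off \<open>X\<close>, and \<open>X\<close> passes through no other unresolved crossing.
  So \<open>X\<close> is a circle in all states with this marker, and \<open>c\<close> is a curl that a first Reidemeister move
  removes. Below, the generators of the smoothing with marker \<open>m\<close> are divided according to the sign of
  \<open>X\<close>, and \<open>opp\<close> consists of the generators with the opposite marker at \<open>c\<close>.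
\<close>

locale kink = turaev_genus_zero +
  fixes p :: "nat \<Rightarrow> int" and c :: nat and m :: int and X :: "nat set"
  assumes unres: "c \<in> unresolved D p"
    and m: "m \<in> {1, -1}"
    and connected: "card (components D p) = 1"
    and sep: "separates D p c m"
    and X: "X \<in> components D (p(c := m))"
    and away: "\<And>d k. d \<in> unresolved D p \<Longrightarrow> d \<noteq> c \<Longrightarrow> k < 4 \<Longrightarrow> arc_at D (d, k) \<notin> X"
begin

abbreviation "off i j \<equiv> {x \<in> cells D (p(c := m)) i j. X \<inter> snd x = {}}"
abbreviation "on i j \<equiv> {x \<in> cells D (p(c := m)) i j. X \<subseteq> snd x}"
abbreviation "opp i j \<equiv> cells D (p(c := -m)) i j"
abbreviation "weight x \<equiv> edge_sign D (fst x) c"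

lemma crossing: "c \<in> crossings D" "p c = 0"
  using unres by (auto simp: unresolved_def)

lemma weight_square: "weight x * weight x = 1"
  by (simp add: edge_sign_def power_add[symmetric] mult_2[symmetric] del: mult_2)

text \<open>
  The resolution with marker \<open>m\<close> has just two components, one for each strand at \<open>c\<close>.
\<close>

lemma one_strand: "(arc_at D (c, 0) \<in> X) \<noteq> (arc_at D (c, 2) \<in> X)"
proof -
  note cu = components_unresolved[OF m crossing(1), of p]
  have p: "p(c := 0) = p" using crossing by (simp add: fun_upd_idem)
  obtain T where "components D p = {T}" using connected by (rule card_1_singletonE)
  hence "components D (p(c := 0)) - {component D (p(c := 0)) (arc_at D (c, 0))} = {}"
    using cu(3) unfolding p by auto
  hence "X = component D (p(c := m)) (arc_at D (c, 0)) \<or> X = component D (p(c := m)) (arc_at D (c, 2))"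
    using X cu(2) by auto
  moreover have "component D (p(c := m)) (arc_at D (c, 0)) \<inter> component D (p(c := m)) (arc_at D (c, 2)) = {}"
    using sep cu(6,7) by simp
  ultimately show ?thesis using cu(10,11) by auto
qed

text \<open>
  A closed subset of \<open>X\<close> of a finer state is closed for the resolution, since \<open>X\<close> avoids the
  crossings at which the two differ.
\<close>

lemma is_circle:
  assumes s: "full_state D s" and r: "refines D s (p(c := m))"
  shows "X \<in> components D s"
proof -
  have cX: "closed_arcs D s X" by (rule closed_refines[OF r components_closed[OF X]])
  obtain a where a: "a \<in> X" using components_nonempty[OF X] by auto
  have aA: "a \<in> arcs D" using a closed_subset[OF cX] by auto
  let ?V = "component D s a"
  have VX: "?V \<subseteq> X" by (rule component_subset[OF cX a])
  have "closed_arcs D (p(c := m)) ?V" unfolding closed_arcs_def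
  proof (intro conjI ballI)
    show "?V \<subseteq> arcs D" using closed_subset[OF closed_component] .
    fix d assume d: "d \<in> crossings D"
    show "compatible ((p(c := m)) d) (\<lambda>k. arc_at D (d, k) \<in> ?V)"
    proof (cases "(p(c := m)) d = 0")
      case True
      hence "d \<in> unresolved D p" "d \<noteq> c" using d m by (auto simp: unresolved_def split: if_splits)
      hence "arc_at D (d, k) \<notin> ?V" if "k < 4" for k using away[of d k] that VX by auto
      thus ?thesis by (simp add: compatible_def)
    next
      case False
      hence "s d = (p(c := m)) d" using r d by (simp add: refines_def)
      moreover have "compatible (s d) (\<lambda>k. arc_at D (d, k) \<in> ?V)"
        using closed_component[of s a] d by (simp add: closed_arcs_def)
      ultimately show ?thesis by simp
    qed
  qed
  from components_cases[OF X this] have "X \<subseteq> ?V" using a component_self[OF aA, of s] by auto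
  hence "X = ?V" using VX by auto
  thus ?thesis using component_in[OF aA] by simp
qed

lemma split_off:
  assumes s: "full_state D s" and r: "refines D s (p(c := m))"
  obtains Z where "site D s c = X \<union> Z" "X \<inter> Z = {}" "Z \<noteq> {}" "X \<noteq> {}" "separates D s c m"
    "Z \<in> components D s"
    "component D s (arc_at D (c, 0)) = X \<and> component D s (arc_at D (c, 2)) = Z \<or>
     component D s (arc_at D (c, 0)) = Z \<and> component D s (arc_at D (c, 2)) = X"
proof -
  have sc: "s(c := m) = s" using r crossing m by (auto simp: refines_def fun_upd_idem)
  note cu = components_unresolved[OF m crossing(1), of s, unfolded sc, folded site_def]
  have XX: "X \<in> components D s" by (rule is_circle[OF s r])
  show ?thesis
  proof (cases "arc_at D (c, 0) \<in> X")
    case True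
    hence "component D s (arc_at D (c, 0)) = X" using components_eqI[OF cu(8) XX cu(10)] by simp
    moreover have "component D s (arc_at D (c, 2)) \<noteq> X" using one_strand True cu(11) by auto
    ultimately show ?thesis using cu that[of "component D s (arc_at D (c, 2))"] by auto
  next
    case False
    hence "component D s (arc_at D (c, 2)) = X" using one_strand components_eqI[OF cu(9) XX cu(11)] by simp
    moreover have "component D s (arc_at D (c, 0)) \<noteq> X" using False cu(10) by auto
    ultimately show ?thesis using cu that[of "component D s (arc_at D (c, 0))"] by auto
  qed
qed

lemma cells_on_off: "cells D (p(c := m)) i j = on i j \<union> off i j" and on_off_disjoint: "on i j \<inter> off i' j' = {}"
proof -
  have "X \<subseteq> snd x \<or> X \<inter> snd x = {}" if "x \<in> cells D (p(c := m)) i j" for x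
  proof -
    obtain s P where x: "x = (s, P)" by (cases x)
    have s: "s \<in> kauffman_states D" "refines D s (p(c := m))" "closed_arcs D s P"
      using that x by (auto simp: cells_def)
    show ?thesis using components_cases[OF is_circle[OF full_state_kauffman[OF s(1)] s(2)] s(3)] x by simp
  qed
  thus "cells D (p(c := m)) i j = on i j \<union> off i j" by blast
  show "on i j \<inter> off i' j' = {}" using components_nonempty[OF X] by auto
qed

subsection \<open>Changing the sign of the split-off circle\<close>

definition toggle :: "(nat \<Rightarrow> int) \<times> nat set \<Rightarrow> (nat \<Rightarrow> int) \<times> nat set" where
  "toggle x = (fst x, snd x \<union> X)"

lemma degree_Un_circle:
  assumes "X \<in> components D s" "X \<inter> P = {}" shows "degree D s (P \<union> X) = degree D s P + 2"
proof -
  have "{C \<in> components D s. C \<subseteq> P \<union> X} = insert X {C \<in> components D s. C \<subseteq> P}"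
    using components_cases[OF _ components_closed[OF assms(1)]] components_nonempty assms
      components_eqI[OF _ assms(1)] by blast
  moreover have "X \<notin> {C \<in> components D s. C \<subseteq> P}" using assms components_nonempty[OF assms(1)] by auto
  moreover have "finite {C \<in> components D s. C \<subseteq> P}" using finite_components by auto
  ultimately show ?thesis by (simp add: degree_def)
qed

lemma toggle_bij: "bij_betw toggle (off i j) (on i (j + 4))"
proof (rule bij_betw_byWitness[where f' = "\<lambda>x. (fst x, snd x - X)"])
  show "\<forall>a\<in>off i j. (fst (toggle a), snd (toggle a) - X) = a" by (auto simp: toggle_def)
  show "\<forall>a'\<in>on i (j + 4). toggle (fst a', snd a' - X) = a'" by (auto simp: toggle_def)
  have circ: "X \<in> components D s" if "s \<in> kauffman_states D" "refines D s (p(c := m))" for s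
    by (rule is_circle[OF full_state_kauffman[OF that(1)] that(2)])
  show "toggle ` off i j \<subseteq> on i (j + 4)"
  proof
    fix y assume "y \<in> toggle ` off i j"
    then obtain s P where y: "y = (s, P \<union> X)" "(s, P) \<in> cells D (p(c := m)) i j" "X \<inter> P = {}"
      by (auto simp: toggle_def)
    thus "y \<in> on i (j + 4)" using circ[of s] degree_Un_circle[of s P] closed_Un components_closed
      by (auto simp: cells_def)
  qed
  show "(\<lambda>x. (fst x, snd x - X)) ` on i (j + 4) \<subseteq> off i j"
  proof
    fix y assume "y \<in> (\<lambda>x. (fst x, snd x - X)) ` on i (j + 4)"
    then obtain s P where y: "y = (s, P - X)" "(s, P) \<in> cells D (p(c := m)) i (j + 4)" "X \<subseteq> P" by auto
    hence "(P - X) \<union> X = P" by auto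
    thus "y \<in> off i j" using y circ[of s] degree_Un_circle[of s "P - X"] closed_Diff components_closed
      by (auto simp: cells_def)
  qed
qed

lemma site_away:
  assumes s: "s \<in> kauffman_states D" "refines D s (p(c := m))" "refines D (s(d := -1)) (p(c := m))"
    and d: "d \<in> crossings D" "s d = 1"
  shows "site D s d \<inter> X = {}"
proof -
  have "(p(c := m)) d = 0" using s(2,3) d by (auto simp: refines_def)
  hence d': "d \<in> unresolved D p" "d \<noteq> c" using d m by (auto simp: unresolved_def split: if_splits)
  have X': "closed_arcs D (s(d := 0)) X"
    by (rule closed_away[OF components_closed[OF is_circle[OF full_state_kauffman[OF s(1)] s(2)]], where b = d])
      (use away[OF d'] in auto)
  show ?thesis unfolding site_def
    by (rule component_disjoint[OF X']) (use away[OF d', of 0] arc_in[OF d(1), of 0] in auto)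
qed

text \<open>
  As long as the marker of \<open>c\<close> is \<open>m\<close>, the differential never touches \<open>X\<close>. So the two signs of \<open>X\<close>
  give two copies of the same complex, four apart in the grading \<open>j\<close>.
\<close>

lemma coeff_on_off:
  assumes "x \<in> on i j \<and> y \<in> off i' j' \<or> x \<in> off i j \<and> y \<in> on i' j'"
  shows "coeff D x y = 0"
proof (rule ccontr)
  assume nz: "coeff D x y \<noteq> 0"
  obtain s P u Q where xy: "x = (s, P)" "y = (u, Q)" by (cases x, cases y)
  with nz obtain d where d: "d \<in> crossings D" "s d = 1" "u = s(d := -1)" "edge D s d P Q"
    using coeff_nonzeroD by metis
  have "site D s d \<inter> X = {}"
    by (rule site_away) (use assms xy d in \<open>auto simp: cells_def\<close>)
  moreover have "P - site D s d = Q - site D s d" using d by (simp add: edge_def)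
  ultimately have "X \<inter> P = X \<inter> Q" by blast
  thus False using assms xy components_nonempty[OF X] by auto
qed

lemma coeff_toggle:
  assumes x: "x \<in> off i j" and y: "y \<in> off i' j'"
  shows "coeff D (toggle x) (toggle y) = coeff D x y"
proof -
  obtain s P u Q where xy: "x = (s, P)" "y = (u, Q)" by (cases x, cases y)
  have s: "s \<in> kauffman_states D" "refines D s (p(c := m))" "X \<inter> P = {}"
    and u: "u \<in> kauffman_states D" "refines D u (p(c := m))" "X \<inter> Q = {}"
    using x y xy by (auto simp: cells_def)
  have "edge D s d (P \<union> X) (Q \<union> X) = edge D s d P Q" if d: "d \<in> crossings D" "s d = 1" "u = s(d := -1)" for d
  proof -
    have "site D s d \<inter> X = {}" by (rule site_away) (use s u d in auto)
    hence "P \<union> X - site D s d = Q \<union> X - site D s d \<longleftrightarrow> P - site D s d = Q - site D s d"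
      using s(3) u(3) by blast
    moreover have "degree D s (P \<union> X) = degree D s P + 2"
      by (rule degree_Un_circle[OF is_circle[OF full_state_kauffman[OF s(1)] s(2)] s(3)])
    moreover have "degree D (s(d := -1)) (Q \<union> X) = degree D (s(d := -1)) Q + 2"
      using degree_Un_circle[OF is_circle[OF full_state_kauffman[OF u(1)] u(2)] u(3)] d by simp
    ultimately show ?thesis by (auto simp: edge_def)
  qed
  thus ?thesis unfolding xy toggle_def coeff_def by (intro sum.cong refl) auto
qed

lemma coeff_opp:
  assumes "x \<in> cells D (p(c := 1)) i j" "y \<in> cells D (p(c := -1)) i' j'"
  shows "coeff D x y = (if fst y = (fst x)(c := -1) \<and> edge D (fst x) c (snd x) (snd y) then weight x else 0)"
proof -
  obtain s P u Q where xy: "x = (s, P)" "y = (u, Q)" by (cases x, cases y)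
  have sc: "s c = 1" "u c = -1" using assms xy crossing by (auto simp: cells_def refines_def)
  show ?thesis
  proof (cases "u = s(c := -1)")
    case True
    thus ?thesis using coeff_upd[of c s P Q] crossing(1) sc(1) xy by simp
  next
    case False
    have "coeff D x y = 0"
    proof (rule ccontr)
      assume "coeff D x y \<noteq> 0"
      then obtain d where "d \<in> crossings D" "u = s(d := -1)" using coeff_nonzeroD xy by metis
      thus False using sc False by (auto simp: fun_upd_apply split: if_splits)
    qed
    thus ?thesis using False xy by simp
  qed
qed

lemma finite_parts: "finite (on i j)" "finite (off i j)" "finite (opp i j)"
  using finite_cells by auto

lemma refines_flip:
  assumes "refines D s (p(c := k))" "k \<in> {1, -1}" "l \<in> {1, -1}" shows "refines D (s(c := l)) (p(c := l))"
  using assms by (auto simp: refines_def)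

end

subsection \<open>A kink whose circle is split off by the positive marker\<close>

text \<open>
  The opposite smoothing joins \<open>X\<close> to the other circle at \<open>c\<close>. A negative \<open>X\<close> is a unit for the merge,
  so merging identifies the generators with negative \<open>X\<close> with those of the opposite smoothing. These two
  parts form an exact subcomplex. The quotient has positive \<open>X\<close>; up to a shift that preserves \<open>j - 2i\<close>
  it is another copy of the complex of the opposite smoothing.
\<close>

locale positive_kink = kink +
  assumes m1: "m = 1"
begin

definition merge :: "(nat \<Rightarrow> int) \<times> nat set \<Rightarrow> (nat \<Rightarrow> int) \<times> nat set" where
  "merge x = ((fst x)(c := -1),
     if snd x \<inter> site D (fst x) c = {} then snd x else snd x \<union> site D (fst x) c)"

definition unmerge :: "(nat \<Rightarrow> int) \<times> nat set \<Rightarrow> (nat \<Rightarrow> int) \<times> nat set" where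
  "unmerge y = ((fst y)(c := 1), snd y - X)"

lemma unmerge_in:
  assumes y: "y \<in> opp i j"
  shows "unmerge y \<in> off (i + 2) j" and "merge (unmerge y) = y"
proof -
  obtain u Q where yq: "y = (u, Q)" by (cases y)
  have u: "u \<in> kauffman_states D" "refines D u (p(c := -1))" "closed_arcs D u Q"
    "(\<Sum>d\<in>crossings D. u d) = i" "i + 2 * degree D u Q = j" using y yq m1 by (auto simp: cells_def)
  define s where "s = u(c := 1)"
  have uc: "u c = -1" using u(2) crossing by (auto simp: refines_def)
  have us: "u = s(c := -1)" using uc by (auto simp: s_def)
  have s: "s \<in> kauffman_states D" "refines D s (p(c := 1))" "s c = 1"
    using kauffman_upd[OF u(1) crossing(1), of 1] refines_flip[OF u(2), of 1] by (auto simp: s_def)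
  have full: "full_state D s" by (rule full_state_kauffman[OF s(1)])
  obtain Z where Z: "site D s c = X \<union> Z" "X \<inter> Z = {}" "Z \<noteq> {}" "X \<noteq> {}" "separates D s c 1" "Z \<in> components D s"
    using split_off[OF full] s(2) m1 by metis
  have s1: "s(c := 1) = s" using s(3) by (simp add: fun_upd_idem)
  have "separates D s c (-1) \<longleftrightarrow> \<not> separates D s c 1"
    by (rule separates_minus_iff[OF crossing(1)]) (use full in \<open>simp add: full_state_def\<close>)
  hence T: "site D s c \<in> components D u"
    using components_unresolved[of "-1" c s] Z(5) crossing(1) us unfolding site_def by (auto simp del: fun_upd_apply)
  have TQ: "site D s c \<subseteq> Q \<or> site D s c \<inter> Q = {}" by (rule components_cases[OF T u(3)])
  have xy: "arc_at D (c, 0) \<in> site D s c" "arc_at D (c, 2) \<in> site D s c"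
    using components_unresolved(1,10,11)[of 1 c s] crossing(1) unfolding site_def by auto
  have "closed_arcs D (s(c := 0)) Q"
    using closed_unresolved[of "-1" c s Q] u(3) us crossing(1) TQ xy by auto
  hence "closed_arcs D s Q" using closed_both_markers[OF crossing(1), of s Q] s1 by simp
  hence cl: "closed_arcs D s (Q - X)"
    using closed_Diff components_closed[OF is_circle[OF full]] s(2) m1 by simp
  have e: "(if (Q - X) \<inter> site D s c = {} then Q - X else (Q - X) \<union> site D s c) = Q"
  proof (cases "site D s c \<subseteq> Q")
    case True
    hence "(Q - X) \<inter> site D s c \<noteq> {}" using Z(1-3) by blast
    thus ?thesis using True Z(1) by auto
  next
    case False
    hence "site D s c \<inter> Q = {}" using TQ by simp
    thus ?thesis using Z(1) by auto
  qed
  have um: "unmerge y = (s, Q - X)" using yq by (simp add: unmerge_def s_def)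
  have "edge D s c (Q - X) Q"
  proof -
    have "\<not> site D s c \<subseteq> Q - X" using Z(1,4) by blast
    moreover have "closed_arcs D (s(c := -1)) Q" using u(3) us by simp
    ultimately show ?thesis using edge_cases(1)[OF full crossing(1) s(3) cl _ Z(5), of Q] e by metis
  qed
  hence "degree D u Q = degree D s (Q - X) + 1" using us by (simp add: edge_def)
  moreover have "(\<Sum>d\<in>crossings D. s d) = i + 2"
    using sum_upd[OF crossing(1), of s "-1"] u(4) us s(3) by simp
  ultimately show "unmerge y \<in> off (i + 2) j"
    using s cl u(5) m1 unfolding um by (auto simp: cells_def)
  have "merge (unmerge y) = (s(c := -1), Q)" unfolding um merge_def fst_conv snd_conv e by (rule refl)
  thus "merge (unmerge y) = y" unfolding us[symmetric] yq[symmetric] .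
qed

lemma coeff_merge:
  assumes x: "x \<in> off i j" and y: "y \<in> opp i' j'"
  shows "coeff D x y = (if y = merge x then weight x else 0)"
proof -
  obtain s P u Q where xy: "x = (s, P)" "y = (u, Q)" by (cases x, cases y)
  have s: "s \<in> kauffman_states D" "refines D s (p(c := 1))" "closed_arcs D s P" "X \<inter> P = {}"
    using x xy m1 by (auto simp: cells_def)
  have sc: "s c = 1" using s(2) crossing by (auto simp: refines_def)
  have full: "full_state D s" by (rule full_state_kauffman[OF s(1)])
  obtain Z where Z: "site D s c = X \<union> Z" "X \<noteq> {}" "separates D s c 1"
    using split_off[OF full] s(2) m1 by metis
  have key: "edge D s c P Q \<longleftrightarrow> Q = (if P \<inter> site D s c = {} then P else P \<union> site D s c)" if "u = s(c := -1)"
  proof -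
    have "\<not> site D s c \<subseteq> P" using Z s(4) by auto
    moreover have "closed_arcs D (s(c := -1)) Q" using y xy that by (auto simp: cells_def)
    ultimately show ?thesis using edge_cases(1)[OF full crossing(1) sc s(3) _ Z(3), of Q] by blast
  qed
  have "coeff D x y = (if u = s(c := -1) \<and> edge D s c P Q then weight x else 0)"
    using coeff_opp[of x i j y i' j'] x y m1 unfolding xy by simp
  moreover have "y = merge x \<longleftrightarrow> u = s(c := -1) \<and> edge D s c P Q"
    using key unfolding xy merge_def fst_conv snd_conv prod.inject by blast
  ultimately show ?thesis by (simp only:)
qed

lemma merge_in:
  assumes x: "x \<in> off i j"
  shows "merge x \<in> opp (i - 2) j" and "unmerge (merge x) = x"
proof -
  obtain s P where xs: "x = (s, P)" by (cases x)
  have s: "s \<in> kauffman_states D" "refines D s (p(c := 1))" "closed_arcs D s P" "X \<inter> P = {}"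
    "(\<Sum>d\<in>crossings D. s d) = i" "i + 2 * degree D s P = j"
    using x xs m1 by (auto simp: cells_def)
  have sc: "s c = 1" using s(2) crossing by (auto simp: refines_def)
  have s1: "s(c := 1) = s" using sc by (simp add: fun_upd_idem)
  have full: "full_state D s" by (rule full_state_kauffman[OF s(1)])
  obtain Z where Z: "site D s c = X \<union> Z" "X \<inter> Z = {}" "Z \<noteq> {}" "X \<noteq> {}" "separates D s c 1" "Z \<in> components D s"
    using split_off[OF full] s(2) m1 by metis
  define Q where "Q = (if P \<inter> site D s c = {} then P else P \<union> site D s c)"
  have mx: "merge x = (s(c := -1), Q)" using xs by (simp add: merge_def Q_def)
  have xy: "arc_at D (c, 0) \<in> site D s c" "arc_at D (c, 2) \<in> site D s c"
    using components_unresolved(1,10,11)[of 1 c s] crossing(1) unfolding site_def by auto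
  have "closed_arcs D s (site D s c)"
    using closed_both_markers[OF crossing(1), of s "site D s c"] s1 closed_component unfolding site_def by simp
  hence "closed_arcs D s Q" using s(3) closed_Un by (simp add: Q_def)
  moreover have "arc_at D (c, 0) \<in> Q \<longleftrightarrow> arc_at D (c, 2) \<in> Q" using xy by (auto simp: Q_def)
  ultimately have "closed_arcs D (s(c := 0)) Q"
    using closed_unresolved[of 1 c s Q] s1 crossing(1) by simp
  hence cl: "closed_arcs D (s(c := -1)) Q" using closed_both_markers[OF crossing(1)] by blast
  have "\<not> site D s c \<subseteq> P" using Z(1,4) s(4) by blast
  hence "edge D s c P Q"
    using edge_cases(1)[OF full crossing(1) sc s(3) cl Z(5)] Q_def by blast
  hence "degree D (s(c := -1)) Q = degree D s P + 1" by (simp add: edge_def)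
  moreover have "(\<Sum>d\<in>crossings D. (s(c := -1)) d) = i - 2"
    using sum_upd[OF crossing(1), of s "-1"] s(5) sc by simp
  ultimately show "merge x \<in> opp (i - 2) j"
    using cl s kauffman_upd[OF s(1) crossing(1), of "-1"] refines_flip[OF s(2), of "-1"] m1
    unfolding mx by (simp add: cells_def)
  have "Z \<subseteq> P" if "P \<inter> site D s c \<noteq> {}"
    using components_cases[OF Z(6) s(3)] that Z(1) s(4) by blast
  hence "Q - X = P" using Z(1) s(4) by (auto simp: Q_def)
  thus "unmerge (merge x) = x" using s1 xs unfolding mx by (simp add: unmerge_def)
qed

lemma merge_bij: "bij_betw merge (off (i + 2) j) (opp i j)"
proof (rule bij_betw_byWitness[where f' = unmerge])
  show "\<forall>x\<in>off (i + 2) j. unmerge (merge x) = x" using merge_in(2) by blast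
  show "\<forall>y\<in>opp i j. merge (unmerge y) = y" using unmerge_in(2) by blast
  show "merge ` off (i + 2) j \<subseteq> opp i j" using merge_in(1)[of _ "i + 2" j] by force
  show "unmerge ` opp i j \<subseteq> off (i + 2) j" using unmerge_in(1) by blast
qed

lemma merge_sign:
  assumes x: "x \<in> off (i + 2) j" and y: "y \<in> off i j"
  shows "coeff D (merge x) (merge y) = (-1) * weight x * weight y * coeff D x y"
proof (rule cone_map_sign[of "cells D p i j"])
  have split: "cells D p i j = on i j \<union> off i j \<union> opp i j"
    using cells_resolve(1)[OF unres, of i j] cells_on_off m1 by simp
  have mx: "merge x \<in> opp i j" using merge_in(1)[OF x] by simp
  have my: "merge y \<in> opp (i - 2) j" using merge_in(1)[OF y] by simp
  show "finite (cells D p i j)" by (rule finite_cells)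
  show "y \<in> cells D p i j" "merge x \<in> cells D p i j" using split y mx by auto
  have dis: "off i j \<inter> opp i j = {}" using cells_resolve(2)[OF unres, of i j i j] m1 by auto
  show "y \<noteq> merge x" using dis y mx by blast
  show "coeff D x z * coeff D z (merge y) = 0" if z: "z \<in> cells D p i j" "z \<noteq> y" "z \<noteq> merge x" for z
  proof -
    from z(1) split consider "z \<in> on i j" | "z \<in> off i j" | "z \<in> opp i j" by blast
    thus ?thesis
    proof cases
      case 1 thus ?thesis using coeff_on_off[OF disjI2[OF conjI[OF x 1]]] by simp
    next
      case 2
      hence "merge y \<noteq> merge z" using merge_in(2)[OF y] merge_in(2)[OF 2] z(2) by metis
      thus ?thesis using coeff_merge[OF 2 my] by simp
    next
      case 3 thus ?thesis using coeff_merge[OF x 3] z(3) by simp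
    qed
  qed
  show "(\<Sum>z\<in>cells D p i j. coeff D x z * coeff D z (merge y)) = 0"
  proof (rule cells_square_zero)
    show "x \<in> cells D p (i + 2) j" using x cells_resolve(1)[OF unres, of "i + 2" j] m1 by auto
    show "merge y \<in> cells D p (i - 2) j" using my cells_resolve(1)[OF unres, of "i - 2" j] m1 by auto
  qed
  show "coeff D x (merge x) = weight x" using coeff_merge[OF x mx] by simp
  show "coeff D y (merge y) = weight y" using coeff_merge[OF y my] by simp
qed (rule weight_square)+

lemma exact:
  assumes ex: "exact_at (coeff D) (opp i (j - 4)) (opp (i - 2) (j - 4)) (opp (i - 4) (j - 4))"
  shows "exact_at (coeff D) (cells D p (i + 2) j) (cells D p i j) (cells D p (i - 2) j)"
proof -
  have split: "cells D p i j = on i j \<union> (off i j \<union> opp i j)" for i j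
  proof -
    have "cells D p i j = on i j \<union> off i j \<union> opp i j"
      using cells_resolve(1)[OF unres, of i j] cells_on_off m1 by simp
    thus ?thesis by (simp only: Un_assoc)
  qed
  have dis: "off i j \<inter> opp i j = {}" "on i j \<inter> (off i j \<union> opp i j) = {}" for i j
  proof -
    show "off i j \<inter> opp i j = {}" using cells_resolve(2)[OF unres, of i j i j] m1 by auto
    have "on i j \<inter> opp i j = {}" using cells_resolve(2)[OF unres, of i j i j] m1 by auto
    thus "on i j \<inter> (off i j \<union> opp i j) = {}"
      using on_off_disjoint[of i j i j] by (simp only: Int_Un_distrib Un_empty_left)
  qed
  have off: "exact_at (coeff D) (off (i + 2) (j - 4)) (off i (j - 4)) (off (i - 2) (j - 4))"
  proof (rule exact_reindex[where g = merge and \<mu> = weight and \<epsilon> = "-1", OF _ _ _ weight_square _ _ _ _ ex])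
    show "bij_betw merge (off (i + 2) (j - 4)) (opp i (j - 4))" by (rule merge_bij)
    show "bij_betw merge (off i (j - 4)) (opp (i - 2) (j - 4))" using merge_bij[of "i - 2"] by simp
    have "bij_betw merge (off (i - 2) (j - 4)) (opp (i - 4) (j - 4))" using merge_bij[of "i - 4"] by simp
    thus "merge ` off (i - 2) (j - 4) \<subseteq> opp (i - 4) (j - 4)" "opp (i - 4) (j - 4) \<subseteq> merge ` off (i - 2) (j - 4)"
      by (auto simp: bij_betw_def)
    show "coeff D (merge x) (merge y) = -1 * weight x * weight y * coeff D x y"
      if "x \<in> off (i + 2) (j - 4)" "y \<in> off i (j - 4)" for x y using merge_sign[OF that] .
    show "coeff D (merge x) (merge y) = -1 * weight x * weight y * coeff D x y"
      if "x \<in> off i (j - 4)" "y \<in> off (i - 2) (j - 4)" for x y using merge_sign[of x "i - 2" "j - 4" y] that by simp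
  qed simp
  have on: "exact_at (coeff D) (on (i + 2) j) (on i j) (on (i - 2) j)"
  proof (rule exact_reindex_inverse[where g = toggle and \<mu> = "\<lambda>_. 1" and \<epsilon> = 1, OF _ _ _ _ _ _ _ _ off])
    show "bij_betw toggle (off (i + 2) (j - 4)) (on (i + 2) j)" "bij_betw toggle (off i (j - 4)) (on i j)"
      "bij_betw toggle (off (i - 2) (j - 4)) (on (i - 2) j)" using toggle_bij[of _ "j - 4"] by simp_all
    show "inj_on toggle (off (i + 2) (j - 4) \<union> off i (j - 4) \<union> off (i - 2) (j - 4))"
      by (rule inj_on_inverseI[where g = "\<lambda>x. (fst x, snd x - X)"]) (auto simp: toggle_def)
  qed (use coeff_toggle in auto)
  have cone: "exact_at (coeff D) (off (i + 2) j \<union> opp (i + 2) j) (off i j \<union> opp i j) (off (i - 2) j \<union> opp (i - 2) j)"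
  proof (rule exact_cone[where g = merge and \<mu> = weight, OF _ _ _ _ dis(1) dis(1)])
    show "bij_betw merge (off (i + 2) j) (opp i j)" by (rule merge_bij)
    have "bij_betw merge (off i j) (opp (i - 2) j)" using merge_bij[of "i - 2"] by simp
    thus "inj_on merge (off i j)" "merge ` off i j \<subseteq> opp (i - 2) j" by (auto simp: bij_betw_def)
    show "(\<Sum>y\<in>off i j \<union> opp i j. coeff D x y * coeff D y z) = 0" if "x \<in> off (i + 2) j" "z \<in> opp (i - 2) j" for x z
    proof -
      have "(\<Sum>y\<in>off i j \<union> opp i j. coeff D x y * coeff D y z) = (\<Sum>y\<in>cells D p i j. coeff D x y * coeff D y z)"
      proof (rule sum.mono_neutral_left[OF finite_cells])
        show "off i j \<union> opp i j \<subseteq> cells D p i j" using split by auto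
        show "\<forall>y\<in>cells D p i j - (off i j \<union> opp i j). coeff D x y * coeff D y z = 0"
        proof
          fix y assume "y \<in> cells D p i j - (off i j \<union> opp i j)"
          hence "y \<in> on i j" using split[of i j] by blast
          from coeff_on_off[OF disjI2[OF conjI[OF that(1) this]]]
          show "coeff D x y * coeff D y z = 0" by simp
        qed
      qed
      also have "\<dots> = 0" by (rule cells_square_zero) (use that split in auto)
      finally show ?thesis .
    qed
  qed (rule finite_parts weight_square | erule (1) coeff_merge)+
  have zero: "coeff D x y = 0" if "x \<in> off i j \<union> opp i j" "y \<in> on i' j'" for x y i j i' j'
  proof -
    from that(1) show ?thesis
    proof
      assume "x \<in> opp i j"
      thus ?thesis using coeff_marker_zero[OF crossing(1), of x p i j y i' j'] that(2) m1 by simp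
    next
      assume "x \<in> off i j"
      from coeff_on_off[OF disjI2[OF conjI[OF this that(2)]]] show ?thesis .
    qed
  qed
  show ?thesis unfolding split
  proof (rule exact_extension[OF _ _ _ _ dis(2) dis(2) zero zero _ on cone])
    show "(\<Sum>y\<in>on i j \<union> (off i j \<union> opp i j). coeff D x y * coeff D y z) = 0"
      if "x \<in> on (i + 2) j" "z \<in> off (i - 2) j \<union> opp (i - 2) j" for x z
      unfolding split[symmetric] by (rule cells_square_zero) (use that split in auto)
  qed (use finite_parts in auto)
qed

end

subsection \<open>A kink whose circle is split off by the negative marker\<close>

text \<open>
  The opposite smoothing is now the positive one, and the differential splits \<open>X\<close> off its generators.
  The component of this map with positive \<open>X\<close> is an isomorphism, since the split of a circle with sign
  \<open>e\<close> contains exactly one term with sign \<open>+\<close> on \<open>X\<close>, and there the other circle has sign \<open>e\<close>. So the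
  generators with negative \<open>X\<close> form a subcomplex with exact quotient, and up to a shift that preserves \<open>j - 2i\<close> this subcomplex is a copy of the
  complex of the opposite smoothing.
\<close>

locale negative_kink = kink +
  assumes m1: "m = -1"
begin

definition split :: "(nat \<Rightarrow> int) \<times> nat set \<Rightarrow> (nat \<Rightarrow> int) \<times> nat set" where
  "split x = ((fst x)(c := -1), snd x \<union> X)"

definition unsplit :: "(nat \<Rightarrow> int) \<times> nat set \<Rightarrow> (nat \<Rightarrow> int) \<times> nat set" where
  "unsplit y = ((fst y)(c := 1),
     if site D ((fst y)(c := 1)) c \<subseteq> snd y then snd y else snd y - X)"

lemma split_circle:
  assumes s: "s \<in> kauffman_states D" "refines D s (p(c := 1))"
  obtains Z where "site D s c = X \<union> Z" "X \<inter> Z = {}" "Z \<noteq> {}" "X \<noteq> {}" "\<not> separates D s c 1"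
    "X \<in> components D (s(c := -1))" "Z \<in> components D (s(c := -1))" "site D s c \<in> components D s" "s c = 1"
    "component D (s(c := -1)) (arc_at D (c, 0)) = X \<and> component D (s(c := -1)) (arc_at D (c, 2)) = Z \<or>
     component D (s(c := -1)) (arc_at D (c, 0)) = Z \<and> component D (s(c := -1)) (arc_at D (c, 2)) = X"
proof -
  have sc: "s c = 1" using s(2) crossing by (auto simp: refines_def)
  have s1: "s(c := 1) = s" using sc by (simp add: fun_upd_idem)
  let ?u = "s(c := -1)"
  have u: "?u \<in> kauffman_states D" by (rule kauffman_upd[OF s(1) crossing(1)]) simp
  have r: "refines D ?u (p(c := m))" using refines_flip[OF s(2), of "-1"] m1 by simp
  have site: "site D ?u c = site D s c" by (simp add: site_def)
  have sepu: "separates D ?u c m = separates D s c (-1)" using m1 by (simp add: separates_def)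
  have full: "full_state D s" by (rule full_state_kauffman[OF s(1)])
  have iff: "separates D s c (-1) \<longleftrightarrow> \<not> separates D s c 1"
    by (rule separates_minus_iff[OF crossing(1)]) (use full in \<open>simp add: full_state_def\<close>)
  note cu = components_unresolved[of 1 c s, OF _ crossing(1), unfolded s1, folded site_def, simplified]
  have X': "X \<in> components D ?u" by (rule is_circle[OF full_state_kauffman[OF u] r])
  show ?thesis
  proof (rule split_off[OF full_state_kauffman[OF u] r])
    fix Z assume Z: "site D ?u c = X \<union> Z" "X \<inter> Z = {}" "Z \<noteq> {}" "X \<noteq> {}" "separates D ?u c m"
      "Z \<in> components D ?u"
      "component D ?u (arc_at D (c, 0)) = X \<and> component D ?u (arc_at D (c, 2)) = Z \<or>
       component D ?u (arc_at D (c, 0)) = Z \<and> component D ?u (arc_at D (c, 2)) = X"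
    have ns: "\<not> separates D s c 1" using Z(5) sepu iff by simp
    hence "site D s c \<in> components D s" using cu(1,6,8) by simp
    thus thesis using that[OF _ Z(2-4) ns X' Z(6) _ sc Z(7)] Z(1) site by simp
  qed
qed

lemma split_edge:
  assumes x: "(s, P) \<in> opp i j" and Q: "closed_arcs D (s(c := -1)) Q" "X \<subseteq> Q"
  shows "edge D s c P Q \<longleftrightarrow> Q = P \<union> X"
proof -
  have s: "s \<in> kauffman_states D" "refines D s (p(c := 1))" "closed_arcs D s P"
    using x m1 by (auto simp: cells_def)
  obtain Z where Z: "site D s c = X \<union> Z" "X \<inter> Z = {}" "Z \<noteq> {}" "X \<noteq> {}" "\<not> separates D s c 1"
    "site D s c \<in> components D s" "s c = 1"
    "component D (s(c := -1)) (arc_at D (c, 0)) = X \<and> component D (s(c := -1)) (arc_at D (c, 2)) = Z \<or>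
     component D (s(c := -1)) (arc_at D (c, 0)) = Z \<and> component D (s(c := -1)) (arc_at D (c, 2)) = X"
    by (rule split_circle[OF s(1,2)])
  have "edge D s c P Q \<longleftrightarrow> (if site D s c \<subseteq> P then Q = P else Q = P \<union> X \<or> Q = P \<union> Z)"
    using edge_cases(2)[OF full_state_kauffman[OF s(1)] crossing(1) Z(7) s(3) Q(1) Z(5)] Z(8) by metis
  also have "\<dots> \<longleftrightarrow> Q = P \<union> X"
  proof (cases "site D s c \<subseteq> P")
    case True
    hence "P \<union> X = P" using Z(1) by blast
    thus ?thesis using True by simp
  next
    case False
    hence "site D s c \<inter> P = {}" using components_cases[OF Z(6) s(3)] by simp
    hence "Q \<noteq> P \<union> Z" using Z(1,2,4) Q(2) by blast
    thus ?thesis using False by simp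
  qed
  finally show ?thesis .
qed

lemma coeff_split:
  assumes x: "x \<in> opp i j" and y: "y \<in> on i' j'"
  shows "coeff D x y = (if y = split x then weight x else 0)"
proof -
  obtain s P u Q where xy: "x = (s, P)" "y = (u, Q)" by (cases x, cases y)
  have key: "edge D s c P Q \<longleftrightarrow> Q = P \<union> X" if "u = s(c := -1)"
    by (rule split_edge[of s P i j]) (use x y xy that in \<open>auto simp: cells_def\<close>)
  have "coeff D x y = (if u = s(c := -1) \<and> edge D s c P Q then weight x else 0)"
    using coeff_opp[of x i j y i' j'] x y m1 unfolding xy by simp
  moreover have "y = split x \<longleftrightarrow> u = s(c := -1) \<and> edge D s c P Q"
    using key unfolding xy split_def fst_conv snd_conv prod.inject by blast
  ultimately show ?thesis by (simp only:)
qed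

lemma split_in:
  assumes x: "x \<in> opp i j"
  shows "split x \<in> on (i - 2) j" and "unsplit (split x) = x"
proof -
  obtain s P where xs: "x = (s, P)" by (cases x)
  have s: "s \<in> kauffman_states D" "refines D s (p(c := 1))" "closed_arcs D s P"
    "(\<Sum>d\<in>crossings D. s d) = i" "i + 2 * degree D s P = j"
    using x xs m1 by (auto simp: cells_def)
  obtain Z where Z: "site D s c = X \<union> Z" "X \<inter> Z = {}" "Z \<noteq> {}" "X \<noteq> {}"
    "X \<in> components D (s(c := -1))" "site D s c \<in> components D s" "s c = 1"
    by (rule split_circle[OF s(1,2)])
  have s1: "s(c := 1) = s" using Z(7) by (simp add: fun_upd_idem)
  have TP: "site D s c \<subseteq> P \<or> site D s c \<inter> P = {}" by (rule components_cases[OF Z(6) s(3)])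
  have xy: "arc_at D (c, 0) \<in> site D s c" "arc_at D (c, 2) \<in> site D s c"
    using components_unresolved(1,10,11)[of 1 c s] crossing(1) unfolding site_def by auto
  have "closed_arcs D (s(c := 0)) P"
    using closed_unresolved[of 1 c s P] s1 crossing(1) xy TP s(3) by auto
  hence "closed_arcs D (s(c := -1)) P" using closed_both_markers[OF crossing(1)] by blast
  hence cl: "closed_arcs D (s(c := -1)) (P \<union> X)" by (rule closed_Un) (rule components_closed[OF Z(5)])
  have "edge D s c P (P \<union> X)" using split_edge[of s P i j "P \<union> X"] x xs cl by blast
  hence "degree D (s(c := -1)) (P \<union> X) = degree D s P + 1" by (simp add: edge_def)
  moreover have "(\<Sum>d\<in>crossings D. (s(c := -1)) d) = i - 2"
    using sum_upd[OF crossing(1), of s "-1"] s(4) Z(7) by simp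
  moreover have sx: "split x = (s(c := -1), P \<union> X)" using xs by (simp add: split_def)
  ultimately show "split x \<in> on (i - 2) j"
    using cl s kauffman_upd[OF s(1) crossing(1), of "-1"] refines_flip[OF s(2), of "-1"] m1
    unfolding sx by (simp add: cells_def)
  have e: "(if site D s c \<subseteq> P \<union> X then P \<union> X else (P \<union> X) - X) = P"
  proof (cases "site D s c \<subseteq> P")
    case True thus ?thesis using Z(1) by auto
  next
    case False
    hence "site D s c \<inter> P = {}" using TP by simp
    hence "\<not> site D s c \<subseteq> P \<union> X" "(P \<union> X) - X = P" using Z(1-3) by blast+
    thus ?thesis by simp
  qed
  have "(s(c := -1))(c := 1) = s" using s1 by simp
  hence "unsplit (split x) = (s, P)" unfolding sx unsplit_def fst_conv snd_conv by (simp only: e)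
  thus "unsplit (split x) = x" unfolding xs .
qed

lemma unsplit_in:
  assumes y: "y \<in> on i j"
  shows "unsplit y \<in> opp (i + 2) j" and "split (unsplit y) = y"
proof -
  obtain u Q where yq: "y = (u, Q)" by (cases y)
  have u: "u \<in> kauffman_states D" "refines D u (p(c := -1))" "closed_arcs D u Q" "X \<subseteq> Q"
    "(\<Sum>d\<in>crossings D. u d) = i" "i + 2 * degree D u Q = j" using y yq m1 by (auto simp: cells_def)
  define s where "s = u(c := 1)"
  have uc: "u c = -1" using u(2) crossing by (auto simp: refines_def)
  have us: "u = s(c := -1)" using uc by (auto simp: s_def)
  have s: "s \<in> kauffman_states D" "refines D s (p(c := 1))"
    using kauffman_upd[OF u(1) crossing(1), of 1] refines_flip[OF u(2), of 1] by (auto simp: s_def)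
  obtain Z where Z: "site D s c = X \<union> Z" "X \<inter> Z = {}" "Z \<noteq> {}" "X \<noteq> {}" "X \<in> components D (s(c := -1))"
    "Z \<in> components D (s(c := -1))" "s c = 1"
    by (rule split_circle[OF s])
  have s1: "s(c := 1) = s" using Z(7) by (simp add: fun_upd_idem)
  define P where "P = (if site D s c \<subseteq> Q then Q else Q - X)"
  have uy: "unsplit y = (s, P)" unfolding yq unsplit_def fst_conv snd_conv s_def[symmetric] P_def by (rule refl)
  have QZ: "Z \<subseteq> Q \<or> Z \<inter> Q = {}" using components_cases[OF Z(6)] u(3) us by simp
  have PX: "P \<union> X = Q" using u(4) by (auto simp: P_def)
  have "closed_arcs D u P" using closed_Diff[OF u(3)] components_closed[OF Z(5)] u(3) us by (simp add: P_def)
  moreover have TP: "site D s c \<subseteq> P \<or> site D s c \<inter> P = {}"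
    using QZ Z(1) u(4) unfolding P_def by (simp split: if_split) blast
  moreover have "arc_at D (c, 0) \<in> site D s c" "arc_at D (c, 2) \<in> site D s c"
    using components_unresolved(1,10,11)[of 1 c s] crossing(1) unfolding site_def by auto
  ultimately have "closed_arcs D (s(c := 0)) P"
    using closed_unresolved[of "-1" c s P] us crossing(1) by auto
  hence cl: "closed_arcs D s P" using closed_both_markers[OF crossing(1), of s P] s1 by simp
  have sum: "(\<Sum>d\<in>crossings D. s d) = i + 2"
    using sum_upd[OF crossing(1), of s "-1"] u(5) us Z(7) by simp
  have "(s, P) \<in> opp (i + 2) (i + 2 + 2 * degree D s P)"
    using s cl sum m1 by (simp add: cells_def)
  hence "edge D s c P Q" using split_edge[of s P _ _ Q] u(3,4) us PX by simp
  hence "degree D u Q = degree D s P + 1" using us by (simp add: edge_def)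
  thus "unsplit y \<in> opp (i + 2) j" using s cl sum m1 u(6) unfolding uy by (simp add: cells_def)
  have "split (unsplit y) = (s(c := -1), Q)" unfolding uy split_def fst_conv snd_conv PX by (rule refl)
  thus "split (unsplit y) = y" unfolding us[symmetric] yq[symmetric] .
qed

lemma split_bij: "bij_betw split (opp (i + 2) j) (on i j)"
proof (rule bij_betw_byWitness[where f' = unsplit])
  show "\<forall>x\<in>opp (i + 2) j. unsplit (split x) = x" using split_in(2) by blast
  show "\<forall>y\<in>on i j. split (unsplit y) = y" using unsplit_in(2) by blast
  show "split ` opp (i + 2) j \<subseteq> on i j" using split_in(1)[of _ "i + 2" j] by force
  show "unsplit ` on i j \<subseteq> opp (i + 2) j" using unsplit_in(1) by blast
qed

lemma cells_split: "cells D p i j = (opp i j \<union> on i j) \<union> off i j"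
proof -
  have "cells D p i j = opp i j \<union> (on i j \<union> off i j)"
    using cells_resolve(1)[OF unres, of i j] cells_on_off m1 by simp
  thus ?thesis by (simp only: Un_assoc)
qed

lemma opp_disjoint: "opp i j \<inter> on i j = {}" "(opp i j \<union> on i j) \<inter> off i j = {}"
proof -
  show 1: "opp i j \<inter> on i j = {}" using cells_resolve(2)[OF unres, of i j i j] m1 by auto
  have "opp i j \<inter> off i j = {}" using cells_resolve(2)[OF unres, of i j i j] m1 by auto
  thus "(opp i j \<union> on i j) \<inter> off i j = {}"
    using on_off_disjoint[of i j i j] by (simp only: Int_Un_distrib2 Un_empty_left)
qed

lemma split_sign:
  assumes x: "x \<in> opp (i + 2) j" and y: "y \<in> opp i j"
  shows "coeff D (split x) (split y) = (-1) * weight x * weight y * coeff D x y"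
proof (rule cone_map_sign[of "cells D p i j"])
  have sx: "split x \<in> on i j" using split_in(1)[OF x] by simp
  have sy: "split y \<in> on (i - 2) j" using split_in(1)[OF y] by simp
  show "finite (cells D p i j)" by (rule finite_cells)
  show "y \<in> cells D p i j" "split x \<in> cells D p i j"
    unfolding cells_split using y sx by blast+
  show "y \<noteq> split x" using opp_disjoint(1)[of i j] y sx by blast
  show "coeff D x z * coeff D z (split y) = 0" if z: "z \<in> cells D p i j" "z \<noteq> y" "z \<noteq> split x" for z
  proof -
    from z(1) cells_split consider "z \<in> on i j" | "z \<in> off i j" | "z \<in> opp i j" by blast
    thus ?thesis
    proof cases
      case 1 thus ?thesis using coeff_split[OF x 1] z(3) by simp
    next
      case 2 thus ?thesis using coeff_on_off[OF disjI2[OF conjI[OF 2 sy]]] by simp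
    next
      case 3
      hence "split y \<noteq> split z" using split_in(2)[OF y] split_in(2)[OF 3] z(2) by metis
      thus ?thesis using coeff_split[OF 3 sy] by simp
    qed
  qed
  show "(\<Sum>z\<in>cells D p i j. coeff D x z * coeff D z (split y)) = 0"
    by (rule cells_square_zero) (use x sy in \<open>simp_all add: cells_split\<close>)
  show "coeff D x (split x) = weight x" using coeff_split[OF x sx] by simp
  show "coeff D y (split y) = weight y" using coeff_split[OF y sy] by simp
qed (rule weight_square)+

lemma exact:
  assumes ex: "exact_at (coeff D) (opp (i + 4) (j + 4)) (opp (i + 2) (j + 4)) (opp i (j + 4))"
  shows "exact_at (coeff D) (cells D p (i + 2) j) (cells D p i j) (cells D p (i - 2) j)"
proof -
  have on: "exact_at (coeff D) (on (i + 2) (j + 4)) (on i (j + 4)) (on (i - 2) (j + 4))"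
  proof (rule exact_reindex_inverse[where g = split and \<mu> = weight and \<epsilon> = "-1", OF _ _ _ _ weight_square _ _ _ ex])
    show "bij_betw split (opp (i + 4) (j + 4)) (on (i + 2) (j + 4))" using split_bij[of "i + 2" "j + 4"] by (simp add: add.commute)
    show "bij_betw split (opp (i + 2) (j + 4)) (on i (j + 4))" by (rule split_bij)
    show "bij_betw split (opp i (j + 4)) (on (i - 2) (j + 4))" using split_bij[of "i - 2"] by simp
    show "inj_on split (opp (i + 4) (j + 4) \<union> opp (i + 2) (j + 4) \<union> opp i (j + 4))"
    proof (rule inj_on_inverseI)
      fix x assume "x \<in> opp (i + 4) (j + 4) \<union> opp (i + 2) (j + 4) \<union> opp i (j + 4)"
      thus "unsplit (split x) = x" using split_in(2) by blast
    qed
    show "coeff D (split x) (split y) = -1 * weight x * weight y * coeff D x y"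
      if "x \<in> opp (i + 4) (j + 4)" "y \<in> opp (i + 2) (j + 4)" for x y
      using split_sign[of x "i + 2" "j + 4" y] that by (simp add: add.commute)
    show "coeff D (split x) (split y) = -1 * weight x * weight y * coeff D x y"
      if "x \<in> opp (i + 2) (j + 4)" "y \<in> opp i (j + 4)" for x y using split_sign[OF that] .
  qed simp
  have off: "exact_at (coeff D) (off (i + 2) j) (off i j) (off (i - 2) j)"
  proof (rule exact_reindex[where g = toggle and \<mu> = "\<lambda>_. 1" and \<epsilon> = 1, OF _ _ _ _ _ _ _ _ on])
    show "bij_betw toggle (off (i + 2) j) (on (i + 2) (j + 4))" "bij_betw toggle (off i j) (on i (j + 4))"
      by (rule toggle_bij)+
    have "bij_betw toggle (off (i - 2) j) (on (i - 2) (j + 4))" by (rule toggle_bij)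
    thus "toggle ` off (i - 2) j \<subseteq> on (i - 2) (j + 4)" "on (i - 2) (j + 4) \<subseteq> toggle ` off (i - 2) j"
      unfolding bij_betw_def by blast+
    show "coeff D (toggle x) (toggle y) = 1 * 1 * 1 * coeff D x y" if "x \<in> off (i + 2) j" "y \<in> off i j" for x y
      using coeff_toggle[OF that] by simp
    show "coeff D (toggle x) (toggle y) = 1 * 1 * 1 * coeff D x y" if "x \<in> off i j" "y \<in> off (i - 2) j" for x y
      using coeff_toggle[OF that] by simp
  qed simp_all
  have cone: "exact_at (coeff D) (opp (i + 2) j \<union> on (i + 2) j) (opp i j \<union> on i j) (opp (i - 2) j \<union> on (i - 2) j)"
  proof (rule exact_cone[where g = split and \<mu> = weight, OF _ _ _ _ opp_disjoint(1) opp_disjoint(1)])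
    show "bij_betw split (opp (i + 2) j) (on i j)" by (rule split_bij)
    have "bij_betw split (opp i j) (on (i - 2) j)" using split_bij[of "i - 2"] by simp
    thus "inj_on split (opp i j)" "split ` opp i j \<subseteq> on (i - 2) j" unfolding bij_betw_def by blast+
    show "(\<Sum>y\<in>opp i j \<union> on i j. coeff D x y * coeff D y z) = 0" if "x \<in> opp (i + 2) j" "z \<in> on (i - 2) j" for x z
    proof -
      have "(\<Sum>y\<in>opp i j \<union> on i j. coeff D x y * coeff D y z) = (\<Sum>y\<in>cells D p i j. coeff D x y * coeff D y z)"
      proof (rule sum.mono_neutral_left[OF finite_cells])
        show "opp i j \<union> on i j \<subseteq> cells D p i j" unfolding cells_split by (rule Un_upper1)
        show "\<forall>y\<in>cells D p i j - (opp i j \<union> on i j). coeff D x y * coeff D y z = 0"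
        proof
          fix y assume "y \<in> cells D p i j - (opp i j \<union> on i j)"
          hence "y \<in> off i j" using cells_split[of i j] by blast
          from coeff_on_off[OF disjI2[OF conjI[OF this that(2)]]]
          show "coeff D x y * coeff D y z = 0" by simp
        qed
      qed
      also have "\<dots> = 0" by (rule cells_square_zero) (use that in \<open>simp_all add: cells_split\<close>)
      finally show ?thesis .
    qed
  qed (rule finite_parts weight_square | erule (1) coeff_split)+
  have zero: "coeff D x y = 0" if "x \<in> off i j" "y \<in> opp i' j' \<union> on i' j'" for x y i j i' j'
  proof -
    from that(2) show ?thesis
    proof
      assume "y \<in> opp i' j'"
      thus ?thesis using coeff_marker_zero[OF crossing(1), of x p i j y i' j'] that(1) m1 by simp
    next
      assume "y \<in> on i' j'"
      from coeff_on_off[OF disjI2[OF conjI[OF that(1) this]]] show ?thesis .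
    qed
  qed
  show ?thesis unfolding cells_split
  proof (rule exact_extension[OF _ _ _ _ opp_disjoint(2) opp_disjoint(2) zero zero _ cone off])
    show "(\<Sum>y\<in>opp i j \<union> on i j \<union> off i j. coeff D x y * coeff D y z) = 0"
      if "x \<in> opp (i + 2) j \<union> on (i + 2) j" "z \<in> off (i - 2) j" for x z
      unfolding cells_split[symmetric]
      by (rule cells_square_zero) (use that in \<open>simp_all only: cells_split Un_iff simp_thms\<close>)
  qed (use finite_parts in auto)
qed

end

section \<open>Connected partial resolutions are thin\<close>

text \<open>
  The upper bound \<open>2|s\<^sub>+| - N\<close> for \<open>j - 2i\<close>, in the gradings of the whole diagram: the markers that are
  already fixed are counted in \<open>i\<close>. The lower bound is four less when the resolution is connected, by
  the vanishing of the genus defect.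
\<close>

definition top_diagonal :: "link_diagram \<Rightarrow> (nat \<Rightarrow> int) \<Rightarrow> int" where
  "top_diagonal D p = 2 * int (card (components D (fill 1 p))) - int (card (unresolved D p)) - (\<Sum>c\<in>crossings D. p c)"

context turaev_genus_zero
begin

lemma closed_connected:
  assumes "card (components D p) = 1" "closed_arcs D p V" "V \<noteq> {}" shows "V = arcs D"
proof -
  obtain C where C: "components D p = {C}" using assms(1) by (rule card_1_singletonE)
  have "U = C" if "closed_arcs D p U" "U \<noteq> {}" for U
  proof -
    have "\<Union>{B \<in> {C}. B \<subseteq> U} = U" using closed_Union_components[OF that(1)] unfolding C .
    thus ?thesis using that(2) by (cases "C \<subseteq> U") auto
  qed
  thus ?thesis using assms(2,3) closed_arcs_all closed_subset[OF assms(2)] by blast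
qed

lemma closed_unresolved_all:
  assumes "closed_arcs D p U" "d \<in> unresolved D p" "k < 4"
  shows "arc_at D (d, k) \<in> U \<longleftrightarrow> arc_at D (d, 0) \<in> U"
proof -
  have "compatible 0 (\<lambda>k. arc_at D (d, k) \<in> U)"
    using assms(1,2) by (auto simp: closed_arcs_def unresolved_def)
  from compatible_zero_eq[OF this assms(3)] show ?thesis .
qed

text \<open>
  If every unresolved crossing can be smoothed so that the diagram falls apart, then the diagram is a
  tree of circles, and a leaf of the tree is a kink. The leaf is found as a piece with the fewest arcs:
  another crossing on it would cut off a smaller piece.
\<close>

lemma exists_kink:
  assumes p: "partial_state D p" and one: "card (components D p) = 1" and ne: "unresolved D p \<noteq> {}"
    and nug: "\<And>c. c \<in> unresolved D p \<Longrightarrow> \<exists>m\<in>{1, -1}. separates D p c m"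
  shows "\<exists>c m X. kink D p c m X"
proof -
  define \<Phi> where "\<Phi> X \<longleftrightarrow> (\<exists>c\<in>unresolved D p. \<exists>m\<in>{1, -1}. separates D p c m \<and> X \<in> components D (p(c := m)))" for X
  obtain c0 where c0: "c0 \<in> unresolved D p" using ne by auto
  then obtain m0 where m0: "m0 \<in> {1, -1}" "separates D p c0 m0" using nug by blast
  have "arc_at D (c0, 0) \<in> arcs D" using c0 arc_in by (auto simp: unresolved_def)
  hence "\<Phi> (component D (p(c0 := m0)) (arc_at D (c0, 0)))"
    unfolding \<Phi>_def using c0 m0 component_in by blast
  hence "\<exists>X. \<Phi> X \<and> (\<forall>Y. \<Phi> Y \<longrightarrow> card X \<le> card Y)" by (rule ex_has_least_nat)
  then obtain X where X: "\<Phi> X" and least: "\<And>Y. \<Phi> Y \<Longrightarrow> card X \<le> card Y" by blast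
  then obtain c m where c: "c \<in> unresolved D p" and m: "m \<in> {1, -1}" "separates D p c m" "X \<in> components D (p(c := m))"
    unfolding \<Phi>_def by blast
  have c': "c \<in> crossings D" "p c = 0" using c by (auto simp: unresolved_def)
  have cX: "closed_arcs D (p(c := m)) X" by (rule components_closed[OF m(3)])
  have finX: "finite X" using closed_subset[OF cX] finite_arcs finite_subset by blast
  have "kink D p c m X"
  proof (unfold_locales)
    fix d k assume d: "d \<in> unresolved D p" "d \<noteq> c" and k: "k < (4::nat)"
    show "arc_at D (d, k) \<notin> X"
    proof
      assume dX: "arc_at D (d, k) \<in> X"
      have d': "d \<in> crossings D" "p d = 0" using d by (auto simp: unresolved_def)
      have du: "d \<in> unresolved D (p(c := m))" using d by (auto simp: unresolved_def)
      have all: "arc_at D (d, l) \<in> X" if "l < 4" for l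
        using closed_unresolved_all[OF cX du] that k dX by blast
      obtain l where l: "l \<in> {1, -1}" "separates D p d l" using nug[OF d(1)] by blast
      let ?q = "p(d := l)"
      have cq: "c \<in> unresolved D ?q" using c d by (auto simp: unresolved_def)
      note cu = components_unresolved[OF l(1) d'(1), of p]
      let ?A = "component D ?q (arc_at D (d, 0))" and ?B = "component D ?q (arc_at D (d, 2))"
      have AB: "?A \<inter> ?B = {}" using cu(6,7) l(2) by blast
      obtain Y where Y: "Y \<in> components D ?q" "arc_at D (c, 0) \<notin> Y"
        using AB cu(8,9) by blast
      have cY: "closed_arcs D ?q Y" by (rule components_closed[OF Y(1)])
      have Yc: "arc_at D (c, i) \<notin> Y" if "i < 4" for i
        using closed_unresolved_all[OF cY cq that] Y(2) by blast
      \<comment> \<open>the part of \<open>Y\<close> outside \<open>X\<close> avoids both \<open>c\<close> and \<open>d\<close>, so connectedness leaves nothing of it\<close>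
      have "closed_arcs D (p(c := m, d := l)) X"
        by (rule closed_refines[OF _ cX]) (use d d' in \<open>auto simp: refines_def\<close>)
      moreover have "closed_arcs D (p(c := m, d := l)) Y"
        by (rule closed_refines[OF _ cY]) (use c c' d in \<open>auto simp: refines_def\<close>)
      ultimately have "closed_arcs D (p(c := m, d := l)) (Y - X)" using closed_Diff by blast
      hence "closed_arcs D (p(c := m)) (Y - X)"
        by (rule closed_away[where b = d]) (use all in auto)
      hence YX: "closed_arcs D p (Y - X)"
        by (rule closed_away[where b = c]) (use Yc in auto)
      have "Y - X \<noteq> arcs D" using all[of 0] arc_in[OF d'(1), of 0] by auto
      hence "Y \<subseteq> X" using closed_connected[OF one YX] by blast
      moreover have "Y \<noteq> X"
      proof
        assume "Y = X"
        hence "closed_arcs D p X"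
          by (intro closed_away[OF cX, where b = c]) (use Yc in auto)
        hence "X = arcs D" using closed_connected[OF one] components_nonempty[OF m(3)] by blast
        thus False using \<open>Y = X\<close> Y(2) arc_in[OF c'(1), of 0] by simp
      qed
      ultimately have "card Y < card X" using finX psubset_card_mono by blast
      moreover have "\<Phi> Y" unfolding \<Phi>_def using d(1) l Y(1) by blast
      ultimately show False using least[of Y] by simp
    qed
  qed (use c m one in auto)
  thus ?thesis by blast
qed

text \<open>
  A positive marker fixes the positive extreme state and the upper bound; a negative marker fixes the
  negative extreme state and the lower bound. As the distance of the bounds is always four, both are
  the same in either case.
\<close>

lemma top_diagonal_resolve:
  assumes p: "partial_state D p" and one: "card (components D p) = 1" and c: "c \<in> unresolved D p"
    and m: "m \<in> {1, -1}" and ns: "\<not> separates D p c m"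
  shows "partial_state D (p(c := m))" "card (components D (p(c := m))) = 1"
    "top_diagonal D (p(c := m)) = top_diagonal D p"
    "card (unresolved D (p(c := m))) < card (unresolved D p)"
proof -
  have c': "c \<in> crossings D" "p c = 0" using c by (auto simp: unresolved_def)
  show p': "partial_state D (p(c := m))" using p m by (auto simp: partial_state_def)
  have p0: "p(c := 0) = p" using c' by (simp add: fun_upd_idem)
  show one': "card (components D (p(c := m))) = 1"
    using card_components_resolve[OF m c'(1), of p] ns one p0 by simp
  have m0: "m \<noteq> 0" using m by auto
  have "card (unresolved D (p(c := m))) + 1 = card (unresolved D p)"
    using c finite_unresolved[of p] card_Suc_Diff1[of "unresolved D p" c] by (simp add: unresolved_upd[OF m0])
  hence u: "int (card (unresolved D (p(c := m)))) = int (card (unresolved D p)) - 1"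
    and "card (unresolved D (p(c := m))) < card (unresolved D p)" by simp_all
  thus "card (unresolved D (p(c := m))) < card (unresolved D p)" by simp
  note e = extreme_components[OF p] extreme_components[OF p']
  have s: "(\<Sum>d\<in>crossings D. (p(c := m)) d) = (\<Sum>d\<in>crossings D. p d) + m"
    using sum_upd[OF c'(1), of p m] c' by simp
  have f: "fill m (p(c := m)) = fill m p" using c' m0 by (auto simp: fill_def)
  show "top_diagonal D (p(c := m)) = top_diagonal D p"
  proof (cases "m = 1")
    case True thus ?thesis using u s f by (simp add: top_diagonal_def)
  next
    case False
    hence "m = -1" using m by simp
    thus ?thesis using u s f e one one' by (simp add: top_diagonal_def)
  qed
qed

lemma cells_resolved_diagonal:
  assumes u: "unresolved D p = {}" and one: "card (components D p) = 1" and x: "x \<in> cells D p i j"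
  shows "top_diagonal D p - 4 \<le> j - 2 * i" "j - 2 * i \<le> top_diagonal D p"
proof -
  obtain s P where xs: "x = (s, P)" by (cases x)
  have s: "refines D s p" "(\<Sum>c\<in>crossings D. s c) = i" "i + 2 * degree D s P = j"
    using x xs by (auto simp: cells_def)
  have sp: "s d = p d" if "d \<in> crossings D" for d using s(1) u that by (auto simp: refines_def unresolved_def)
  have "components D s = components D p" "components D (fill 1 p) = components D p"
    using u by (auto intro!: components_cong sp simp: fill_def unresolved_def)
  moreover have "(\<Sum>c\<in>crossings D. p c) = i" using s(2) sp by (simp cong: sum.cong)
  moreover have "card {C \<in> components D s. C \<subseteq> P} \<le> card (components D s)"
    by (rule card_mono[OF finite_components]) auto
  ultimately show "top_diagonal D p - 4 \<le> j - 2 * i" "j - 2 * i \<le> top_diagonal D p"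
    using s(3) one u unfolding top_diagonal_def degree_def by simp_all
qed

text \<open>
  Choose a crossing both of whose smoothings are connected and use the exact sequence of its two
  smoothings, or else remove a kink. At the end all crossings are resolved and there is one circle,
  whose two generators lie on the two extreme diagonals.
\<close>

lemma cells_exact:
  assumes "partial_state D p" "card (components D p) = 1"
    and "\<not> (top_diagonal D p - 4 \<le> j - 2 * i \<and> j - 2 * i \<le> top_diagonal D p)"
  shows "exact_at (coeff D) (cells D p (i + 2) j) (cells D p i j) (cells D p (i - 2) j)"
  using assms
proof (induction "card (unresolved D p)" arbitrary: p i j rule: less_induct)
  case less
  show ?case
  proof (cases "unresolved D p = {}")
    case True
    hence "cells D p i j = {}" using cells_resolved_diagonal[OF True less.prems(2)] less.prems(3) by blast
    thus ?thesis by (simp add: exact_at_def)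
  next
    case ne: False
    have IH: "exact_at (coeff D) (cells D (p(c := m)) (i' + 2) j') (cells D (p(c := m)) i' j') (cells D (p(c := m)) (i' - 2) j')"
      if "c \<in> unresolved D p" "m \<in> {1, -1}" "\<not> separates D p c m" "j' - 2 * i' = j - 2 * i" for c m i' j'
      using less.hyps[of "p(c := m)" j' i'] top_diagonal_resolve[OF less.prems(1,2) that(1-3)] less.prems(3) that(4)
      by simp
    show ?thesis
    proof (cases "\<exists>c\<in>unresolved D p. \<forall>m\<in>{1, -1}. \<not> separates D p c m")
      case True
      then obtain c where c: "c \<in> unresolved D p" "\<not> separates D p c 1" "\<not> separates D p c (-1)" by auto
      have c': "c \<in> crossings D" using c by (auto simp: unresolved_def)
      note split = cells_resolve[OF c(1)]
      show ?thesis unfolding split(1)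
      proof (rule exact_extension[OF finite_cells finite_cells finite_cells finite_cells split(2) split(2)])
        show "coeff D x y = 0" if "x \<in> cells D (p(c := -1)) (i + 2) j" "y \<in> cells D (p(c := 1)) i j" for x y
          by (rule coeff_marker_zero[OF c' that])
        show "coeff D x y = 0" if "x \<in> cells D (p(c := -1)) i j" "y \<in> cells D (p(c := 1)) (i - 2) j" for x y
          by (rule coeff_marker_zero[OF c' that])
        show "(\<Sum>y\<in>cells D (p(c := 1)) i j \<union> cells D (p(c := -1)) i j. coeff D x y * coeff D y z) = 0"
          if "x \<in> cells D (p(c := 1)) (i + 2) j" "z \<in> cells D (p(c := -1)) (i - 2) j" for x z
          unfolding split(1)[symmetric] by (rule cells_square_zero) (use that in \<open>simp_all add: split(1)\<close>)
        show "exact_at (coeff D) (cells D (p(c := 1)) (i + 2) j) (cells D (p(c := 1)) i j) (cells D (p(c := 1)) (i - 2) j)"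
          by (rule IH) (use c in auto)
        show "exact_at (coeff D) (cells D (p(c := -1)) (i + 2) j) (cells D (p(c := -1)) i j) (cells D (p(c := -1)) (i - 2) j)"
          by (rule IH) (use c in auto)
      qed
    next
      case False
      hence "\<exists>c m X. kink D p c m X"
        by (intro exists_kink[OF less.prems(1,2) ne]) blast
      then obtain c m X where k: "kink D p c m X" by blast
      interpret k: kink D p c m X by (rule k)
      have "\<not> separates D (fill 1 p) c 1 \<or> \<not> separates D (fill 1 p) c (-1)"
        using not_both_separate[of c "fill 1 p"] k.crossing(1) by (auto simp: fill_def)
      moreover have "separates D p c l \<Longrightarrow> separates D (fill 1 p) c l" for l
        by (rule separates_refines) (auto simp: refines_def fill_def)
      ultimately have ns: "\<not> separates D p c (-m)" using k.sep k.m by auto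
      have mm: "-m \<in> {1, -1}" using k.m by auto
      show ?thesis
      proof (cases "m = 1")
        case True
        interpret positive_kink D p c m X by unfold_locales (rule True)
        show ?thesis by (rule exact) (use IH[OF k.unres mm ns, of "j - 4" "i - 2"] in simp)
      next
        case False
        hence "m = -1" using k.m by simp
        interpret negative_kink D p c m X by unfold_locales fact
        show ?thesis by (rule exact) (use IH[OF k.unres mm ns, of "j + 4" "i + 2"] in \<open>simp add: add.commute\<close>)
      qed
    qed
  qed
qed

end

section \<open>Enhanced states as closed sets of arcs\<close>

definition positive_part :: "link_diagram \<Rightarrow> enhanced_state \<Rightarrow> (nat \<Rightarrow> int) \<times> nat set" where
  "positive_part D S = (fst S, \<Union>{C \<in> components D (fst S). snd S C = 1})"

definition chain_coeff :: "link_diagram \<Rightarrow> enhanced_state \<Rightarrow> enhanced_state \<Rightarrow> int" where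
  "chain_coeff D S S' = (-1) ^ t_exponent D S S' * incidence D S S'"

context four_valent
begin

lemma positive_circles:
  assumes "s \<in> kauffman_states D" "\<epsilon> \<in> components D s \<rightarrow>\<^sub>E {1, -1}"
  shows "{C \<in> components D s. C \<subseteq> \<Union>{C \<in> components D s. \<epsilon> C = (1::int)}} = {C \<in> components D s. \<epsilon> C = 1}"
proof -
  have "\<epsilon> C = 1" if C: "C \<in> components D s" "C \<subseteq> \<Union>{C \<in> components D s. \<epsilon> C = 1}" for C
  proof -
    obtain a where a: "a \<in> C" using components_nonempty[OF C(1)] by auto
    then obtain B where "B \<in> components D s" "\<epsilon> B = 1" "a \<in> B" using C(2) by blast
    thus ?thesis using components_eqI[OF C(1) _ a, of B] by simp
  qed
  thus ?thesis by blast
qed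

lemma tau_degree:
  assumes "s \<in> kauffman_states D" "\<epsilon> \<in> components D s \<rightarrow>\<^sub>E {1, -1}"
  shows "tau D (s, \<epsilon>) = degree D s (snd (positive_part D (s, \<epsilon>)))"
proof -
  have "tau D (s, \<epsilon>) = (\<Sum>C\<in>components D s. 2 * of_bool (\<epsilon> C = 1) - 1)"
    unfolding tau_def using circles_eq_components[OF assms(1)] assms(2)
    by (auto intro!: sum.cong simp: PiE_def Pi_def)
  also have "\<dots> = 2 * int (card {C \<in> components D s. \<epsilon> C = 1}) - int (card (components D s))"
    using finite_components by (simp add: sum_subtractf sum_distrib_left[symmetric] Int_def)
  finally show ?thesis using positive_circles[OF assms] by (simp add: degree_def positive_part_def)
qed

lemma positive_part_bij: "bij_betw (positive_part D) (generators D i j) (cells D (\<lambda>_. 0) i j)"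
proof (rule bij_betw_byWitness[where f' = "\<lambda>(s, P). (s, \<lambda>C\<in>components D s. if C \<subseteq> P then 1 else -1)"])
  have gen: "(s, \<epsilon>) \<in> generators D i j \<longleftrightarrow> s \<in> kauffman_states D \<and> \<epsilon> \<in> components D s \<rightarrow>\<^sub>E {1, -1} \<and>
      (\<Sum>c\<in>crossings D. s c) = i \<and> i + 2 * degree D s (snd (positive_part D (s, \<epsilon>))) = j" for s \<epsilon>
    using tau_degree[of s \<epsilon>] circles_eq_components[of s]
    by (auto simp: generators_def enhanced_states_def sigma_def)
  show "\<forall>S\<in>generators D i j. (case positive_part D S of (s, P) \<Rightarrow> (s, \<lambda>C\<in>components D s. if C \<subseteq> P then 1 else -1)) = S"
  proof
    fix S assume S: "S \<in> generators D i j"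
    obtain s \<epsilon> where s: "S = (s, \<epsilon>)" by (cases S)
    have g: "s \<in> kauffman_states D" "\<epsilon> \<in> components D s \<rightarrow>\<^sub>E {1, -1}" using S s gen by auto
    have "(\<lambda>C\<in>components D s. if C \<subseteq> \<Union>{C \<in> components D s. \<epsilon> C = 1} then 1 else -1) = \<epsilon>"
    proof
      fix C
      show "(\<lambda>C\<in>components D s. if C \<subseteq> \<Union>{C \<in> components D s. \<epsilon> C = 1} then 1 else -1) C = \<epsilon> C"
      proof (cases "C \<in> components D s")
        case True
        hence "C \<subseteq> \<Union>{C \<in> components D s. \<epsilon> C = 1} \<longleftrightarrow> \<epsilon> C = 1" using positive_circles[OF g] by blast
        moreover have "\<epsilon> C \<in> {1, -1}" using g(2) True by (auto simp: PiE_def Pi_def)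
        ultimately show ?thesis using True by auto
      next
        case False
        thus ?thesis using g(2) by (auto simp: PiE_def extensional_def)
      qed
    qed
    thus "(case positive_part D S of (s, P) \<Rightarrow> (s, \<lambda>C\<in>components D s. if C \<subseteq> P then 1 else -1)) = S"
      using s by (simp add: positive_part_def)
  qed
  have inv: "positive_part D (s, \<lambda>C\<in>components D s. if C \<subseteq> P then 1 else -1) = (s, P)"
    if "closed_arcs D s P" for s P
  proof -
    have "{C \<in> components D s. (\<lambda>C\<in>components D s. if C \<subseteq> P then 1 else - 1 :: int) C = 1} =
        {C \<in> components D s. C \<subseteq> P}" by auto
    thus ?thesis using closed_Union_components[OF that] by (simp add: positive_part_def)
  qed
  show "\<forall>y\<in>cells D (\<lambda>_. 0) i j. positive_part D (case y of (s, P) \<Rightarrow> (s, \<lambda>C\<in>components D s. if C \<subseteq> P then 1 else -1)) = y"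
    using inv by (auto simp: cells_def)
  show "positive_part D ` generators D i j \<subseteq> cells D (\<lambda>_. 0) i j"
  proof
    fix y assume "y \<in> positive_part D ` generators D i j"
    then obtain s \<epsilon> where s: "y = positive_part D (s, \<epsilon>)" "(s, \<epsilon>) \<in> generators D i j" by auto
    have "closed_arcs D s (\<Union>{C \<in> components D s. \<epsilon> C = 1})"
    proof -
      have "finite {C \<in> components D s. \<epsilon> C = 1}" using finite_components by auto
      moreover have "closed_arcs D s (\<Union>F)" if "finite F" "F \<subseteq> components D s" for F
        using that by (induction F rule: finite_induct) (auto intro: closed_empty closed_Un components_closed)
      ultimately show ?thesis by blast
    qed
    thus "y \<in> cells D (\<lambda>_. 0) i j" using s(2) unfolding gen s(1)
      by (simp add: cells_def positive_part_def refines_def)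
  qed
  show "(\<lambda>(s, P). (s, \<lambda>C\<in>components D s. if C \<subseteq> P then 1 else -1)) ` cells D (\<lambda>_. 0) i j \<subseteq> generators D i j"
    using inv gen by (auto simp: cells_def)
qed

lemma touches_iff:
  assumes m: "m \<in> {1, -1}" and c: "c \<in> crossings D" and C: "C \<in> components D (s(c := m))"
  shows "touches D C c \<longleftrightarrow> C \<notin> components D (s(c := 0)) - {site D s c}"
proof -
  note cu = components_unresolved[OF m c, of s, folded site_def]
  show ?thesis
  proof
    assume "touches D C c"
    then obtain k where k: "k < 4" "arc_at D (c, k) \<in> C" by (auto simp: touches_def)
    have "compatible 0 (\<lambda>k. arc_at D (c, k) \<in> site D s c)"
      using closed_component[of "s(c := 0)" "arc_at D (c, 0)"] c unfolding site_def closed_arcs_def by auto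
    from compatible_zero_eq[OF this k(1)] have "arc_at D (c, k) \<in> site D s c" using cu(1,10) by blast
    thus "C \<notin> components D (s(c := 0)) - {site D s c}" using components_eqI[OF _ cu(3) k(2)] by blast
  next
    assume "C \<notin> components D (s(c := 0)) - {site D s c}"
    hence "C = component D (s(c := m)) (arc_at D (c, 0)) \<or> C = component D (s(c := m)) (arc_at D (c, 2))"
      using C cu(2) by blast
    hence "arc_at D (c, 0) \<in> C \<or> arc_at D (c, 2) \<in> C" using cu(10,11) by blast
    thus "touches D C c" unfolding touches_def by (elim disjE) (rule exI[of _ 0], simp, rule exI[of _ 2], simp)
  qed
qed

lemma untouched_part:
  assumes m: "m \<in> {1, -1}" and c: "c \<in> crossings D"
  shows "\<Union>{C \<in> components D (s(c := m)). \<epsilon> C = 1} - site D s c =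
    \<Union>{C \<in> components D (s(c := 0)) - {site D s c}. \<epsilon> C = (1::int)}"
proof -
  note cu = components_unresolved[OF m c, of s, folded site_def]
  have dis: "C \<inter> site D s c = {}" if "C \<in> components D (s(c := 0)) - {site D s c}" for C
    using components_eqI[OF _ cu(3), of C] that by blast
  have sub: "C \<subseteq> site D s c" if "C \<in> components D (s(c := m))" "C \<notin> components D (s(c := 0)) - {site D s c}" for C
    using that cu(1,2) by blast
  show ?thesis using dis sub cu(2) by blast
qed

text \<open>
  For generators in consecutive chain groups, the condition on degrees in an edge holds automatically,
  and a single changed marker has to go from positive to negative.
\<close>

lemma chain_coeff_eq:
  assumes S: "S \<in> generators D i j" and S': "S' \<in> generators D (i - 2) j"
  shows "coeff D (positive_part D S) (positive_part D S') = chain_coeff D S S'"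
proof -
  obtain s \<epsilon> where s: "S = (s, \<epsilon>)" by (cases S)
  obtain u \<eta> where u: "S' = (u, \<eta>)" by (cases S')
  define P where "P = \<Union>{C \<in> components D s. \<epsilon> C = 1}"
  define Q where "Q = \<Union>{C \<in> components D u. \<eta> C = 1}"
  have pp: "positive_part D S = (s, P)" "positive_part D S' = (u, Q)"
    by (simp_all add: positive_part_def s u P_def Q_def)
  have "(s, P) \<in> cells D (\<lambda>_. 0) i j" "(u, Q) \<in> cells D (\<lambda>_. 0) (i - 2) j"
    using positive_part_bij[of i j] positive_part_bij[of "i - 2" j] S S' pp unfolding bij_betw_def by (metis imageI)+
  hence sK: "s \<in> kauffman_states D" and uK: "u \<in> kauffman_states D"
    and si: "(\<Sum>c\<in>crossings D. s c) = i" and ui: "(\<Sum>c\<in>crossings D. u c) = i - 2"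
    and deg: "degree D u Q = degree D s P + 1" by (auto simp: cells_def)
  have \<epsilon>: "\<epsilon> \<in> components D s \<rightarrow>\<^sub>E {1, -1}" and \<eta>: "\<eta> \<in> components D u \<rightarrow>\<^sub>E {1, -1}"
    using S S' s u circles_eq_components[OF sK] circles_eq_components[OF uK]
    by (auto simp: generators_def enhanced_states_def)
  show ?thesis
  proof (cases "\<exists>c\<in>crossings D. s c = 1 \<and> u = s(c := -1)")
    case True
    then obtain c where c: "c \<in> crossings D" "s c = 1" "u = s(c := -1)" by blast
    have s1: "s(c := 1) = s" using c by (simp add: fun_upd_idem)
    have ch: "changed D S S' = {c}" using c by (auto simp: changed_def s u)
    let ?O = "components D (s(c := 0)) - {site D s c}"
    have P: "P - site D s c = \<Union>{C \<in> ?O. \<epsilon> C = 1}" and Q: "Q - site D s c = \<Union>{C \<in> ?O. \<eta> C = 1}"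
      using untouched_part[of 1 c s \<epsilon>] untouched_part[of "-1" c s \<eta>] c s1 by (simp_all add: P_def Q_def)
    have Os: "?O \<subseteq> components D s" and Ou: "?O \<subseteq> components D u"
      using components_unresolved(2)[of 1 c s] components_unresolved(2)[of "-1" c s] c s1
      unfolding site_def by auto
    have "(\<forall>C \<in> components D s \<union> components D u. \<not> touches D C c \<longrightarrow> \<epsilon> C = \<eta> C) \<longleftrightarrow> (\<forall>C\<in>?O. \<epsilon> C = \<eta> C)"
      using touches_iff[of 1 c _ s] touches_iff[of "-1" c _ s] c s1 Os Ou by (simp del: fun_upd_apply) blast
    also have "\<dots> \<longleftrightarrow> P - site D s c = Q - site D s c"
    proof
      assume all: "\<forall>C\<in>?O. \<epsilon> C = \<eta> C"
      have "\<epsilon> C = 1 \<longleftrightarrow> \<eta> C = 1" if "C \<in> ?O" for C using bspec[OF all that] by simp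
      hence "{C \<in> ?O. \<epsilon> C = 1} = {C \<in> ?O. \<eta> C = 1}" by blast
      thus "P - site D s c = Q - site D s c" unfolding P Q by (rule arg_cong)
    next
      assume eq: "P - site D s c = Q - site D s c"
      have iff: "C \<subseteq> \<Union>{C \<in> ?O. \<zeta> C = 1} \<longleftrightarrow> \<zeta> C = 1" if C: "C \<in> ?O" for C and \<zeta> :: "nat set \<Rightarrow> int"
      proof
        assume sub: "C \<subseteq> \<Union>{C \<in> ?O. \<zeta> C = 1}"
        obtain a where a: "a \<in> C" using components_nonempty C by blast
        then obtain B where B: "B \<in> ?O" "\<zeta> B = 1" "a \<in> B" using sub by blast
        have "C = B" by (rule components_eqI[of _ "s(c := 0)"]) (use C B a in auto)
        thus "\<zeta> C = 1" using B by simp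
      qed (use C in blast)
      show "\<forall>C\<in>?O. \<epsilon> C = \<eta> C"
      proof
        fix C assume C: "C \<in> ?O"
        have "\<epsilon> C = 1 \<longleftrightarrow> \<eta> C = 1" using iff[OF C, of \<epsilon>] iff[OF C, of \<eta>] eq unfolding P Q by simp
        moreover have "\<epsilon> C \<in> {1, -1}" using \<epsilon> Os C by (auto simp: PiE_def Pi_def)
        moreover have "\<eta> C \<in> {1, -1}" using \<eta> Ou C by (auto simp: PiE_def Pi_def)
        ultimately show "\<epsilon> C = \<eta> C" by auto
      qed
    qed
    also have "\<dots> \<longleftrightarrow> edge D s c P Q" using deg c by (simp add: edge_def)
    finally have "incidence D S S' = of_bool (edge D s c P Q)"
      unfolding incidence_def ch using circles_eq_components[OF sK] circles_eq_components[OF uK] by (simp add: s u)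
    moreover have "(-1) ^ t_exponent D S S' = edge_sign D s c"
      unfolding t_exponent_def ch by (simp add: s edge_sign_def)
    ultimately show ?thesis unfolding pp chain_coeff_def using coeff_upd[of c s P Q] c by simp
  next
    case False
    have "coeff D (s, P) (u, Q) = 0"
    proof (rule ccontr)
      assume "coeff D (s, P) (u, Q) \<noteq> 0"
      thus False using False by (metis coeff_nonzeroD)
    qed
    moreover have "changed D S S' \<noteq> {c}" for c
    proof
      assume ch: "changed D S S' = {c}"
      hence c: "c \<in> crossings D" "s c \<noteq> u c" by (auto simp: changed_def s u)
      have "u = s(c := u c)"
      proof
        fix d
        show "u d = (s(c := u c)) d"
        proof (cases "d \<in> crossings D")
          case True
          hence "d \<noteq> c \<Longrightarrow> s d = u d" using ch by (auto simp: changed_def s u)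
          thus ?thesis by auto
        next
          case False
          thus ?thesis using sK uK c by (auto simp: kauffman_states_def PiE_def extensional_def)
        qed
      qed
      moreover from this have "(\<Sum>d\<in>crossings D. u d) = (\<Sum>d\<in>crossings D. s d) - s c + u c"
        using sum_upd[OF c(1), of s "u c"] by simp
      hence "u c = s c - 2" using si ui by simp
      moreover have "s c \<in> {1, -1}" "u c \<in> {1, -1}"
        using sK uK c(1) by (auto simp: kauffman_states_def PiE_def Pi_def)
      ultimately show False using False c(1) by auto
    qed
    hence "incidence D S S' = 0" by (simp add: incidence_def)
    ultimately show ?thesis unfolding pp chain_coeff_def by simp
  qed
qed

lemma generators_exact:
  assumes "exact_at (coeff D) (cells D (\<lambda>_. 0) (i + 2) j) (cells D (\<lambda>_. 0) i j) (cells D (\<lambda>_. 0) (i - 2) j)"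
  shows "exact_at (chain_coeff D) (generators D (i + 2) j) (generators D i j) (generators D (i - 2) j)"
proof (rule exact_reindex[where g = "positive_part D" and \<mu> = "\<lambda>_. 1" and \<epsilon> = 1, OF positive_part_bij positive_part_bij _ _ _ _ _ _ assms])
  have "bij_betw (positive_part D) (generators D (i - 2) j) (cells D (\<lambda>_. 0) (i - 2) j)" by (rule positive_part_bij)
  thus "positive_part D ` generators D (i - 2) j \<subseteq> cells D (\<lambda>_. 0) (i - 2) j"
    "cells D (\<lambda>_. 0) (i - 2) j \<subseteq> positive_part D ` generators D (i - 2) j" by (auto simp: bij_betw_def)
  show "coeff D (positive_part D x) (positive_part D y) = 1 * 1 * 1 * chain_coeff D x y"
    if "x \<in> generators D (i + 2) j" "y \<in> generators D i j" for x y
    using chain_coeff_eq[of x "i + 2" j y] that by simp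
  show "coeff D (positive_part D x) (positive_part D y) = 1 * 1 * 1 * chain_coeff D x y"
    if "x \<in> generators D i j" "y \<in> generators D (i - 2) j" for x y
    using chain_coeff_eq[of x i j y] that by simp
qed simp_all

lemma finite_generators: "finite (generators D i j)"
  using bij_betw_finite[OF positive_part_bij] finite_cells by blast

end

section \<open>From exactness to the vanishing of homology\<close>

context four_valent
begin

lemma lookup_differential:
  assumes "Poly_Mapping.keys x \<subseteq> generators D i j"
  shows "Poly_Mapping.lookup (differential D i j x) z =
    (if z \<in> generators D (i - 2) j then \<Sum>y\<in>generators D i j. Poly_Mapping.lookup x y * chain_coeff D y z else 0)"
proof -
  have inner: "Poly_Mapping.lookup (\<Sum>S'\<in>generators D (i - 2) j.
      frag_cmul ((-1) ^ t_exponent D S S' * incidence D S S') (frag_of S')) z =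
    (if z \<in> generators D (i - 2) j then chain_coeff D S z else 0)" for S
  proof -
    have "Poly_Mapping.lookup (\<Sum>S'\<in>generators D (i - 2) j.
      frag_cmul ((-1) ^ t_exponent D S S' * incidence D S S') (frag_of S')) z =
      (\<Sum>S'\<in>generators D (i - 2) j. if z = S' then chain_coeff D S S' else 0)"
      unfolding lookup_sum by (rule sum.cong) (auto simp: chain_coeff_def)
    thus ?thesis using finite_generators by simp
  qed
  have "Poly_Mapping.lookup (differential D i j x) z =
    (\<Sum>y\<in>Poly_Mapping.keys x. Poly_Mapping.lookup x y * (if z \<in> generators D (i - 2) j then chain_coeff D y z else 0))"
    unfolding differential_def frag_extend_def by (subst lookup_sum) (simp only: lookup_frag_cmul inner)
  also have "\<dots> = (\<Sum>y\<in>generators D i j. Poly_Mapping.lookup x y * (if z \<in> generators D (i - 2) j then chain_coeff D y z else 0))"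
    by (rule sum.mono_neutral_left) (use assms finite_generators in \<open>auto simp: in_keys_iff\<close>)
  finally show ?thesis by simp
qed

lemma kernel_subset_image:
  assumes ex: "exact_at (chain_coeff D) (generators D (i + 2) j) (generators D i j) (generators D (i - 2) j)"
    and f: "Poly_Mapping.keys f \<subseteq> generators D i j" "differential D i j f = 0"
  shows "f \<in> differential D (i + 2) j ` carrier (chain_group D (i + 2) j)"
proof -
  have "\<forall>z\<in>generators D (i - 2) j. (\<Sum>y\<in>generators D i j. Poly_Mapping.lookup f y * chain_coeff D y z) = 0"
  proof
    fix z assume "z \<in> generators D (i - 2) j"
    thus "(\<Sum>y\<in>generators D i j. Poly_Mapping.lookup f y * chain_coeff D y z) = 0"
      using lookup_differential[OF f(1), of z] f(2) by simp
  qed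
  then obtain h where h: "\<And>y. y \<in> generators D i j \<Longrightarrow>
      (\<Sum>x\<in>generators D (i + 2) j. h x * chain_coeff D x y) = Poly_Mapping.lookup f y"
    using ex unfolding exact_at_def by blast
  define g where "g = (\<Sum>S\<in>generators D (i + 2) j. frag_cmul (h S) (frag_of S))"
  have g: "Poly_Mapping.lookup g x = (if x \<in> generators D (i + 2) j then h x else 0)" for x
  proof -
    have "Poly_Mapping.lookup g x = (\<Sum>S\<in>generators D (i + 2) j. if x = S then h S else 0)"
      unfolding g_def lookup_sum by (rule sum.cong) auto
    thus ?thesis using finite_generators by simp
  qed
  have keys: "Poly_Mapping.keys g \<subseteq> generators D (i + 2) j" using g by (auto simp: in_keys_iff split: if_splits)
  have "differential D (i + 2) j g = f"
  proof (rule poly_mapping_eqI)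
    fix y
    have "Poly_Mapping.lookup f y = 0" if "y \<notin> generators D i j" using f(1) that by (auto simp: in_keys_iff)
    thus "Poly_Mapping.lookup (differential D (i + 2) j g) y = Poly_Mapping.lookup f y"
      using lookup_differential[OF keys, of y] h[of y] g by (simp cong: sum.cong)
  qed
  thus ?thesis using keys by (force simp: chain_group_def)
qed

lemma image_subgroup:
  "subgroup (differential D (i + 2) j ` carrier (chain_group D (i + 2) j)) (chain_group D i j)"
proof -
  interpret G: group "chain_group D i j" by (simp add: chain_group_def)
  show ?thesis
  proof (rule G.subgroupI)
    have "Poly_Mapping.keys (differential D (i + 2) j x) \<subseteq> generators D i j"
      if "Poly_Mapping.keys x \<subseteq> generators D (i + 2) j" for x
      using lookup_differential[OF that] by (auto simp: in_keys_iff split: if_splits)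
    thus sub: "differential D (i + 2) j ` carrier (chain_group D (i + 2) j) \<subseteq> carrier (chain_group D i j)"
      by (auto simp: chain_group_def)
    show "differential D (i + 2) j ` carrier (chain_group D (i + 2) j) \<noteq> {}"
      by (auto simp: chain_group_def free_Abelian_group_def intro: exI[of _ 0])
    fix a assume a: "a \<in> differential D (i + 2) j ` carrier (chain_group D (i + 2) j)"
    then obtain x where x: "a = differential D (i + 2) j x" "Poly_Mapping.keys x \<subseteq> generators D (i + 2) j"
      by (auto simp: chain_group_def)
    have "differential D (i + 2) j (- x) = - a" using x(1) by (simp add: differential_def frag_extend_minus)
    moreover have "inv\<^bsub>chain_group D i j\<^esub> a = - a" using a sub by (auto simp: chain_group_def)
    ultimately show "inv\<^bsub>chain_group D i j\<^esub> a \<in> differential D (i + 2) j ` carrier (chain_group D (i + 2) j)"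
      using x(2) by (intro image_eqI[of _ _ "- x"]) (simp_all add: chain_group_def)
    fix b assume "b \<in> differential D (i + 2) j ` carrier (chain_group D (i + 2) j)"
    then obtain y where y: "b = differential D (i + 2) j y" "Poly_Mapping.keys y \<subseteq> generators D (i + 2) j"
      by (auto simp: chain_group_def)
    have "differential D (i + 2) j (x + y) = a + b" using x(1) y(1) by (simp add: differential_def frag_extend_add)
    moreover have "Poly_Mapping.keys (x + y) \<subseteq> generators D (i + 2) j" using keys_add[of x y] x(2) y(2) by blast
    ultimately show "a \<otimes>\<^bsub>chain_group D i j\<^esub> b \<in> differential D (i + 2) j ` carrier (chain_group D (i + 2) j)"
      by (intro image_eqI[of _ _ "x + y"]) (simp_all add: chain_group_def)
  qed
qed

text \<open>
  As the cycles are boundaries, every coset of the boundaries in the group of cycles is the group of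
  boundaries itself.
\<close>

lemma homology_trivial:
  assumes ex: "exact_at (chain_coeff D) (generators D (i + 2) j) (generators D i j) (generators D (i - 2) j)"
  shows "trivial_group (khovanov_homology D i j)"
proof -
  let ?G = "chain_group D i j"
  let ?K = "subgroup_generated ?G (kernel ?G (chain_group D (i - 2) j) (differential D i j))"
  let ?I = "differential D (i + 2) j ` carrier (chain_group D (i + 2) j)"
  interpret G: group ?G by (simp add: chain_group_def)
  interpret I: subgroup ?I ?G by (rule image_subgroup)
  have "kernel ?G (chain_group D (i - 2) j) (differential D i j) \<subseteq> ?I"
    using kernel_subset_image[OF ex] by (auto simp: kernel_def chain_group_def)
  hence KI: "carrier ?K \<subseteq> ?I"
    unfolding carrier_subgroup_generated by (intro G.generate_subgroup_incl[OF _ image_subgroup]) blast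
  have coset: "?I #>\<^bsub>?K\<^esub> a = ?I" if "a \<in> ?I" for a
  proof -
    have "?I #>\<^bsub>?K\<^esub> a = ?I #>\<^bsub>?G\<^esub> a" by (simp add: r_coset_def)
    also have "\<dots> = ?I" using that by (rule I.rcos_const[OF G.is_group])
    finally show ?thesis .
  qed
  have "\<one>\<^bsub>?G\<^esub> \<in> carrier ?K" unfolding carrier_subgroup_generated by (rule generate.one)
  hence car: "carrier (?K Mod ?I) = {?I}"
    unfolding carrier_FactGroup using coset KI by blast
  have mult: "?I <#>\<^bsub>?K\<^esub> ?I = ?I"
  proof -
    have "?I <#>\<^bsub>?K\<^esub> ?I = ?I <#>\<^bsub>?G\<^esub> ?I" by (simp add: set_mult_def)
    also have "\<dots> = ?I" by (rule G.subgroup_mult_id[OF image_subgroup])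
    finally show ?thesis .
  qed
  have "group (?K Mod ?I)"
    by (rule groupI) (auto simp: car mult)
  thus ?thesis unfolding khovanov_homology_def trivial_group_def using car by simp
qed

end

theorem corollary5p5:
  fixes D :: link_diagram
  assumes "is_link_diagram D"
    and "alternating D"
    and "non_split D"
    and "\<not> (\<exists>c\<in>crossings D. nugatory D c)"
  shows "H_thick2 D 0 0 \<and> H_thick D 1"
proof -
  interpret turaev_genus_zero D by (rule alternating_turaev_genus_zero[OF assms(1-3)])
  let ?N = "int (card (crossings D))"
  let ?p = "int (card (circles D (s_plus D)))" and ?m = "int (card (circles D (s_minus D)))"
  have "circles D (s_plus D) = components D (s_plus D)"
    by (rule circles_eq_components) (auto simp: s_plus_def kauffman_states_def)
  also have "\<dots> = components D (fill 1 (\<lambda>_. 0))" by (rule components_cong) (auto simp: s_plus_def fill_def)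
  finally have P: "circles D (s_plus D) = components D (fill 1 (\<lambda>_. 0))" .
  have "circles D (s_minus D) = components D (s_minus D)"
    by (rule circles_eq_components) (auto simp: s_minus_def kauffman_states_def)
  also have "\<dots> = components D (fill (-1) (\<lambda>_. 0))" by (rule components_cong) (auto simp: s_minus_def fill_def)
  finally have M: "circles D (s_minus D) = components D (fill (-1) (\<lambda>_. 0))" .
  have U: "unresolved D (\<lambda>_. 0) = crossings D" by (simp add: unresolved_def)
  have ps: "partial_state D (\<lambda>_. 0)" by (simp add: partial_state_def)
  have sum: "?p + ?m = ?N + 2 * int (card (components D (\<lambda>_. 0)))"
    using extreme_components[OF ps] unfolding P M U .
  have top: "top_diagonal D (\<lambda>_. 0) = 2 * ?p - ?N" by (simp add: top_diagonal_def P U)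
  have exact: "exact_at (coeff D) (cells D (\<lambda>_. 0) (i + 2) j) (cells D (\<lambda>_. 0) i j) (cells D (\<lambda>_. 0) (i - 2) j)"
    if out: "\<not> (?N - 2 * ?m \<le> j - 2 * i \<and> j - 2 * i \<le> 2 * ?p - ?N)" for i j
  proof (cases "arcs D = {}")
    case True
    hence C: "crossings D = {}" using arc_in[of _ 0] by auto
    have "components D s = {}" for s using True by (simp add: components_def)
    hence "cells D (\<lambda>_. 0) i j = {}" using out unfolding P M by (auto simp: cells_def degree_def C)
    thus ?thesis by (simp add: exact_at_def)
  next
    case False
    hence one: "card (components D (\<lambda>_. 0)) = 1" using non_split_components[OF assms(1,3)] by simp
    show ?thesis by (rule cells_exact[OF ps one]) (use out sum one in \<open>simp add: top\<close>)
  qed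
  have thin: "H_thick2 D 0 0"
    unfolding H_thick2_def
    using homology_trivial[OF generators_exact[OF exact]] by simp
  have "card (components D (\<lambda>_. 0)) \<le> 1"
    using non_split_components[OF assms(1,3)] by (cases "arcs D = {}") (simp_all add: components_def)
  hence "?p + ?m \<le> ?N + 2" using sum by simp
  hence "real_of_int (?p + ?m) \<le> real_of_int (?N + 2)" by (rule of_int_le_iff[THEN iffD2])
  hence "(real (card (circles D (s_plus D))) + real (card (circles D (s_minus D))) - real (card (crossings D))) / 2 \<le> 1"
    by simp
  hence "H_thick D 1" unfolding H_thick_def using thin by (intro exI[of _ 0]) simp
  thus ?thesis using thin by simp
qed

end
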